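(* Let $B^H=\{B^H(t),\,t\in\mathbb{R}_+^N\}$ be a fractional Brownian sheet in $\mathbb{R}^d$ with index $H=(H_1,\ldots,H_N)\in(0,1)^N$. If $d<\sum_{\ell=1}^N \frac{1}{H_\ell}$, then for all intervals $I\in\mathcal{A}$, $B^H$ has a jointly continuous local time on $I$ almost surely.
   Context: Write $\mathbb{R}_+^N=[0,\infty)^N$. For $s,t\in\mathbb{R}^N$ with $s_j<t_j$ for all $j$, $[s,t]=\prod_{j=1}^N[s_j,t_j]$; $\mathcal{A}$ denotes the class of all such closed intervals contained in $(0,\infty)^N$. $\lambda_m$ is Lebesgue measure on $\mathbb{R}^m$. Fractional Brownian sheet: for $H=(H_1,\ldots,H_N)\in(0,1)^N$, a real-valued fractional Brownian sheet $B_0^H=\{B_0^H(t),t\in\mathbb{R}_+^N\}$ is a centered Gaussian random field with covariance $$\mathbb{E}[B_0^H(s)B_0^H(t)]=\prod_{\ell=1}^N\frac12\left(s_\ell^{2H_\ell}+t_\ell^{2H_\ell}-|s_\ell-t_\ell|^{2H_\ell}\right).$$ A fractional Brownian sheet in $\mathbb{R}^d$ (an $(N,d)$-fractional Brownian sheet) with index $H$ is $B^H(t)=(B_1^H(t),\ldots,B_d^H(t))$, where $B_1^H,\ldots,B_d^H$ are independent copies of $B_0^H$. Local times: for a Borel vector field $X$ on $\mathbb{R}^N$ (or $\mathbb{R}^N_+$) with values in $\mathbb{R}^d$ and a Borel set $T$, the occupation measure is $\mu_T(\bullet)=\lambda_N\{t\in T: X(t)\in\bullet\}$. If $\mu_T\ll\lambda_d$,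 $X$ is said to have local times on $T$, and the local time is $L(x,T)=\frac{d\mu_T}{d\lambda_d}(x)$, $x\in\mathbb{R}^d$. For $I=\prod_{i=1}^N[a_i,a_i+h_i]\in\mathcal{A}$, $X$ is said to have a jointly continuous local time on $I$ if one can choose a version of the local time, still denoted $L(x,\prod_{i=1}^N[a_i,a_i+t_i])$, which is a continuous function of $(x,t_1,\ldots,t_N)\in\mathbb{R}^d\times\prod_{i=1}^N[0,h_i]$.
   Formalization: The fractional Brownian sheet is also assumed jointly measurable in (t, ω), which holds for its continuous version; with only the covariance and Borel paths the claim fails, e.g. for a version whose paths all vanish off countable sets. *)

theory Defs
  imports "HOL-Probability.Probability"
begin

definition orthant :: "(real ^ 'n) set" where
  "orthant = {t. \<forall>i. 0 \<le> t $ i}"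

definition pos_intervals :: "(real ^ 'n) set set" where
  "pos_intervals =
     {cbox s t | s t. (\<forall>i. s $ i < t $ i) \<and> cbox s t \<subseteq> {x. \<forall>i. 0 < x $ i}}"

text \<open>Constants count as (degenerate) Gaussian variables; this is needed because a fractional
  Brownian sheet vanishes on the coordinate hyperplanes.\<close>

definition gaussian_rv :: "'w measure \<Rightarrow> ('w \<Rightarrow> real) \<Rightarrow> bool" where
  "gaussian_rv M X \<longleftrightarrow>
     X \<in> borel_measurable M \<and>
     ((\<exists>m \<sigma>. 0 < \<sigma> \<and> distributed M lborel X (normal_density m \<sigma>)) \<or>
      (\<exists>m. AE w in M. X w = m))"

definition centered_gaussian_field ::
    "'w measure \<Rightarrow> 'i set \<Rightarrow> ('i \<Rightarrow> 'w \<Rightarrow> real) \<Rightarrow> bool" where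
  "centered_gaussian_field M T X \<longleftrightarrow>
     (\<forall>S c. finite S \<and> S \<subseteq> T \<longrightarrow> gaussian_rv M (\<lambda>w. \<Sum>t\<in>S. c t * X t w)) \<and>
     (\<forall>t\<in>T. integral\<^sup>L M (X t) = 0)"

definition fbs_cov :: "real ^ 'n \<Rightarrow> real ^ 'n \<Rightarrow> real ^ 'n \<Rightarrow> real" where
  "fbs_cov H s t =
     (\<Prod>l\<in>UNIV. 1 / 2 * ((s $ l) powr (2 * H $ l) + (t $ l) powr (2 * H $ l)
                          - \<bar>s $ l - t $ l\<bar> powr (2 * H $ l)))"

definition real_fbs :: "'w measure \<Rightarrow> real ^ 'n \<Rightarrow> (real ^ 'n \<Rightarrow> 'w \<Rightarrow> real) \<Rightarrow> bool" where
  "real_fbs M H X \<longleftrightarrow>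
     centered_gaussian_field M orthant X \<and>
     (\<forall>s\<in>orthant. \<forall>t\<in>orthant. integral\<^sup>L M (\<lambda>w. X s w * X t w) = fbs_cov H s t)"

text \<open>Independence of the coordinate processes is independence of the random elements of the
  product space \<open>\<real>\<^sup>T\<close>, \<open>T\<close> the closed orthant, with its product \<open>\<sigma>\<close>-algebra. Values of \<open>B\<close> at
  parameters outside the orthant are irrelevant.\<close>

definition fractional_brownian_sheet ::
    "'w measure \<Rightarrow> real ^ 'n \<Rightarrow> (real ^ 'n \<Rightarrow> 'w \<Rightarrow> real ^ 'd) \<Rightarrow> bool" where
  "fractional_brownian_sheet M H B \<longleftrightarrow>
     (\<forall>j. real_fbs M H (\<lambda>t w. B t w $ j)) \<and>
     prob_space.indep_vars M (\<lambda>_. \<Pi>\<^sub>M t\<in>orthant. borel) (\<lambda>j w. \<lambda>t\<in>orthant. B t w $ j) UNIV"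

definition occupation_measure ::
    "(real ^ 'n \<Rightarrow> real ^ 'd) \<Rightarrow> (real ^ 'n) set \<Rightarrow> (real ^ 'd) measure" where
  "occupation_measure X T = distr (restrict_space lborel T) borel X"

text \<open>The measurability conjunct is not redundant: \<^const>\<open>distr\<close> along a non-measurable function
  may be the null measure. In \<open>is_local_time\<close>, nonnegativity has to be stated separately because
  \<^const>\<open>ennreal\<close> sends negative numbers to \<open>0\<close>.\<close>

definition has_local_times :: "(real ^ 'n \<Rightarrow> real ^ 'd) \<Rightarrow> (real ^ 'n) set \<Rightarrow> bool" where
  "has_local_times X T \<longleftrightarrow>
     X \<in> borel_measurable (restrict_space borel T) \<and>
     absolutely_continuous lborel (occupation_measure X T)"

definition is_local_time ::
    "(real ^ 'n \<Rightarrow> real ^ 'd) \<Rightarrow> (real ^ 'n) set \<Rightarrow> (real ^ 'd \<Rightarrow> real) \<Rightarrow> bool" where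
  "is_local_time X T l \<longleftrightarrow>
     has_local_times X T \<and> l \<in> borel_measurable borel \<and>
     (AE x in lborel. 0 \<le> l x \<and> ennreal (l x) = RN_deriv lborel (occupation_measure X T) x)"

definition jointly_continuous_local_time ::
    "(real ^ 'n \<Rightarrow> real ^ 'd) \<Rightarrow> (real ^ 'n) set \<Rightarrow> bool" where
  "jointly_continuous_local_time X I \<longleftrightarrow>
     (\<exists>a h. (\<forall>i. 0 < h $ i) \<and> I = cbox a (a + h) \<and>
        (\<exists>L :: real ^ 'd \<Rightarrow> real ^ 'n \<Rightarrow> real.
           (\<forall>t\<in>cbox 0 h. is_local_time X (cbox a (a + t)) (\<lambda>x. L x t)) \<and>
           continuous_on (UNIV \<times> cbox 0 h) (\<lambda>(x, t). L x t)))"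

end

theory Submission
  imports Defs
begin

text \<open>Fix a mollifier \<open>\<Phi>\<^sub>r\<close> on \<open>\<real>\<^sup>d\<close> at scale \<open>1/r\<close> and smooth the occupation measure to
  \<open>L\<^sub>r(x, t) = \<integral> \<Phi>\<^sub>r (B(s) - x) ds\<close>, the integral being over \<open>[a, a + t]\<close>. Each \<open>L\<^sub>r\<close> is
  Lipschitz with a constant polynomial in \<open>r\<close>, so if all moments of \<open>L\<^sub>2\<^sub>r - L\<^sub>r\<close> at single points
  decay like \<open>r powr (- \<gamma> n)\<close>, then a union bound over a grid of polynomial size makes the \<open>L\<^sub>r\<close>, with
  \<open>r = 2 ^ k\<close>, almost surely locally uniformly Cauchy. The limit is the jointly continuous local time;
  no moments of increments in \<open>x\<close> or \<open>t\<close> are needed.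

  By Fourier inversion the \<open>n\<close>-th moment is bounded by the integral over \<open>(s\<^sub>1, \<dots>, s\<^sub>n)\<close> of the \<open>d\<close>-th
  power of a Gaussian integral \<open>\<integral> \<Prod>\<^sub>j (1 + \<bar>\<xi>\<^sub>j\<bar> powr \<gamma>) exp (- Var (\<Sum>\<^sub>j \<xi>\<^sub>j B\<^sub>0(s\<^sub>j)) / 2) d\<xi>\<close>. Sectorial
  local nondeterminism bounds the variance below by \<open>\<xi>\<^sub>j\<^sup>2\<close> times a power of the distance, measured in
  any one coordinate, from \<open>s\<^sub>j\<close> to the other points. Ordering the points by one coordinate, this
  dominates the Gaussian integral by a product over \<open>j\<close> and over coordinates \<open>l\<close> of
  \<open>1 + \<Sum>\<^sub>k \<bar>s\<^sub>j\<^sub>l - s\<^sub>k\<^sub>l\<bar> powr (- \<eta>)\<close> with \<open>\<eta> = d / (\<Sum>\<^sub>l 1 / H\<^sub>l) + 2 \<gamma> d\<close>, and \<open>\<eta> < 1\<close> for small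
  \<open>\<gamma>\<close> exactly because \<open>d < \<Sum>\<^sub>l 1 / H\<^sub>l\<close>.

  Local nondeterminism follows by duality: a tent function has an explicit Fourier transform, which
  decays just fast enough to have finite energy for every Hurst index below \<open>1\<close>.\<close>

section \<open>Harmonizable representation and tent functions\<close>

text \<open>Two different separations are at work. A polynomial weight in one frequency has to be
  absorbed while all other frequencies are free, so there local nondeterminism gives only the
  distance to all other points. Eliminating the frequencies one by one needs only the distance to
  earlier points, and a kernel singular in these alone can be integrated from the last point
  backwards. The first distance enters with the small power \<gamma> and is exchanged for the second
  at the price of doubling its exponent, whence the \<open>2 * \<gamma> * d\<close> in \<eta>. The
  same exchange for the main exponent would double it as well, more than the dimension condition
  allows.

  Duality means the following: if \<open>C * K - g g\<close> is positive semidefinite for a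
  covariance K, that is, g has squared norm at most C in the reproducing kernel Hilbert space of K,
  and g is 1 at one point and 0 at the others, then the variance is at least the squared coefficient
  of that point divided by C. Tensor products of such g serve the product covariance. The sheet
  vanishes on the coordinate hyperplanes, so the tents must stay away from them; this is how the
  lower bound \<alpha> of the coordinates enters.\<close>

lemma integrable_indicator_has_integral:
  fixes f :: "real \<Rightarrow> real"
  assumes "f \<in> borel_measurable borel" "A \<in> sets borel" "\<And>x. x \<in> A \<Longrightarrow> 0 \<le> f x" "(f has_integral I) A"
  shows "integrable lborel (\<lambda>x. indicator A x * f x)"
proof (rule integrableI_nonneg)
  show "(\<integral>\<^sup>+ x. ennreal (indicator A x * f x) \<partial>lborel) < \<infinity>"
    using nn_integral_has_integral_lebesgue[of A f I] assms by simp
qed (use assms in \<open>auto simp: indicator_def\<close>)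

lemma integrable_lborel_even:
  fixes f :: "real \<Rightarrow> real"
  assumes "integrable lborel (\<lambda>x. indicator {0..} x * f x)" "\<And>x. f (- x) = f x"
  shows "integrable lborel f"
  using has_bochner_integral_even_function[of f "LBINT x. indicator {0..} x * f x"] assms
  by (auto simp: has_bochner_integral_iff)

lemma one_minus_cos_le_sq: "1 - cos x \<le> x\<^sup>2 / 2" for x :: real
proof -
  have "1 - cos x = 2 * (sin (x / 2))\<^sup>2"
    using cos_double_sin[of "x/2"] by simp
  moreover have "\<bar>sin (x/2)\<bar>\<^sup>2 \<le> \<bar>x/2\<bar>\<^sup>2"
    by (intro power_mono abs_sin_x_le_abs_x) auto
  ultimately show ?thesis by (simp add: power_divide)
qed

text \<open>Both ends of the range of H are used: on [0, 1] the integrand is at most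
  \<open>x powr (1 - 2*H)\<close>, integrable as H < 1, and beyond 1 at most
  \<open>2 * x powr (-1 - 2*H)\<close>, integrable as H > 0.\<close>

lemma integrable_one_minus_cos:
  assumes H: "0 < H" "H < (1::real)"
  shows "integrable lborel (\<lambda>x. (1 - cos x) * \<bar>x\<bar> powr (-1 - 2*H))"
proof (rule integrable_lborel_even)
  let ?f = "\<lambda>x::real. (1 - cos x) * \<bar>x\<bar> powr (-1 - 2*H)"
  have 1: "integrable lborel (\<lambda>x. indicator {0..1} x * x powr (1 - 2*H))"
    using has_integral_powr_from_0[of "1 - 2*H" 1] H
    by (intro integrable_indicator_has_integral) auto
  have 2: "integrable lborel (\<lambda>x. indicator {1..} x * x powr (-1 - 2*H))"
    using has_integral_powr_to_inf[of "-1 - 2*H" 1] H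
    by (intro integrable_indicator_has_integral) auto
  show "integrable lborel (\<lambda>x. indicator {0..} x * ?f x)"
  proof (rule Bochner_Integration.integrable_bound)
    show "integrable lborel (\<lambda>x. indicator {0..1} x * x powr (1 - 2*H) + 2
        * (indicator {1..} x * x powr (-1 - 2*H)))"
      using 1 2 by auto
    show "AE x in lborel. norm (indicator {0..} x * ?f x) \<le>
       norm (indicator {0..1} x * x powr (1 - 2*H) + 2 * (indicator {1..} x * x powr (-1 - 2*H)))"
    proof (intro AE_I2)
      fix x :: real
      consider "x < 0" | "x = 0" | "0 < x" "x < 1" | "1 \<le> x" by linarith
      then show "norm (indicator {0..} x * ?f x) \<le>
       norm (indicator {0..1} x * x powr (1 - 2*H) + 2 * (indicator {1..} x * x powr (-1 - 2*H)))"
      proof cases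
        case 3
        have "(1 - cos x) * x powr (-1 - 2*H) \<le> x\<^sup>2 * x powr (-1 - 2*H)"
          using one_minus_cos_le_sq[of x] zero_le_power2[of x] by (intro mult_right_mono; linarith?) simp
        also have "\<dots> = x powr (1 - 2*H)"
          using 3 powr_add[of x 2 "-1 - 2*H"] by simp
        finally show ?thesis using 3 by (simp add: abs_mult)
      next
        case 4
        have "- cos 1 \<le> (2::real)" using cos_ge_minus_one[of "1::real"] by linarith
        moreover have "(1 - cos x) * x powr (-1 - 2*H) \<le> 2 * x powr (-1 - 2*H)"
          using cos_ge_minus_one[of x] by (intro mult_right_mono) auto
        ultimately show ?thesis using 4 by (cases "x = 1") (auto simp: abs_mult)
      qed auto
    qed
  qed auto
qed auto

text \<open>Normalisation of the spectral density \<open>\<bar>x\<bar> powr (-1 - 2*H)\<close> of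
  fractional Brownian motion. Its value at H = 1/2 also normalises the Fourier transform of the
  tent.\<close>

definition cos_const :: "real \<Rightarrow> real" where
  "cos_const H = (LBINT x. (1 - cos x) * \<bar>x\<bar> powr (-1 - 2*H))"

lemma cos_const_pos:
  assumes H: "0 < H" "H < (1::real)"
  shows "0 < cos_const H"
proof -
  let ?f = "\<lambda>x::real. (1 - cos x) * \<bar>x\<bar> powr (-1 - 2*H)"
  have cos1: "cos 1 < (1::real)"
    using cos_monotone_0_pi[of 0 1] pi_gt3 by simp
  \<comment> \<open>A lower bound of the integrand on [1, 2], where the cosine decreases and the
    power is smallest at 2.\<close>
  define c :: real where "c = (1 - cos 1) * 2 powr (-1 - 2*H)"
  have c: "0 < c" using cos1 by (simp add: c_def)
  have "c = (LBINT x. c * indicator {1..2::real} x)" by simp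
  also have "\<dots> \<le> cos_const H"
    unfolding cos_const_def
  proof (rule integral_mono)
    fix x :: real
    show "c * indicator {1..2} x \<le> ?f x"
    proof (cases "x \<in> {1..2}")
      case True
      have "cos x \<le> cos 1"
        using True pi_gt3 by (intro cos_monotone_0_pi_le) auto
      moreover have "2 powr (-1 - 2*H) \<le> x powr (-1 - 2*H)"
        using True H by (intro powr_mono2') auto
      ultimately show ?thesis
        using True cos1 unfolding c_def by (auto intro!: mult_mono)
    qed auto
  next
    show "integrable lborel ?f" by (rule integrable_one_minus_cos[OF H])
  qed auto
  finally show ?thesis using c by linarith
qed

lemma has_bochner_integral_one_minus_cos_scaled:
  assumes H: "0 < H" "H < (1::real)"
  shows "has_bochner_integral lborel (\<lambda>x. (1 - cos (t * x)) * \<bar>x\<bar> powr (-1 - 2*H)) (\<bar>t\<bar> powr (2*H)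
      * cos_const H)"
proof (cases "t = 0")
  case False
  let ?p = "-1 - 2*H"
  have eq: "(1 - cos (0 + t * x)) * \<bar>0 + t * x\<bar> powr ?p = \<bar>t\<bar> powr ?p
      * ((1 - cos (t * x)) * \<bar>x\<bar> powr ?p)" for x
    by (simp add: abs_mult powr_mult)
  have "integrable lborel (\<lambda>x. \<bar>t\<bar> powr ?p * ((1 - cos (t * x)) * \<bar>x\<bar> powr ?p))"
    using lborel_integrable_real_affine[OF integrable_one_minus_cos[OF H] False, of 0] unfolding eq .
  then have int: "integrable lborel (\<lambda>x. (1 - cos (t * x)) * \<bar>x\<bar> powr ?p)"
    using False by (subst (asm) integrable_mult_left_iff) auto
  have "cos_const H = \<bar>t\<bar> * (\<bar>t\<bar> powr ?p * (LBINT x. (1 - cos (t * x)) * \<bar>x\<bar> powr ?p))"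
    unfolding cos_const_def by (subst lborel_integral_real_affine[OF False, of _ 0])
        (simp only: eq, simp)
  also have "\<dots> = \<bar>t\<bar> powr (-2*H) * (LBINT x. (1 - cos (t * x)) * \<bar>x\<bar> powr ?p)"
    using False powr_add[of "\<bar>t\<bar>" 1 ?p] by simp
  finally have "\<bar>t\<bar> powr (2*H) * cos_const H = (\<bar>t\<bar> powr (2*H) * \<bar>t\<bar> powr (-2*H))
      * (LBINT x. (1 - cos (t * x)) * \<bar>x\<bar> powr ?p)"
    by simp
  then have "\<bar>t\<bar> powr (2*H) * cos_const H = (LBINT x. (1 - cos (t * x)) * \<bar>x\<bar> powr ?p)"
    using False by (simp flip: powr_add)
  then show ?thesis using int by (simp add: has_bochner_integral_iff)
qed (simp add: has_bochner_integral_zero)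

definition fbm_cov :: "real \<Rightarrow> real \<Rightarrow> real \<Rightarrow> real" where
  "fbm_cov H s t = 1 / 2 * (s powr (2 * H) + t powr (2 * H) - \<bar>s - t\<bar> powr (2 * H))"

text \<open>The bracket is the real part of 1 - exp(isx) times the conjugate of 1 - exp(itx), and it
  equals (1 - cos sx) + (1 - cos tx) - (1 - cos (s-t)x), so scaling evaluates each piece. The two
  real features 1 - cos and sin exhibit the covariance as a Gram kernel.\<close>

lemma fbm_cov_harmonizable:
  assumes H: "0 < H" "H < (1::real)" and st: "0 \<le> s" "0 \<le> t"
  shows "has_bochner_integral lborel
    (\<lambda>x. ((1 - cos (s * x)) * (1 - cos (t * x)) + sin (s * x) * sin (t * x)) * \<bar>x\<bar> powr (-1 - 2*H))
    (2 * cos_const H * fbm_cov H s t)"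
proof -
  note S = has_bochner_integral_one_minus_cos_scaled[OF H]
  have "has_bochner_integral lborel
    (\<lambda>x. (1 - cos (s * x)) * \<bar>x\<bar> powr (-1 - 2*H) + (1 - cos (t * x)) * \<bar>x\<bar> powr (-1 - 2*H)
        - (1 - cos ((s - t) * x)) * \<bar>x\<bar> powr (-1 - 2*H))
    (\<bar>s\<bar> powr (2*H) * cos_const H + \<bar>t\<bar> powr (2*H) * cos_const H - \<bar>s-t\<bar> powr (2*H) * cos_const H)"
    by (intro has_bochner_integral_add has_bochner_integral_diff S)
  also have "(\<lambda>x. (1 - cos (s * x)) * \<bar>x\<bar> powr (-1 - 2*H) + (1 - cos (t * x)) * \<bar>x\<bar> powr (-1 - 2*H)
        - (1 - cos ((s - t) * x)) * \<bar>x\<bar> powr (-1 - 2*H)) =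
     (\<lambda>x. ((1 - cos (s * x)) * (1 - cos (t * x)) + sin (s * x) * sin (t * x)) * \<bar>x\<bar> powr (-1 - 2*H))"
    by (simp add: fun_eq_iff left_diff_distrib cos_diff algebra_simps)
  also have "\<bar>s\<bar> powr (2*H) * cos_const H + \<bar>t\<bar> powr (2*H) * cos_const H - \<bar>s-t\<bar> powr (2*H) * cos_const H
     = 2 * cos_const H * fbm_cov H s t"
    using st by (simp add: fbm_cov_def algebra_simps)
  finally show ?thesis .
qed

section \<open>The tent function, its Fourier transform and its energy\<close>

definition tent :: "real \<Rightarrow> real" where "tent x = max 0 (1 - \<bar>x\<bar>)"

text \<open>Up to normalisation the Fourier transform of \<open>tent\<close>. Written with
  \<open>powr\<close> it is the integrand of \<open>cos_const (1/2)\<close>, which supplies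
  integrability and scaling.\<close>

definition fejer :: "real \<Rightarrow> real" where "fejer x = (1 - cos x) * \<bar>x\<bar> powr (-2)"

text \<open>At \<open>0\<close>, where the continuous extension is \<open>1/2\<close>, the value is \<open>0\<close>; this is a null set.\<close>

lemma fejer_eq: "fejer x = (1 - cos x) / x\<^sup>2"
  by (cases "x = 0") (auto simp: fejer_def powr_minus divide_inverse)

lemma fejer_nonneg: "0 \<le> fejer x" by (simp add: fejer_def)

lemma fejer_minus [simp]: "fejer (- x) = fejer x" by (simp add: fejer_def)

lemma fejer_le_half: "fejer x \<le> 1 / 2"
  using one_minus_cos_le_sq[of x] by (cases "x = 0") (auto simp: fejer_eq divide_simps)

lemma borel_measurable_fejer [measurable]: "fejer \<in> borel_measurable borel"
  unfolding fejer_def by measurable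

lemma integrable_fejer: "integrable lborel fejer"
  using integrable_one_minus_cos[of "1/2"] unfolding fejer_def[abs_def] by simp

text \<open>The tent is half a second difference of the absolute value, which is what the scaling
  formula produces at H = 1/2. On the other side, half the same second difference of 1 - cos(yx) in
  y is (1 - cos x) cos(yx).\<close>

lemma tent_fourier:
  "has_bochner_integral lborel (\<lambda>x. fejer x * cos (y * x)) (cos_const (1/2) * tent y)"
proof -
  note S = has_bochner_integral_one_minus_cos_scaled[of "1/2", simplified]
  have "has_bochner_integral lborel
     (\<lambda>x. 1/2 * ((1 - cos ((1 + y) * x)) * \<bar>x\<bar> powr -2 + (1 - cos ((1 - y) * x)) * \<bar>x\<bar> powr -2)
        - (1 - cos (y * x)) * \<bar>x\<bar> powr -2)
     (1/2 * (\<bar>1 + y\<bar> * cos_const (1/2) + \<bar>1 - y\<bar> * cos_const (1/2)) - \<bar>y\<bar> * cos_const (1/2))"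
    using S by (intro has_bochner_integral_add has_bochner_integral_diff
        has_bochner_integral_mult_right) auto
  also have "(\<lambda>x. 1/2 * ((1 - cos ((1 + y) * x)) * \<bar>x\<bar> powr -2 + (1 - cos ((1 - y) * x)) * \<bar>x\<bar> powr -2)
        - (1 - cos (y * x)) * \<bar>x\<bar> powr -2) = (\<lambda>x. fejer x * cos (y * x))"
    by (simp add: fejer_def fun_eq_iff ring_distribs cos_diff cos_add)
  also have "1/2 * (\<bar>1 + y\<bar> * cos_const (1/2) + \<bar>1 - y\<bar> * cos_const (1/2)) - \<bar>y\<bar> * cos_const (1/2)
     = cos_const (1/2) * (1/2 * (\<bar>1 + y\<bar> + \<bar>1 - y\<bar>) - \<bar>y\<bar>)"
    by (simp add: algebra_simps)
  also have "1/2 * (\<bar>1 + y\<bar> + \<bar>1 - y\<bar>) - \<bar>y\<bar> = tent y"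
    by (auto simp: tent_def max_def abs_if)
  finally show ?thesis .
qed

lemma fbm_cov_scale:
  assumes "0 < r" "0 \<le> s" "0 \<le> t"
  shows "fbm_cov H (s / r) (t / r) = r powr (-2 * H) * fbm_cov H s t"
proof -
  have "\<bar>s / r - t / r\<bar> = \<bar>s - t\<bar> / r" using assms
      by (simp add: diff_divide_distrib flip: diff_divide_distrib)
  then show ?thesis using assms
    by (simp add: fbm_cov_def powr_divide powr_minus field_simps)
qed

text \<open>Energy of the tent with respect to the inverse spectral density. Bounding one of the two
  factors \<open>1 - cos x\<close> by 2 leaves the integrand of
  \<open>cos_const (1 - H)\<close>.\<close>

lemma integrable_fejer_sq:
  assumes H: "0 < H" "H < (1::real)"
  shows "integrable lborel (\<lambda>x. (fejer x)\<^sup>2 * \<bar>x\<bar> powr (1 + 2*H))"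
proof (rule Bochner_Integration.integrable_bound)
  show "integrable lborel (\<lambda>x. 2 * ((1 - cos x) * \<bar>x\<bar> powr (-1 - 2 * (1 - H))))"
    using integrable_one_minus_cos[of "1 - H"] H by (intro integrable_mult_right) auto
  have "(fejer x)\<^sup>2 * \<bar>x\<bar> powr (1 + 2*H) \<le> 2 * ((1 - cos x) * \<bar>x\<bar> powr (-1 - 2 * (1 - H)))" for x
  proof (cases "x = 0")
    case False
    have "(fejer x)\<^sup>2 * \<bar>x\<bar> powr (1 + 2*H) = (1 - cos x)\<^sup>2 * (\<bar>x\<bar> powr -2 * \<bar>x\<bar> powr -2
        * \<bar>x\<bar> powr (1 + 2*H))"
      by (simp add: fejer_def power2_eq_square)
    also have "\<bar>x\<bar> powr -2 * \<bar>x\<bar> powr -2 * \<bar>x\<bar> powr (1 + 2*H) = \<bar>x\<bar> powr (-1 - 2 * (1 - H))"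
      unfolding powr_add[symmetric] by (rule arg_cong[where f="\<lambda>a. \<bar>x\<bar> powr a"]) simp
    also have "(1 - cos x)\<^sup>2 * \<bar>x\<bar> powr (-1 - 2 * (1 - H)) \<le> (2 * (1 - cos x))
        * \<bar>x\<bar> powr (-1 - 2 * (1 - H))"
      unfolding power2_eq_square by (intro mult_right_mono) auto
    also have "\<dots> = 2 * ((1 - cos x) * \<bar>x\<bar> powr (-1 - 2 * (1 - H)))" by (rule mult.assoc)
    finally show ?thesis .
  qed (simp add: fejer_def)
  then show "AE x in lborel. norm ((fejer x)\<^sup>2 * \<bar>x\<bar> powr (1 + 2*H))
      \<le> norm (2 * ((1 - cos x) * \<bar>x\<bar> powr (-1 - 2 * (1 - H))))"
    by (intro AE_I2) (simp add: abs_mult)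
qed auto

lemma integrable_mult_of_squares:
  fixes f g :: "'a \<Rightarrow> real"
  assumes [measurable]: "f \<in> borel_measurable M" "g \<in> borel_measurable M"
    and f: "integrable M (\<lambda>x. (f x)\<^sup>2)" and g: "integrable M (\<lambda>x. (g x)\<^sup>2)"
  shows "integrable M (\<lambda>x. f x * g x)"
proof (rule Bochner_Integration.integrable_bound)
  show "integrable M (\<lambda>x. (f x)\<^sup>2 + (g x)\<^sup>2)" using f g by auto
  show "AE x in M. norm (f x * g x) \<le> norm ((f x)\<^sup>2 + (g x)\<^sup>2)"
  proof (intro AE_I2)
    fix x
    have "2 * (\<bar>f x\<bar> * \<bar>g x\<bar>) \<le> \<bar>f x\<bar>\<^sup>2 + \<bar>g x\<bar>\<^sup>2"
      using sum_squares_bound[of "\<bar>f x\<bar>" "\<bar>g x\<bar>"] by simp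
    then have "\<bar>f x\<bar> * \<bar>g x\<bar> \<le> \<bar>f x\<bar>\<^sup>2 + \<bar>g x\<bar>\<^sup>2" using mult_nonneg_nonneg[of "\<bar>f x\<bar>" "\<bar>g x\<bar>"] by linarith
    then show "norm (f x * g x) \<le> norm ((f x)\<^sup>2 + (g x)\<^sup>2)" by (simp add: abs_mult)
  qed
qed auto

lemma integral_Cauchy_Schwarz:
  fixes f g :: "'a \<Rightarrow> real"
  assumes [measurable]: "f \<in> borel_measurable M" "g \<in> borel_measurable M"
    and f: "integrable M (\<lambda>x. (f x)\<^sup>2)" and g: "integrable M (\<lambda>x. (g x)\<^sup>2)"
  shows "(LINT x|M. f x * g x)\<^sup>2 \<le> (LINT x|M. (f x)\<^sup>2) * (LINT x|M. (g x)\<^sup>2)"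
proof -
  have fg: "integrable M (\<lambda>x. f x * g x)" by (rule integrable_mult_of_squares[OF assms])
  let ?A = "LINT x|M. (f x)\<^sup>2" and ?B = "LINT x|M. (g x)\<^sup>2" and ?C = "LINT x|M. f x * g x"
  have quad: "0 \<le> a\<^sup>2 * ?A - 2 * (a * b * ?C) + b\<^sup>2 * ?B" for a b
  proof -
    have "0 \<le> (LINT x|M. (a * f x - b * g x)\<^sup>2)" by simp
    also have "(\<lambda>x. (a * f x - b * g x)\<^sup>2) = (\<lambda>x. a\<^sup>2 * (f x)\<^sup>2 - 2 * a * b * (f x * g x) + b\<^sup>2 * (g x)\<^sup>2)"
      by (simp add: fun_eq_iff power2_eq_square algebra_simps)
    also have "(LINT x|M. a\<^sup>2 * (f x)\<^sup>2 - 2 * a * b * (f x * g x) + b\<^sup>2 * (g x)\<^sup>2) = a\<^sup>2 * ?A - 2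
        * (a * b * ?C) + b\<^sup>2 * ?B"
      using f g fg by (subst Bochner_Integration.integral_add Bochner_Integration.integral_diff; simp)+
    finally show ?thesis .
  qed
  have A: "0 \<le> ?A" by simp
  show ?thesis
  proof (cases "?A = 0")
    case True
    have "?C = 0"
    proof (rule ccontr)
      assume C: "?C \<noteq> 0"
      \<comment> \<open>When \<open>?A\<close> vanishes, this choice makes the quadratic form equal
        to \<open>- (?B + 1) + ?B = -1\<close>.\<close>
      show False using quad[of "(?B + 1) / (2 * ?C)" 1] True C by simp
    qed
    then show ?thesis using True by simp
  next
    case False
    then have "0 < ?A" using A by linarith
    moreover have "0 \<le> ?A * (?A * ?B - ?C\<^sup>2)"
      using quad[of ?C ?A] by (simp add: power2_eq_square algebra_simps)
    ultimately show ?thesis by (simp add: zero_le_mult_iff)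
  qed
qed

text \<open>Bound for the squared norm of a unit tent centred at some \<open>u \<ge> 1\<close> in
  the reproducing kernel Hilbert space of \<open>fbm_cov H\<close>, as Cauchy-Schwarz delivers
  it.\<close>

definition bump_const :: "real \<Rightarrow> real" where
  "bump_const H = 2 * cos_const H * (LBINT x. (fejer x)\<^sup>2 * \<bar>x\<bar> powr (1 + 2*H)) / (cos_const (1/2))\<^sup>2"

lemma bump_const_nonneg: "0 < H \<Longrightarrow> H < 1 \<Longrightarrow> 0 \<le> bump_const H"
  using cos_const_pos[of H] unfolding bump_const_def
  by (intro divide_nonneg_nonneg mult_nonneg_nonneg Bochner_Integration.integral_nonneg) auto

text \<open>The covariance form is the weighted L2 norm of the sum of c j (exp(i t_j x) - 1).
  Pairing this function with \<open>fejer\<close> and the phase exp(-iux) gives the tents at the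
  points t j, and Cauchy-Schwarz, with the spectral weight split between the factors, separates the
  energy of the tent from the form.\<close>

lemma tent_bound_unit:
  assumes H: "0 < H" "H < (1::real)" and "finite J" and t: "\<And>j. j \<in> J \<Longrightarrow> 0 \<le> t j" and u: "1 \<le> u"
  shows "(\<Sum>j\<in>J. c j * tent (t j - u))\<^sup>2 \<le> bump_const H * (\<Sum>i\<in>J. \<Sum>j\<in>J. c i * c j * fbm_cov H (t i) (t j))"
proof -
  define Q where "Q = (\<Sum>i\<in>J. \<Sum>j\<in>J. c i * c j * fbm_cov H (t i) (t j))"
  define a b where "a x = (\<Sum>j\<in>J. c j * (1 - cos (t j * x)))" and "b x = (\<Sum>j\<in>J. c j * sin (t j * x))"
      for x
  define f where "f x = fejer x * \<bar>x\<bar> powr (1/2 + H)" for x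
  \<comment> \<open>Up to the weight, the real part of exp(-iux) times the sum of c j (exp(i t_j x)
    - 1); hence its square is at most the weighted a^2 + b^2. The weights of \<open>f\<close> and
    \<open>g\<close> are inverse to each other.\<close>
  define g where "g x = (b x * sin (u * x) - a x * cos (u * x)) * \<bar>x\<bar> powr (- 1/2 - H)" for x
  have [measurable]: "a \<in> borel_measurable borel" "b \<in> borel_measurable borel"
      "f \<in> borel_measurable borel" "g \<in> borel_measurable borel"
    unfolding a_def[abs_def] b_def[abs_def] f_def[abs_def] g_def[abs_def] by measurable
  have "has_bochner_integral lborel (\<lambda>x. \<Sum>i\<in>J. \<Sum>j\<in>J. c i * c j *
     (((1 - cos (t i * x)) * (1 - cos (t j * x)) + sin (t i * x) * sin (t j * x)) * \<bar>x\<bar> powr (-1 - 2*H)))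
     (\<Sum>i\<in>J. \<Sum>j\<in>J. c i * c j * (2 * cos_const H * fbm_cov H (t i) (t j)))"
    by (intro has_bochner_integral_sum has_bochner_integral_mult_right fbm_cov_harmonizable H t)
  also have "(\<lambda>x. \<Sum>i\<in>J. \<Sum>j\<in>J. c i * c j *
     (((1 - cos (t i * x)) * (1 - cos (t j * x)) + sin (t i * x) * sin (t j * x)) * \<bar>x\<bar> powr (-1 - 2*H)))
     = (\<lambda>x. ((a x)\<^sup>2 + (b x)\<^sup>2) * \<bar>x\<bar> powr (-1 - 2*H))"
  proof
    fix x
    have "(a x)\<^sup>2 = (\<Sum>i\<in>J. \<Sum>j\<in>J. c i * (1 - cos (t i * x)) * (c j * (1 - cos (t j * x))))"
      and "(b x)\<^sup>2 = (\<Sum>i\<in>J. \<Sum>j\<in>J. c i * sin (t i * x) * (c j * sin (t j * x)))"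
      unfolding a_def b_def power2_eq_square by (rule sum_product)+
    note ab2 = this
    show "(\<Sum>i\<in>J. \<Sum>j\<in>J. c i * c j *
       (((1 - cos (t i * x)) * (1 - cos (t j * x)) + sin (t i * x) * sin (t j * x))
           * \<bar>x\<bar> powr (-1 - 2*H)))
       = ((a x)\<^sup>2 + (b x)\<^sup>2) * \<bar>x\<bar> powr (-1 - 2*H)"
      unfolding ab2 sum.distrib[symmetric] sum_distrib_right
      by (intro sum.cong; simp add: algebra_simps)
  qed
  also have "(\<Sum>i\<in>J. \<Sum>j\<in>J. c i * c j * (2 * cos_const H * fbm_cov H (t i) (t j))) = 2 * cos_const H * Q"
    unfolding Q_def sum_distrib_left by (intro sum.cong) auto
  finally have ab: "has_bochner_integral lborel (\<lambda>x. ((a x)\<^sup>2 + (b x)\<^sup>2) * \<bar>x\<bar> powr (-1 - 2*H)) (2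
      * cos_const H * Q)" .
  have g2: "(g x)\<^sup>2 \<le> ((a x)\<^sup>2 + (b x)\<^sup>2) * \<bar>x\<bar> powr (-1 - 2*H)" for x
  proof -
    have "(b x * sin (u * x) - a x * cos (u * x))\<^sup>2 + (b x * cos (u * x) + a x * sin (u * x))\<^sup>2
       = ((a x)\<^sup>2 + (b x)\<^sup>2) * ((sin (u * x))\<^sup>2 + (cos (u * x))\<^sup>2)"
      by algebra
    moreover have "0 \<le> (b x * cos (u * x) + a x * sin (u * x))\<^sup>2" by simp
    ultimately have "(b x * sin (u * x) - a x * cos (u * x))\<^sup>2 \<le> (a x)\<^sup>2 + (b x)\<^sup>2"
      unfolding sin_cos_squared_add mult_1_right by (metis le_add_same_cancel1)
    moreover have "(\<bar>x\<bar> powr (- 1/2 - H))\<^sup>2 = \<bar>x\<bar> powr (-1 - 2*H)"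
      by (simp add: power2_eq_square flip: powr_add)
    ultimately show ?thesis unfolding g_def power_mult_distrib by (intro mult_mono) auto
  qed
  have f2: "(f x)\<^sup>2 = (fejer x)\<^sup>2 * \<bar>x\<bar> powr (1 + 2*H)" for x
  proof -
    have "(\<bar>x\<bar> powr (1/2 + H))\<^sup>2 = \<bar>x\<bar> powr (1 + 2*H)"
      by (simp add: power2_eq_square flip: powr_add)
    then show ?thesis by (simp add: f_def power_mult_distrib)
  qed
  have int_g: "integrable lborel (\<lambda>x. (g x)\<^sup>2)"
  proof (rule Bochner_Integration.integrable_bound)
    show "integrable lborel (\<lambda>x. ((a x)\<^sup>2 + (b x)\<^sup>2) * \<bar>x\<bar> powr (-1 - 2*H))"
      using ab by (simp only: has_bochner_integral_iff)
    show "AE x in lborel. norm ((g x)\<^sup>2) \<le> norm (((a x)\<^sup>2 + (b x)\<^sup>2) * \<bar>x\<bar> powr (-1 - 2*H))"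
    proof (intro AE_I2)
      fix x
      have "norm ((g x)\<^sup>2) = (g x)\<^sup>2" by simp
      also note g2
      also have "((a x)\<^sup>2 + (b x)\<^sup>2) * \<bar>x\<bar> powr (-1 - 2*H) \<le> norm (((a x)\<^sup>2 + (b x)\<^sup>2)
          * \<bar>x\<bar> powr (-1 - 2*H))"
        unfolding real_norm_def by (rule abs_ge_self)
      finally show "norm ((g x)\<^sup>2) \<le> norm (((a x)\<^sup>2 + (b x)\<^sup>2) * \<bar>x\<bar> powr (-1 - 2*H))" .
    qed
  qed measurable
  have int_g_le: "(LBINT x. (g x)\<^sup>2) \<le> 2 * cos_const H * Q"
    using integral_mono[OF int_g _ g2] ab by (simp only: has_bochner_integral_iff)
  have fg: "f x * g x = (\<Sum>j\<in>J. c j * (fejer x * cos ((t j - u) * x) - fejer x * cos (- u * x)))" for x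
  proof (cases "x = 0")
    case False
    have "\<bar>x\<bar> powr (1/2 + H) * \<bar>x\<bar> powr (- 1/2 - H) = 1"
      using False by (simp flip: powr_add)
    then have "f x * g x = fejer x * (b x * sin (u * x) - a x * cos (u * x))"
      by (simp add: f_def g_def)
    also have "b x * sin (u * x) - a x * cos (u * x)
        = (\<Sum>j\<in>J. c j * (cos ((t j - u) * x) - cos (- u * x)))"
      unfolding a_def b_def sum_distrib_right sum_subtractf[symmetric]
      by (intro sum.cong) (auto simp: left_diff_distrib cos_diff algebra_simps)
    finally show ?thesis by (simp add: sum_distrib_left algebra_simps)
  qed (simp add: f_def g_def fejer_def)
  have "has_bochner_integral lborel (\<lambda>x. f x * g x)
     (\<Sum>j\<in>J. c j * (cos_const (1/2) * tent (t j - u) - cos_const (1/2) * tent (- u)))"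
    unfolding fg by (intro has_bochner_integral_sum has_bochner_integral_mult_right
        has_bochner_integral_diff tent_fourier)
  \<comment> \<open>The 1 subtracted from every exponential contributes \<open>tent (- u)\<close>,
    which is 0 because the tent around u does not reach beyond the origin.\<close>
  moreover have "tent (- u) = 0" using u by (simp add: tent_def)
  ultimately have "(LBINT x. f x * g x) = cos_const (1/2) * (\<Sum>j\<in>J. c j * tent (t j - u))"
    by (simp add: has_bochner_integral_iff sum_distrib_left algebra_simps)
  then have "(cos_const (1/2))\<^sup>2 * (\<Sum>j\<in>J. c j * tent (t j - u))\<^sup>2 = (LBINT x. f x * g x)\<^sup>2"
    by (simp add: power_mult_distrib)
  also have "\<dots> \<le> (LBINT x. (f x)\<^sup>2) * (LBINT x. (g x)\<^sup>2)"
    using int_g integrable_fejer_sq[OF H] by (intro integral_Cauchy_Schwarz) (auto simp: f2)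
  also have "\<dots> \<le> (LBINT x. (f x)\<^sup>2) * (2 * cos_const H * Q)"
    by (intro mult_left_mono int_g_le) auto
  also have "\<dots> = (cos_const (1/2))\<^sup>2 * (bump_const H * Q)"
    using cos_const_pos[of "1/2"] by (simp add: bump_const_def f2)
  finally show ?thesis
    using cos_const_pos[of "1/2"] by (simp add: Q_def)
qed

text \<open>Self-similarity reduces to width 1; the condition \<open>r \<le> u\<close> becomes
  \<open>1 \<le> u / r\<close>.\<close>

lemma tent_bound:
  assumes H: "0 < H" "H < (1::real)" and "finite J" and t: "\<And>j. j \<in> J \<Longrightarrow> 0 \<le> t j" and r: "0 < r" "r \<le> u"
  shows "(\<Sum>j\<in>J. c j * tent ((t j - u) / r))\<^sup>2
     \<le> bump_const H * r powr (-2 * H) * (\<Sum>i\<in>J. \<Sum>j\<in>J. c i * c j * fbm_cov H (t i) (t j))"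
proof -
  have "(\<Sum>j\<in>J. c j * tent (t j / r - u / r))\<^sup>2
     \<le> bump_const H * (\<Sum>i\<in>J. \<Sum>j\<in>J. c i * c j * fbm_cov H (t i / r) (t j / r))"
    using assms by (intro tent_bound_unit) auto
  also have "(\<Sum>i\<in>J. \<Sum>j\<in>J. c i * c j * fbm_cov H (t i / r) (t j / r)) =
     r powr (-2 * H) * (\<Sum>i\<in>J. \<Sum>j\<in>J. c i * c j * fbm_cov H (t i) (t j))"
    unfolding sum_distrib_left using r t by (intro sum.cong) (auto simp: fbm_cov_scale)
  finally show ?thesis by (simp add: diff_divide_distrib mult.assoc)
qed

section \<open>Positive semidefinite kernels and tensor products of test functions\<close>

definition psd_on :: "'i set \<Rightarrow> ('i \<Rightarrow> 'i \<Rightarrow> real) \<Rightarrow> bool" where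
  "psd_on J D \<longleftrightarrow> (\<forall>c. 0 \<le> (\<Sum>i\<in>J. \<Sum>j\<in>J. c i * c j * D i j))"

lemma psd_on_add: "psd_on J D \<Longrightarrow> psd_on J E \<Longrightarrow> psd_on J (\<lambda>i j. D i j + E i j)"
  by (simp add: psd_on_def sum.distrib distrib_left add_nonneg_nonneg)

lemma psd_on_mult_rank_one:
  assumes "psd_on J D"
  shows "psd_on J (\<lambda>i j. g i * g j * D i j)"
  unfolding psd_on_def
proof
  fix c
  have "(\<Sum>i\<in>J. \<Sum>j\<in>J. c i * c j * (g i * g j * D i j)) = (\<Sum>i\<in>J. \<Sum>j\<in>J. (c i * g i) * (c j * g j) * D i j)"
    by (intro sum.cong) auto
  then show "0 \<le> (\<Sum>i\<in>J. \<Sum>j\<in>J. c i * c j * (g i * g j * D i j))"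
    using assms by (simp add: psd_on_def)
qed

text \<open>The Schur product theorem, for which it suffices that one factor has a feature representation.\<close>

lemma psd_on_mult_fbm_cov:
  assumes H: "0 < H" "H < (1::real)" and t: "\<And>j. j \<in> J \<Longrightarrow> 0 \<le> t j" and D: "psd_on J D"
  shows "psd_on J (\<lambda>i j. fbm_cov H (t i) (t j) * D i j)"
  unfolding psd_on_def
proof
  fix c
  have "has_bochner_integral lborel (\<lambda>x. \<Sum>i\<in>J. \<Sum>j\<in>J. c i * c j * D i j *
     (((1 - cos (t i * x)) * (1 - cos (t j * x)) + sin (t i * x) * sin (t j * x)) * \<bar>x\<bar> powr (-1 - 2*H)))
     (\<Sum>i\<in>J. \<Sum>j\<in>J. c i * c j * D i j * (2 * cos_const H * fbm_cov H (t i) (t j)))"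
    by (intro has_bochner_integral_sum has_bochner_integral_mult_right fbm_cov_harmonizable H t)
  moreover have "(\<Sum>i\<in>J. \<Sum>j\<in>J. c i * c j * D i j *
     (((1 - cos (t i * x)) * (1 - cos (t j * x)) + sin (t i * x) * sin (t j * x)) * \<bar>x\<bar> powr (-1 - 2*H)))
     = ((\<Sum>i\<in>J. \<Sum>j\<in>J. (c i * (1 - cos (t i * x))) * (c j * (1 - cos (t j * x))) * D i j) +
        (\<Sum>i\<in>J. \<Sum>j\<in>J. (c i * sin (t i * x)) * (c j * sin (t j * x)) * D i j)) * \<bar>x\<bar> powr (-1 - 2*H)" for x
    unfolding sum.distrib[symmetric] sum_distrib_right
    by (intro sum.cong) (auto simp: algebra_simps)
  moreover have "0 \<le> ((\<Sum>i\<in>J. \<Sum>j\<in>J. (c i * (1 - cos (t i * x))) * (c j * (1 - cos (t j * x))) * D i j) +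
        (\<Sum>i\<in>J. \<Sum>j\<in>J. (c i * sin (t i * x)) * (c j * sin (t j * x)) * D i j)) * \<bar>x\<bar> powr (-1 - 2*H)" for x
    using D[unfolded psd_on_def] by (intro mult_nonneg_nonneg add_nonneg_nonneg) auto
  ultimately have "0 \<le> (\<Sum>i\<in>J. \<Sum>j\<in>J. c i * c j * D i j * (2 * cos_const H * fbm_cov H (t i) (t j)))"
    by (simp add: has_bochner_integral_iff) (metis (no_types, lifting)
        Bochner_Integration.integral_nonneg)
  also have "\<dots> = 2 * cos_const H * (\<Sum>i\<in>J. \<Sum>j\<in>J. c i * c j * (fbm_cov H (t i) (t j) * D i j))"
    unfolding sum_distrib_left by (intro sum.cong) auto
  finally show "0 \<le> (\<Sum>i\<in>J. \<Sum>j\<in>J. c i * c j * (fbm_cov H (t i) (t j) * D i j))"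
    using cos_const_pos[OF H] by (simp add: zero_le_mult_iff)
qed

text \<open>Norms in reproducing kernel Hilbert spaces multiply under tensor products. With P and G
  the products over the coordinates treated so far,
  \<open>C K P - g g G G = C K (P - G G) + G G (C K - g g)\<close>: the first summand is a Schur
  product with the induction hypothesis, the second a diagonal rescaling of the assumption.\<close>

lemma psd_on_prod_fbm_cov_minus_rank_one:
  assumes H: "\<And>l. l \<in> S \<Longrightarrow> 0 < H l \<and> H l < (1::real)" and t: "\<And>l j. l \<in> S \<Longrightarrow> j \<in> J \<Longrightarrow> 0 \<le> t l j"
    and C: "\<And>l. l \<in> S \<Longrightarrow> 0 \<le> C l"
    and "finite S"
    and psd: "\<And>l. l \<in> S \<Longrightarrow> psd_on J (\<lambda>i j. C l * fbm_cov (H l) (t l i) (t l j) - g l i * g l j)"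
  shows "psd_on J (\<lambda>i j. (\<Prod>l\<in>S. C l * fbm_cov (H l) (t l i) (t l j)) - (\<Prod>l\<in>S. g l i) * (\<Prod>l\<in>S. g l j))"
  using assms(4) H t C psd
proof (induction S)
  case empty
  then show ?case by (simp add: psd_on_def)
next
  case (insert l S)
  let ?K = "\<lambda>l i j. fbm_cov (H l) (t l i) (t l j)"
  have IH: "psd_on J (\<lambda>i j. (\<Prod>l\<in>S. C l * ?K l i j) - (\<Prod>l\<in>S. g l i) * (\<Prod>l\<in>S. g l j))"
    using insert by (intro insert.IH) auto
  \<comment> \<open>The scalar \<open>C l\<close> is written as a rank one factor with both entries
    \<open>sqrt (C l)\<close>.\<close>
  have 1: "psd_on J (\<lambda>i j. sqrt (C l) * sqrt (C l)
      * (?K l i j * ((\<Prod>l\<in>S. C l * ?K l i j) - (\<Prod>l\<in>S. g l i) * (\<Prod>l\<in>S. g l j))))"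
    using insert.prems by (intro psd_on_mult_rank_one[where g="\<lambda>_. sqrt (C l)"] psd_on_mult_fbm_cov
        IH) auto
  have 2: "psd_on J (\<lambda>i j. (\<Prod>l\<in>S. g l i) * (\<Prod>l\<in>S. g l j) * (C l * ?K l i j - g l i * g l j))"
    using insert.prems by (intro psd_on_mult_rank_one) auto
  have "sqrt (C l) * sqrt (C l) = C l" using insert.prems by simp
  then show ?case
    using psd_on_add[OF 1 2] insert.hyps by (simp add: algebra_simps)
qed

section \<open>Sectorial local nondeterminism\<close>

lemma fbs_cov_eq: "fbs_cov H s t = (\<Prod>l\<in>UNIV. fbm_cov (H $ l) (s $ l) (t $ l))"
  by (simp add: fbs_cov_def fbm_cov_def)

lemma fbs_cov_commute: "fbs_cov H s t = fbs_cov H t s"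
  by (simp add: fbs_cov_def abs_minus_commute add.commute)

text \<open>The case \<open>g = 0\<close> of the tensor product lemma, since a product of zeros over
  the nonempty index type is 0.\<close>

lemma psd_on_fbs_cov:
  fixes H :: "real ^ 'n"
  assumes H: "\<And>l. 0 < H $ l" "\<And>l. H $ l < 1" and s: "\<And>j l. j \<in> J \<Longrightarrow> 0 \<le> s j $ l"
  shows "psd_on J (\<lambda>i j. fbs_cov H (s i) (s j))"
proof -
  have "psd_on J (\<lambda>_ _. 1)"
    by (simp add: psd_on_def flip: sum_product)
  then have K: "psd_on J (\<lambda>i j. fbm_cov (H $ l) (s i $ l) (s j $ l))" for l
    using psd_on_mult_fbm_cov[of "H $ l" J "\<lambda>j. s j $ l" "\<lambda>_ _. 1"] H s by simp
  show ?thesis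
    using psd_on_prod_fbm_cov_minus_rank_one[of UNIV "\<lambda>l. H $ l" J "\<lambda>l j. s j $ l" "\<lambda>_. 1"
        "\<lambda>_ _. 0"] H s K
    by (simp add: fbs_cov_eq power_0_left)
qed

abbreviation fbs_form :: "real ^ 'n \<Rightarrow> 'j set \<Rightarrow> ('j \<Rightarrow> real ^ 'n) \<Rightarrow> ('j \<Rightarrow> real) \<Rightarrow> real" where
  "fbs_form H J s \<xi> \<equiv> \<Sum>i\<in>J. \<Sum>k\<in>J. \<xi> i * \<xi> k * fbs_cov H (s i) (s k)"

text \<open>The product bounds the squared norm of a product of tents of half-width \<alpha>. The
  maximum with 1 rules out division by 0 and makes the constant at most 1, which later keeps the
  weights \<open>v\<close> at most 1.\<close>

definition lnd_const :: "real ^ 'n \<Rightarrow> real \<Rightarrow> real" where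
  "lnd_const H \<alpha> = 1 / max 1 (\<Prod>l\<in>UNIV. bump_const (H $ l) * \<alpha> powr (-2 * H $ l))"

lemma lnd_const_pos: "0 < lnd_const H \<alpha>" and lnd_const_le_one: "lnd_const H \<alpha> \<le> 1"
  by (auto simp: lnd_const_def)

text \<open>Sectorial local nondeterminism. The test function that separates \<open>s j\<close> from the other points is
  a product of tents, narrow in direction \<open>l\<close> only, hence the power of \<open>\<rho>\<close>.\<close>

lemma fbs_cov_local_nondeterminism:
  fixes H :: "real ^ 'n"
  assumes H: "\<And>l. 0 < H $ l" "\<And>l. H $ l < 1" and \<alpha>: "0 < \<alpha>" "\<alpha> \<le> 1"
    and J: "finite J" and s: "\<And>i l. i \<in> J \<Longrightarrow> \<alpha> \<le> s i $ l" and j: "j \<in> J" and \<rho>: "0 < \<rho>" "\<rho> \<le> 1"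
    and sep: "\<And>k. k \<in> J \<Longrightarrow> k \<noteq> j \<Longrightarrow> \<rho> \<le> \<bar>s j $ l - s k $ l\<bar>"
  shows "lnd_const H \<alpha> * \<rho> powr (2 * H $ l) * (\<xi> j)\<^sup>2 \<le> fbs_form H J s \<xi>"
proof -
  define A where "A = (\<Prod>l\<in>UNIV. bump_const (H $ l) * \<alpha> powr (-2 * H $ l))"
  define Q where "Q = fbs_form H J s \<xi>"
  \<comment> \<open>Half-widths of the tents around \<open>s j\<close>. All are at most \<alpha>,
    hence at most the coordinates of \<open>s j\<close>, as \<open>tent_bound\<close> requires; the
    one in direction l is at most \<rho>, so this tent vanishes at every other point.\<close>
  define r where "r m = (if m = l then \<alpha> * \<rho> else \<alpha>)" for m
  define C where "C m = bump_const (H $ m) * r m powr (-2 * H $ m)" for m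
  define g where "g m k = tent ((s k $ m - s j $ m) / r m)" for m k
  have s0: "0 \<le> s i $ m" if "i \<in> J" for i m
    using s[OF that, of m] \<alpha> by linarith
  have r0: "0 < r m" for m using \<alpha> \<rho> by (simp add: r_def)
  have r1: "r m \<le> s j $ m" for m
  proof -
    have "r m \<le> \<alpha>" using \<alpha> \<rho> mult_left_le[of \<rho> \<alpha>] by (simp add: r_def)
    then show ?thesis using s[OF j, of m] by linarith
  qed
  have C0: "0 \<le> C m" for m using H by (simp add: C_def bump_const_nonneg)
  have psd: "psd_on J (\<lambda>i k. C m * fbm_cov (H $ m) (s i $ m) (s k $ m) - g m i * g m k)" for m
    unfolding psd_on_def
  proof
    fix c
    have "(\<Sum>i\<in>J. \<Sum>k\<in>J. c i * c k * (C m * fbm_cov (H $ m) (s i $ m) (s k $ m) - g m i * g m k))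
       = (\<Sum>i\<in>J. \<Sum>k\<in>J. C m * (c i * c k * fbm_cov (H $ m) (s i $ m) (s k $ m)))
           - (\<Sum>i\<in>J. \<Sum>k\<in>J. (c i * g m i) * (c k * g m k))"
      unfolding sum_subtractf[symmetric] by (intro sum.cong) (auto simp: algebra_simps)
    also have "\<dots> = C m * (\<Sum>i\<in>J. \<Sum>k\<in>J. c i * c k * fbm_cov (H $ m) (s i $ m) (s k $ m))
        - (\<Sum>i\<in>J. c i * g m i)\<^sup>2"
      unfolding power2_eq_square sum_product by (simp add: sum_distrib_left)
    also have "\<dots> \<ge> 0"
      using tent_bound[of "H $ m" J "\<lambda>i. s i $ m" "r m" "s j $ m" c] H J s0 r0 r1
          by (simp add: C_def g_def)
    finally show "0 \<le> (\<Sum>i\<in>J. \<Sum>k\<in>J. c i * c k * (C m * fbm_cov (H $ m) (s i $ m) (s k $ m) - g m i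
        * g m k))" .
  qed
  have psdP: "psd_on J (\<lambda>i k. (\<Prod>m\<in>UNIV. C m * fbm_cov (H $ m) (s i $ m) (s k $ m))
      - (\<Prod>m\<in>UNIV. g m i) * (\<Prod>m\<in>UNIV. g m k))"
    using H s0 C0 psd by (intro psd_on_prod_fbm_cov_minus_rank_one) auto
  have g: "(\<Prod>m\<in>UNIV. g m k) = (if k = j then 1 else 0)" if "k \<in> J" for k
  proof (cases "k = j")
    case True
    then show ?thesis by (simp add: g_def tent_def)
  next
    case False
    have "\<alpha> * \<rho> \<le> 1 * \<rho>"
      using \<alpha> \<rho> by (intro mult_right_mono) auto
    also have "\<dots> \<le> \<bar>s k $ l - s j $ l\<bar>"
      using sep[OF that False] by (simp add: abs_minus_commute)
    finally have "\<alpha> * \<rho> \<le> \<bar>s k $ l - s j $ l\<bar>" .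
    then have "1 \<le> \<bar>(s k $ l - s j $ l) / r l\<bar>"
      using r0[of l] \<alpha> \<rho> by (simp add: r_def abs_mult)
    then have "g l k = 0" by (simp add: g_def tent_def)
    then have "(\<Prod>m\<in>UNIV. g m k) = 0" by (intro prod_zero) auto
    with False show ?thesis by simp
  qed
  have "0 \<le> (\<Sum>i\<in>J. \<Sum>k\<in>J. \<xi> i * \<xi> k * ((\<Prod>m\<in>UNIV. C m * fbm_cov (H $ m) (s i $ m) (s k $ m))
      - (\<Prod>m\<in>UNIV. g m i) * (\<Prod>m\<in>UNIV. g m k)))"
    using psdP by (simp add: psd_on_def)
  also have "\<dots> = (\<Sum>i\<in>J. \<Sum>k\<in>J. prod C UNIV * (\<xi> i * \<xi> k * fbs_cov H (s i) (s k))
      - (\<xi> i * (\<Prod>m\<in>UNIV. g m i)) * (\<xi> k * (\<Prod>m\<in>UNIV. g m k)))"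
    unfolding prod.distrib fbs_cov_eq by (intro sum.cong refl) (simp only: right_diff_distrib mult_ac)
  also have "\<dots> = prod C UNIV * Q - (\<Sum>i\<in>J. \<xi> i * (\<Prod>m\<in>UNIV. g m i))\<^sup>2"
    unfolding power2_eq_square sum_product Q_def by (simp add: sum_subtractf sum_distrib_left)
  also have "(\<Sum>i\<in>J. \<xi> i * (\<Prod>m\<in>UNIV. g m i)) = (\<Sum>i\<in>J. if i = j then \<xi> i else 0)"
    by (intro sum.cong) (auto simp: g)
  also have "\<dots> = \<xi> j" using J j by simp
  finally have 1: "(\<xi> j)\<^sup>2 \<le> prod C UNIV * Q" by simp
  have "C m = (bump_const (H $ m) * \<alpha> powr (-2 * H $ m))
      * (if m = l then \<rho> powr (-2 * H $ l) else 1)" for m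
    using \<alpha> \<rho> by (simp add: C_def r_def powr_mult)
  then have "prod C UNIV = A * \<rho> powr (-2 * H $ l)"
    by (simp add: A_def prod.distrib)
  with 1 have "(\<xi> j)\<^sup>2 \<le> \<rho> powr (-2 * H $ l) * (A * Q)" by (simp add: mult_ac)
  then have "\<rho> powr (2 * H $ l) * (\<xi> j)\<^sup>2 \<le> (\<rho> powr (2 * H $ l) * \<rho> powr (-2 * H $ l)) * (A * Q)"
    unfolding mult.assoc by (intro mult_left_mono) auto
  also have "\<rho> powr (2 * H $ l) * \<rho> powr (-2 * H $ l) = 1"
    using \<rho> by (simp flip: powr_add)
  also have "1 * (A * Q) \<le> max 1 A * Q"
    using psd_on_fbs_cov[of H J s] H s0 by (simp add: psd_on_def Q_def mult_right_mono)
  finally have "\<rho> powr (2 * H $ l) * (\<xi> j)\<^sup>2 \<le> Q * max 1 A" by (simp only: mult.commute)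
  then have "(\<rho> powr (2 * H $ l) * (\<xi> j)\<^sup>2) / max 1 A \<le> Q"
    by (subst pos_divide_le_eq) auto
  then show ?thesis by (simp only: lnd_const_def A_def[symmetric] Q_def times_divide_eq_left mult_1_left)
qed

section \<open>Gaussian integrals of quadratic forms\<close>

lemma nn_integral_exp_neg_quadratic:
  assumes "0 < (q::real)"
  shows "(\<integral>\<^sup>+ y. ennreal (exp (- (q * (y + L)\<^sup>2))) \<partial>lborel) = ennreal (sqrt (pi / q))"
proof -
  define \<sigma> where "\<sigma> = sqrt (1 / (2 * q))"
  have \<sigma>: "0 < \<sigma>" "\<sigma>\<^sup>2 = 1 / (2 * q)" using assms by (auto simp: \<sigma>_def)
  have eq: "exp (- (q * (y + L)\<^sup>2)) = sqrt (pi / q) * normal_density (- L) \<sigma> y" for y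
    using assms by (simp add: normal_density_def \<sigma> real_sqrt_divide)
  have "(\<integral>\<^sup>+ y. ennreal (normal_density (- L) \<sigma> y) \<partial>lborel) = 1"
    using \<sigma> by (subst nn_integral_eq_integral) auto
  then show ?thesis
    unfolding eq using assms by (subst ennreal_mult, simp, simp) (simp add: nn_integral_cmult)
qed

text \<open>Integrating out the variable with the smallest key replaces the form by its minimum over that
  variable, and the hypothesis on \<open>w\<close> passes to this minimum. So no determinants are needed.\<close>

lemma nn_integral_exp_quadratic_form_le:
  fixes key :: "'i \<Rightarrow> real"
  assumes "finite J" "inj_on key J" "\<And>i k. q i k = q k i" "\<And>j. j \<in> J \<Longrightarrow> 0 < w j"
    and "\<And>\<xi> j. j \<in> J \<Longrightarrow> (\<And>k. k \<in> J \<Longrightarrow> key j < key k \<Longrightarrow> \<xi> k = 0) \<Longrightarrow>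
        w j * (\<xi> j)\<^sup>2 \<le> (\<Sum>i\<in>J. \<Sum>k\<in>J. \<xi> i * \<xi> k * (q i k :: real))"
  shows "(\<integral>\<^sup>+ \<xi>. ennreal (exp (- (\<Sum>i\<in>J. \<Sum>k\<in>J. \<xi> i * \<xi> k * q i k))) \<partial>(Pi\<^sub>M J (\<lambda>_. lborel)))
    \<le> ennreal (\<Prod>j\<in>J. sqrt (pi / w j))"
  using assms
proof (induction "card J" arbitrary: J q)
  case 0
  then have "J = {}" by simp
  then show ?case by (simp add: PiM_empty nn_integral_count_space_finite)
next
  case (Suc n)
  interpret product_sigma_finite "\<lambda>_::'i. lborel :: real measure" ..
  have "J \<noteq> {}" using Suc.hyps(2) by auto
  then obtain m where m: "m \<in> J" "\<And>k. k \<in> J \<Longrightarrow> key m \<le> key k"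
    using \<open>finite J\<close> Min_in[of "key ` J"] Min_le[of "key ` J"]
        by (metis (no_types) empty_is_image finite_imageI image_iff imageI)
  define J' where "J' = J - {m}"
  have J: "J = insert m J'" "m \<notin> J'" "finite J'" "card J' = n"
    using m Suc.hyps(2) Suc.prems(1) by (auto simp: J'_def)
  have key: "key m < key k" if "k \<in> J'" for k
    using m(2)[of k] Suc.prems(2) that J m(1) by (metis inj_onD insert_iff order_le_less)
  define Q where "Q \<xi> = (\<Sum>i\<in>J. \<Sum>k\<in>J. \<xi> i * \<xi> k * q i k)" for \<xi>
  \<comment> \<open>The unit vector at m is admissible for m, since it vanishes at every larger key;
    this gives the diagonal entry.\<close>
  have "w m * (1::real)\<^sup>2 \<le> Q (\<lambda>i. if i = m then 1 else 0)"
  proof -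
    have "w m * ((\<lambda>i. if i = m then 1 else 0) m)\<^sup>2 \<le> Q (\<lambda>i. if i = m then 1 else 0)"
      unfolding Q_def using m by (intro Suc.prems(5)) auto
    then show ?thesis by simp
  qed
  also have "\<dots> = (\<Sum>i\<in>J. \<Sum>k\<in>J. if k = m then (if i = m then q m m else 0) else 0)"
    unfolding Q_def by (intro sum.cong) auto
  also have "\<dots> = q m m" using m Suc.prems(1) by simp
  finally have qm: "w m \<le> q m m" by simp
  have wm: "0 < w m" using Suc.prems(4) m by simp
  have qm0: "0 < q m m" using qm wm by simp
  \<comment> \<open>The Schur complement of the entry at m: \<open>- L \<xi>\<close> is the
    minimising value of the variable m and \<open>Q'\<close> the minimum.\<close>
  define q' where "q' i k = q i k - q m i * q m k / q m m" for i k
  define Q' where "Q' \<xi> = (\<Sum>i\<in>J'. \<Sum>k\<in>J'. \<xi> i * \<xi> k * q' i k)" for \<xi>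
  define L where "L \<xi> = (\<Sum>i\<in>J'. q m i * \<xi> i) / q m m" for \<xi>
  have split: "Q \<xi> = q m m * (\<xi> m + L \<xi>)\<^sup>2 + Q' \<xi>" for \<xi>
  proof -
    let ?S = "\<Sum>i\<in>J'. q m i * \<xi> i"
    have "Q \<xi> = \<xi> m * \<xi> m * q m m + (\<Sum>k\<in>J'. \<xi> m * \<xi> k * q m k) + (\<Sum>i\<in>J'. \<xi> i * \<xi> m * q i m)
        + (\<Sum>i\<in>J'. \<Sum>k\<in>J'. \<xi> i * \<xi> k * q i k)"
      using J by (simp add: Q_def sum.distrib)
    also have "(\<Sum>k\<in>J'. \<xi> m * \<xi> k * q m k) = \<xi> m * ?S"
      by (simp add: sum_distrib_left algebra_simps)
    also have "(\<Sum>i\<in>J'. \<xi> i * \<xi> m * q i m) = \<xi> m * ?S"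
      unfolding sum_distrib_left using Suc.prems(3) by (intro sum.cong) (auto simp: algebra_simps)
    also have "(\<Sum>i\<in>J'. \<Sum>k\<in>J'. \<xi> i * \<xi> k * q i k) = Q' \<xi> + ?S\<^sup>2 / q m m"
      unfolding Q'_def q'_def power2_eq_square sum_product sum_divide_distrib sum.distrib[symmetric]
      by (intro sum.cong) (auto simp: algebra_simps)
    finally have *: "Q \<xi> = \<xi> m * \<xi> m * q m m + \<xi> m * ?S + \<xi> m * ?S + (Q' \<xi> + ?S\<^sup>2 / q m m)" .
    have "q m m * (\<xi> m + ?S / q m m)\<^sup>2 = \<xi> m * \<xi> m * q m m + \<xi> m * ?S + \<xi> m * ?S + ?S\<^sup>2 / q m m"
      using qm0 by (simp add: field_simps power2_eq_square)
    then show ?thesis using * unfolding L_def by simp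
  qed
  have upd: "L (\<xi>(m := y)) = L \<xi>" "Q' (\<xi>(m := y)) = Q' \<xi>" for \<xi> y
    unfolding L_def Q'_def using J by (auto intro!: sum.cong arg_cong2[where f="(/)"])
  have IH: "(\<integral>\<^sup>+ \<xi>. ennreal (exp (- Q' \<xi>)) \<partial>(Pi\<^sub>M J' (\<lambda>_. lborel))) \<le> ennreal (\<Prod>j\<in>J'. sqrt (pi / w j))"
    unfolding Q'_def
  proof (rule Suc.hyps(1))
    fix \<xi> :: "'i \<Rightarrow> real" and j assume j: "j \<in> J'" and zero: "\<And>k. k \<in> J' \<Longrightarrow> key j < key k \<Longrightarrow> \<xi> k = 0"
    \<comment> \<open>At the minimising value Q becomes \<open>Q'\<close>. The entry at m may be
      nonzero because its key lies below that of j, and zeros are prescribed only at larger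
      keys.\<close>
    let ?\<xi> = "\<xi>(m := - L \<xi>)"
    have "w j * (?\<xi> j)\<^sup>2 \<le> Q ?\<xi>"
      unfolding Q_def
    proof (rule Suc.prems(5))
      fix k assume "k \<in> J" "key j < key k"
      then show "?\<xi> k = 0" using zero[of k] key[OF j] J by auto
    qed (use j J in auto)
    also have "Q ?\<xi> = Q' \<xi>" unfolding split upd by simp
    finally show "w j * (\<xi> j)\<^sup>2 \<le> (\<Sum>i\<in>J'. \<Sum>k\<in>J'. \<xi> i * \<xi> k * q' i k)"
      using j J(2) by (cases "j = m") (auto simp: Q'_def)
  next
    show "inj_on key J'" using Suc.prems(2) by (auto simp: J'_def inj_on_diff)
    show "q' i k = q' k i" for i k using Suc.prems(3)[of i k] by (simp add: q'_def)
  qed (use J Suc.prems in auto)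
  have [measurable]: "L \<in> borel_measurable (Pi\<^sub>M J' (\<lambda>_. lborel))"
      "Q' \<in> borel_measurable (Pi\<^sub>M J' (\<lambda>_. lborel))"
    unfolding L_def[abs_def] Q'_def[abs_def] by measurable
  have meas: "(\<lambda>\<xi>. ennreal (exp (- Q \<xi>))) \<in> borel_measurable (Pi\<^sub>M (insert m J') (\<lambda>_. lborel))"
    unfolding Q_def J(1) by measurable
  have "(\<integral>\<^sup>+ \<xi>. ennreal (exp (- Q \<xi>)) \<partial>(Pi\<^sub>M J (\<lambda>_. lborel)))
     = (\<integral>\<^sup>+ \<xi>. (\<integral>\<^sup>+ y. ennreal (exp (- Q (\<xi>(m := y)))) \<partial>lborel) \<partial>(Pi\<^sub>M J' (\<lambda>_. lborel)))"
    unfolding J(1) by (rule product_nn_integral_insert[OF J(3,2) meas])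
  also have "\<dots> = (\<integral>\<^sup>+ \<xi>. ennreal (exp (- Q' \<xi>)) * ennreal (sqrt (pi / q m m)) \<partial>(Pi\<^sub>M J' (\<lambda>_. lborel)))"
  proof (intro nn_integral_cong)
    fix \<xi>
    have "(\<integral>\<^sup>+ y. ennreal (exp (- Q (\<xi>(m := y)))) \<partial>lborel) = (\<integral>\<^sup>+ y. ennreal (exp (- Q' \<xi>))
        * ennreal (exp (- (q m m * (y + L \<xi>)\<^sup>2))) \<partial>lborel)"
      by (intro nn_integral_cong) (simp add: split upd flip: ennreal_mult exp_add)
    also have "\<dots> = ennreal (exp (- Q' \<xi>)) * ennreal (sqrt (pi / q m m))"
      by (simp add: nn_integral_cmult nn_integral_exp_neg_quadratic[OF qm0])
    finally show "(\<integral>\<^sup>+ y. ennreal (exp (- Q (\<xi>(m := y)))) \<partial>lborel) = \<dots>" .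
  qed
  also have "\<dots> = (\<integral>\<^sup>+ \<xi>. ennreal (exp (- Q' \<xi>)) \<partial>(Pi\<^sub>M J' (\<lambda>_. lborel))) * ennreal (sqrt (pi / q m m))"
    by (rule nn_integral_multc) measurable
  also have "\<dots> \<le> ennreal (\<Prod>j\<in>J'. sqrt (pi / w j)) * ennreal (sqrt (pi / w m))"
    using qm wm by (intro mult_mono IH ennreal_leI) (auto intro!: divide_left_mono)
  also have "\<dots> = ennreal (\<Prod>j\<in>J. sqrt (pi / w j))"
    unfolding J(1) using J Suc.prems(4) wm by (subst ennreal_mult[symmetric])
        (auto intro!: prod_nonneg simp: mult.commute less_imp_le)
  finally show ?case by (simp add: Q_def)
qed

text \<open>Rescaling by \<open>sqrt a\<close> leaves \<open>y powr \<gamma>\<close>, which is at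
  most 1 or at most y^2, and both are below exp(y^2). As \<open>a \<le> 1\<close>, the constant 1 is
  below the same bound.\<close>

lemma one_plus_powr_le_exp:
  assumes "0 < a" "a \<le> 1" "0 < \<gamma>" "\<gamma> \<le> (1::real)"
  shows "1 + \<bar>x\<bar> powr \<gamma> \<le> 2 * a powr (- \<gamma> / 2) * exp (a * x\<^sup>2)"
proof -
  define y where "y = sqrt a * \<bar>x\<bar>"
  have y: "0 \<le> y" "y\<^sup>2 = a * x\<^sup>2" using assms by (auto simp: y_def power_mult_distrib)
  have e: "y\<^sup>2 \<le> exp (y\<^sup>2)" using exp_ge_add_one_self[of "y\<^sup>2"] by linarith
  have "y powr \<gamma> \<le> exp (y\<^sup>2)"
  proof (cases "y \<le> 1")
    case True
    then have "y powr \<gamma> \<le> 1 powr \<gamma>" using y assms by (intro powr_mono2) auto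
    then show ?thesis by (simp add: order_trans[OF _ one_le_exp_iff[THEN iffD2]])
  next
    case False
    then have "y powr \<gamma> \<le> y powr 2" using assms by (intro powr_mono) auto
    then show ?thesis using e False by (simp add: powr_numeral)
  qed
  moreover have "\<bar>x\<bar> powr \<gamma> = a powr (- \<gamma> / 2) * y powr \<gamma>"
    using assms by (simp add: y_def powr_mult powr_half_sqrt[symmetric] powr_powr flip: powr_add
        mult.assoc)
  ultimately have "\<bar>x\<bar> powr \<gamma> \<le> a powr (- \<gamma> / 2) * exp (a * x\<^sup>2)"
    using y by (simp add: mult_left_mono)
  moreover have "1 * 1 \<le> a powr (- \<gamma> / 2) * exp (a * x\<^sup>2)"
  proof (rule mult_mono)
    have "1 powr (- \<gamma> / 2) \<le> a powr (- \<gamma> / 2)"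
      using assms by (intro powr_mono2') auto
    then show "1 \<le> a powr (- \<gamma> / 2)" by simp
  qed (use assms in auto)
  ultimately show ?thesis by simp
qed

text \<open>Half of the exponent pays for the polynomial weights, by averaging the bounds with the \<open>v j\<close>; the
  other half is integrated.\<close>

lemma nn_integral_weighted_exp_quadratic_form_le:
  fixes key :: "'i \<Rightarrow> real"
  assumes J: "finite J" and key: "inj_on key J" and sym: "\<And>i k. q i k = q k i"
    and w: "\<And>j. j \<in> J \<Longrightarrow> 0 < w j"
    and lower_w: "\<And>\<xi> j. j \<in> J \<Longrightarrow> (\<And>k. k \<in> J \<Longrightarrow> key j < key k \<Longrightarrow> \<xi> k = 0) \<Longrightarrow>
        w j * (\<xi> j)\<^sup>2 \<le> (\<Sum>i\<in>J. \<Sum>k\<in>J. \<xi> i * \<xi> k * (q i k :: real))"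
    and v: "\<And>j. j \<in> J \<Longrightarrow> 0 < v j" "\<And>j. j \<in> J \<Longrightarrow> v j \<le> 1"
    and lower_v: "\<And>\<xi> j. j \<in> J \<Longrightarrow> v j * (\<xi> j)\<^sup>2 \<le> (\<Sum>i\<in>J. \<Sum>k\<in>J. \<xi> i * \<xi> k * (q i k :: real))"
    and \<gamma>: "0 < \<gamma>" "\<gamma> \<le> 1"
  defines "N \<equiv> real (card J) + 1"
  shows "(\<integral>\<^sup>+ \<xi>. ennreal ((\<Prod>j\<in>J. 1 + \<bar>\<xi> j\<bar> powr \<gamma>)
      * exp (- (\<Sum>i\<in>J. \<Sum>k\<in>J. \<xi> i * \<xi> k * q i k) / 2)) \<partial>(Pi\<^sub>M J (\<lambda>_. lborel)))
    \<le> ennreal ((4 * (4 * N) powr (\<gamma> / 2) * sqrt pi) ^ card J * (\<Prod>j\<in>J. v j powr (- \<gamma> / 2)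
        * w j powr (- 1 / 2)))"
proof -
  define Q where "Q \<xi> = (\<Sum>i\<in>J. \<Sum>k\<in>J. \<xi> i * \<xi> k * q i k)" for \<xi>
  have N: "1 \<le> N" by (simp add: N_def)
  \<comment> \<open>Each weight is bounded with parameter \<open>v j / (4 * N)\<close>, so that the
    exponents together amount to at most \<open>Q \<xi> / 4\<close> and \<open>- Q \<xi> / 4\<close>
    remains. The summand 1 in N keeps it positive for empty J.\<close>
  define c where "c j = 2 * (v j / (4 * N)) powr (- \<gamma> / 2)" for j
  have c0: "0 \<le> c j" for j by (simp add: c_def)
  have pw: "(\<Prod>j\<in>J. 1 + \<bar>\<xi> j\<bar> powr \<gamma>) * exp (- Q \<xi> / 2) \<le> prod c J * exp (- (Q \<xi> / 4))" for \<xi>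
  proof -
    have "(\<Prod>j\<in>J. 1 + \<bar>\<xi> j\<bar> powr \<gamma>) \<le> (\<Prod>j\<in>J. c j * exp (v j / (4 * N) * (\<xi> j)\<^sup>2))"
    proof (intro prod_mono conjI)
      fix j assume "j \<in> J"
      then show "1 + \<bar>\<xi> j\<bar> powr \<gamma> \<le> c j * exp (v j / (4 * N) * (\<xi> j)\<^sup>2)"
        unfolding c_def using v[of j] N \<gamma> by (intro one_plus_powr_le_exp) auto
    qed auto
    also have "\<dots> = prod c J * exp (\<Sum>j\<in>J. v j / (4 * N) * (\<xi> j)\<^sup>2)"
      by (simp add: prod.distrib exp_sum J)
    also have "\<dots> \<le> prod c J * exp (Q \<xi> / 4)"
    proof (intro mult_left_mono)
      have Q0: "0 \<le> Q \<xi>" if "J \<noteq> {}"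
      proof -
        from that obtain j where j: "j \<in> J" by blast
        have "0 \<le> v j * (\<xi> j)\<^sup>2" using v[OF j] by simp
        also have "\<dots> \<le> Q \<xi>" unfolding Q_def by (rule lower_v[OF j])
        finally show ?thesis .
      qed
      have "(\<Sum>j\<in>J. v j * (\<xi> j)\<^sup>2) \<le> (\<Sum>j\<in>J. Q \<xi>)"
        unfolding Q_def by (intro sum_mono lower_v)
      also have "\<dots> \<le> N * Q \<xi>"
        using Q0 by (cases "J = {}") (auto simp: N_def Q_def intro!: mult_right_mono)
      finally have "(\<Sum>j\<in>J. v j * (\<xi> j)\<^sup>2) / (4 * N) \<le> N * Q \<xi> / (4 * N)"
        using N by (intro divide_right_mono) auto
      then have "(\<Sum>j\<in>J. v j / (4 * N) * (\<xi> j)\<^sup>2) \<le> Q \<xi> / 4"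
        using N by (simp add: sum_divide_distrib)
      then show "exp (\<Sum>j\<in>J. v j / (4 * N) * (\<xi> j)\<^sup>2) \<le> exp (Q \<xi> / 4)" by simp
    qed (simp add: prod_nonneg c0)
    finally have "(\<Prod>j\<in>J. 1 + \<bar>\<xi> j\<bar> powr \<gamma>) * exp (- Q \<xi> / 2) \<le> (prod c J * exp (Q \<xi> / 4))
        * exp (- Q \<xi> / 2)"
      by (intro mult_right_mono) auto
    also have "\<dots> = prod c J * exp (- (Q \<xi> / 4))"
      by (simp add: mult.assoc flip: exp_add)
    finally show ?thesis .
  qed
  have Q4: "Q \<xi> / 4 = (\<Sum>i\<in>J. \<Sum>k\<in>J. \<xi> i * \<xi> k * (q i k / 4))" for \<xi>
    by (simp add: Q_def sum_divide_distrib)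
  have "(\<integral>\<^sup>+ \<xi>. ennreal ((\<Prod>j\<in>J. 1 + \<bar>\<xi> j\<bar> powr \<gamma>) * exp (- Q \<xi> / 2)) \<partial>(Pi\<^sub>M J (\<lambda>_. lborel)))
     \<le> (\<integral>\<^sup>+ \<xi>. ennreal (prod c J) * ennreal (exp (- (Q \<xi> / 4))) \<partial>(Pi\<^sub>M J (\<lambda>_. lborel)))"
    using pw by (intro nn_integral_mono) (simp add: c0 prod_nonneg ennreal_leI flip: ennreal_mult)
  also have "\<dots> = ennreal (prod c J) * (\<integral>\<^sup>+ \<xi>. ennreal (exp (- (Q \<xi> / 4))) \<partial>(Pi\<^sub>M J (\<lambda>_. lborel)))"
    unfolding Q_def by (intro nn_integral_cmult) measurable
  also have "\<dots> \<le> ennreal (prod c J) * ennreal (\<Prod>j\<in>J. sqrt (pi / (w j / 4)))"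
  proof (intro mult_left_mono)
    show "(\<integral>\<^sup>+ \<xi>. ennreal (exp (- (Q \<xi> / 4))) \<partial>(Pi\<^sub>M J (\<lambda>_. lborel)))
        \<le> ennreal (\<Prod>j\<in>J. sqrt (pi / (w j / 4)))"
      unfolding Q4
    proof (rule nn_integral_exp_quadratic_form_le[OF J key])
      fix \<xi> :: "'i \<Rightarrow> real" and j assume "j \<in> J" "\<And>k. k \<in> J \<Longrightarrow> key j < key k \<Longrightarrow> \<xi> k = 0"
      then show "w j / 4 * (\<xi> j)\<^sup>2 \<le> (\<Sum>i\<in>J. \<Sum>k\<in>J. \<xi> i * \<xi> k * (q i k / 4))"
        using lower_w[of j \<xi>] unfolding Q4[symmetric] Q_def by simp
    qed (use w sym in auto)
  qed simp
  also have "\<dots> = ennreal (prod c J * (\<Prod>j\<in>J. sqrt (pi / (w j / 4))))"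
    using w by (intro ennreal_mult[symmetric] prod_nonneg c0 ballI) (auto simp: less_imp_le)
  also have "prod c J * (\<Prod>j\<in>J. sqrt (pi / (w j / 4))) = (\<Prod>j\<in>J. (4 * (4 * N) powr (\<gamma> / 2) * sqrt pi)
      * (v j powr (- \<gamma> / 2) * w j powr (- 1 / 2)))"
    unfolding prod.distrib[symmetric]
  proof (intro prod.cong refl)
    fix j assume j: "j \<in> J"
    have "sqrt (pi / (w j / 4)) = 2 * sqrt pi * w j powr (- 1 / 2)"
      using w[OF j] by (simp add: real_sqrt_divide real_sqrt_mult powr_minus powr_half_sqrt field_simps)
    moreover have "c j = 2 * (4 * N) powr (\<gamma> / 2) * v j powr (- \<gamma> / 2)"
      using v[OF j] N by (simp add: c_def powr_divide powr_minus field_simps)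
    ultimately show "c j * sqrt (pi / (w j / 4)) = (4 * (4 * N) powr (\<gamma> / 2) * sqrt pi)
        * (v j powr (- \<gamma> / 2) * w j powr (- 1 / 2))"
      by simp
  qed
  also have "\<dots> = (4 * (4 * N) powr (\<gamma> / 2) * sqrt pi) ^ card J * (\<Prod>j\<in>J. v j powr (- \<gamma> / 2)
      * w j powr (- 1 / 2))"
    by (simp add: prod.distrib)
  finally show ?thesis by (simp add: Q_def)
qed

section \<open>Characteristic functions and joint moments\<close>

lemma (in prob_space) gaussian_rv_square_integrable:
  assumes "gaussian_rv M X"
  shows "integrable M (\<lambda>w. (X w)\<^sup>2)"
proof -
  have [measurable]: "X \<in> borel_measurable M" using assms by (simp add: gaussian_rv_def)
  consider (dist) m \<sigma> where "0 < \<sigma>" "distributed M lborel X (normal_density m \<sigma>)" | (const) m where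
      "AE w in M. X w = m"
    using assms by (auto simp: gaussian_rv_def)
  then show ?thesis
  proof cases
    case dist
    have "integrable lborel (\<lambda>x. normal_density m \<sigma> x * x\<^sup>2)"
    proof -
      have "integrable lborel (\<lambda>x. normal_density m \<sigma> x * (x - m)^2 + (2 * m)
          * (normal_density m \<sigma> x * (x - m)^1) + m\<^sup>2 * (normal_density m \<sigma> x * (x-m)^0))"
        using dist(1) by (intro Bochner_Integration.integrable_add integrable_mult_right
            integrable_normal_moment)
      also have "(\<lambda>x. normal_density m \<sigma> x * (x - m)^2 + (2 * m)
          * (normal_density m \<sigma> x * (x - m)^1) + m\<^sup>2 * (normal_density m \<sigma> x * (x-m)^0))
          = (\<lambda>x. normal_density m \<sigma> x * x\<^sup>2)"
        by (simp add: fun_eq_iff power2_eq_square algebra_simps)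
      finally show ?thesis .
    qed
    then show ?thesis
      using distributed_integrable[OF dist(2), of "\<lambda>x. x\<^sup>2"] by simp
  next
    case const
    then have "integrable M (\<lambda>w. (X w)\<^sup>2) \<longleftrightarrow> integrable M (\<lambda>w. m\<^sup>2)"
      by (intro integrable_cong_AE) auto
    then show ?thesis by simp
  qed
qed

text \<open>The degenerate case obeys the same formula: mean zero forces the constant to be 0, so
  both sides are 1.\<close>

lemma (in prob_space) gaussian_rv_char:
  assumes X: "gaussian_rv M X" and mean: "expectation X = 0"
  shows "(CLINT w|M. iexp (X w)) = complex_of_real (exp (- expectation (\<lambda>w. (X w)\<^sup>2) / 2))"
proof -
  have [measurable]: "X \<in> borel_measurable M" using assms by (simp add: gaussian_rv_def)
  consider (dist) m \<sigma> where "0 < \<sigma>" "distributed M lborel X (normal_density m \<sigma>)" | (const) m where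
      "AE w in M. X w = m"
    using X by (auto simp: gaussian_rv_def)
  then show ?thesis
  proof cases
    case dist
    have m: "m = 0"
      using normal_distributed_expectation[OF dist] mean by simp
    have var: "expectation (\<lambda>w. (X w)\<^sup>2) = \<sigma>\<^sup>2"
      using normal_distributed_variance[OF dist] mean by simp
    have d: "distributed M lborel (\<lambda>w. X w / \<sigma>) std_normal_density"
      using normal_standard_normal_convert[of \<sigma> X 0] dist m by simp
    have "(CLINT w|M. iexp (X w)) = (CLINT w|M. iexp (\<sigma> * (X w / \<sigma>)))"
      using dist by simp
    also have "\<dots> = char (distr M borel (\<lambda>w. X w / \<sigma>)) \<sigma>"
      unfolding char_def by (subst integral_distr) auto
    also have "distr M borel (\<lambda>w. X w / \<sigma>) = std_normal_distribution"
      using distributed_distr_eq_density[OF d] by (simp cong: distr_cong)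
    finally show ?thesis by (simp add: char_std_normal_distribution var)
  next
    case const
    have "expectation X = m"
      using integral_cong_AE[of X M "\<lambda>_. m"] const by (simp add: prob_space)
    with mean const have ae: "AE w in M. X w = 0" by simp
    have "(CLINT w|M. iexp (X w)) = (CLINT w|M. 1)"
      by (rule integral_cong_AE) (use ae in auto)
    moreover have "expectation (\<lambda>w. (X w)\<^sup>2) = expectation (\<lambda>w. 0)"
      by (rule integral_cong_AE) (use ae in auto)
    ultimately show ?thesis by (simp add: prob_space)
  qed
qed

lemma real_fbs_measurable:
  assumes "real_fbs M H X" "t \<in> orthant"
  shows "X t \<in> borel_measurable M"
proof -
  have "gaussian_rv M (\<lambda>w. \<Sum>u\<in>{t}. 1 * X u w)"
    using assms unfolding real_fbs_def centered_gaussian_field_def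
        by (elim conjE allE[of _ "{t}"] allE[of _ "\<lambda>_. 1"]) simp
  then show ?thesis by (simp add: gaussian_rv_def)
qed

text \<open>Gaussianity is stated for combinations over sets of parameters, so the indexed sum is
  carried over to the image of s; this is where injectivity enters.\<close>

lemma (in prob_space) real_fbs_char:
  assumes X: "real_fbs M H X" and J: "finite J" and inj: "inj_on s J" and s: "\<And>j. j \<in> J \<Longrightarrow> s j \<in> orthant"
  shows "(CLINT w|M. iexp (\<Sum>j\<in>J. \<xi> j * X (s j) w))
    = complex_of_real (exp (- fbs_form H J s \<xi> / 2))"
proof -
  have gauss: "\<And>S c. finite S \<Longrightarrow> S \<subseteq> orthant \<Longrightarrow> gaussian_rv M (\<lambda>w. \<Sum>t\<in>S. c t * X t w)"
    and mean: "\<And>t. t \<in> orthant \<Longrightarrow> expectation (X t) = 0"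
    and cov: "\<And>s t. s \<in> orthant \<Longrightarrow> t \<in> orthant \<Longrightarrow> expectation (\<lambda>w. X s w * X t w) = fbs_cov H s t"
    using X by (auto simp: real_fbs_def centered_gaussian_field_def)
  have g1: "gaussian_rv M (X t)" if "t \<in> orthant" for t
    using gauss[of "{t}" "\<lambda>_. 1"] that by simp
  have [measurable]: "X t \<in> borel_measurable M" if "t \<in> orthant" for t
    using g1[OF that] by (simp add: gaussian_rv_def)
  have sq: "integrable M (\<lambda>w. (X t w)\<^sup>2)" if "t \<in> orthant" for t
    by (rule gaussian_rv_square_integrable[OF g1[OF that]])
  have int1: "integrable M (X t)" if "t \<in> orthant" for t
    using square_integrable_imp_integrable[OF _ sq[OF that]] that by simp
  have int2: "integrable M (\<lambda>w. X t w * X u w)" if "t \<in> orthant" "u \<in> orthant" for t u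
    using that sq by (intro integrable_mult_of_squares) auto
  define Y where "Y w = (\<Sum>j\<in>J. \<xi> j * X (s j) w)" for w
  have "Y = (\<lambda>w. \<Sum>t\<in>s ` J. \<xi> (inv_into J s t) * X t w)"
    unfolding Y_def by (subst sum.reindex[OF inj]) (auto simp: inv_into_f_f[OF inj] fun_eq_iff
        intro!: sum.cong)
  then have gY: "gaussian_rv M Y"
    using gauss[of "s ` J" "\<lambda>t. \<xi> (inv_into J s t)"] J s by auto
  have mY: "expectation Y = 0"
    unfolding Y_def using int1 s mean by (subst Bochner_Integration.integral_sum) auto
  have "expectation (\<lambda>w. (Y w)\<^sup>2) = expectation (\<lambda>w. \<Sum>i\<in>J. \<Sum>k\<in>J. \<xi> i * \<xi> k * (X (s i) w * X (s k) w))"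
    unfolding Y_def power2_eq_square sum_product
    by (intro Bochner_Integration.integral_cong sum.cong) auto
  also have "\<dots> = (\<Sum>i\<in>J. \<Sum>k\<in>J. \<xi> i * \<xi> k * expectation (\<lambda>w. X (s i) w * X (s k) w))"
    using int2 s by (simp add: Bochner_Integration.integral_sum Bochner_Integration.integrable_sum)
  also have "\<dots> = fbs_form H J s \<xi>"
    using s cov by (intro sum.cong) auto
  finally show ?thesis using gaussian_rv_char[OF gY mY] by (simp add: Y_def)
qed

text \<open>For non-integrable f the Bochner integral is 0 by default, so the bound holds for every
  f.\<close>

lemma norm_integral_le_nn_integral:
  fixes f :: "'a \<Rightarrow> 'b :: {banach, second_countable_topology}"
  shows "ennreal (norm (integral\<^sup>L M f)) \<le> (\<integral>\<^sup>+ x. norm (f x) \<partial>M)"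
  by (cases "integrable M f") (simp_all add: integral_norm_bound_ennreal not_integrable_integral_eq)

text \<open>Every factor is expanded by its Fourier integral, Fubini moves the expectation inside,
  and the characteristic function appears. The shift x contributes only a phase of modulus 1, so the
  bound is uniform in x.\<close>

lemma (in prob_space) real_fbs_abs_expectation_prod_le:
  fixes J :: "'j set"
  assumes X: "real_fbs M H X" and J: "finite J" and inj: "inj_on s J" and s: "\<And>j. j \<in> J \<Longrightarrow> s j \<in> orthant"
    and \<kappa>: "integrable lborel \<kappa>" and k: "\<And>y. complex_of_real (k y)
        = (CLBINT \<xi>. complex_of_real (\<kappa> \<xi>) * iexp (\<xi> * y))"
    and k_meas [measurable]: "k \<in> borel_measurable borel"
  shows "ennreal \<bar>expectation (\<lambda>w. \<Prod>j\<in>J. k (X (s j) w - x))\<bar> \<le>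
    (\<integral>\<^sup>+ \<xi>. ennreal ((\<Prod>j\<in>J. \<bar>\<kappa> (\<xi> j)\<bar>) * exp (- fbs_form H J s \<xi> / 2)) \<partial>(Pi\<^sub>M J (\<lambda>_. lborel)))"
proof -
  interpret P: product_sigma_finite "\<lambda>_::'j. lborel :: real measure" ..
  interpret PF: finite_product_sigma_finite "\<lambda>_::'j. lborel :: real measure" J by standard (rule J)
  interpret PS: pair_sigma_finite M "Pi\<^sub>M J (\<lambda>_. lborel :: real measure)" ..
  have [measurable]: "\<kappa> \<in> borel_measurable borel" using borel_measurable_integrable[OF \<kappa>] by simp
  have [measurable]: "j \<in> J \<Longrightarrow> X (s j) \<in> borel_measurable M" for j using s real_fbs_measurable[OF X]
      by auto
  define Q where "Q \<xi> = fbs_form H J s \<xi>" for \<xi>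
  define F where "F w \<xi> = (\<Prod>j\<in>J. complex_of_real (\<kappa> (\<xi> j)) * iexp (\<xi> j * (X (s j) w - x)))" for w \<xi>
  have F_meas [measurable]: "case_prod F \<in> borel_measurable (M \<Otimes>\<^sub>M Pi\<^sub>M J (\<lambda>_. lborel))"
    unfolding F_def[abs_def] by measurable
  have int_factor: "integrable lborel (\<lambda>\<xi>. complex_of_real (\<kappa> \<xi>) * iexp (\<xi> * y))" for y
    by (rule Bochner_Integration.integrable_bound[OF \<kappa>]) (auto simp: norm_mult)
  have normF: "norm (F w \<xi>) = (\<Prod>j\<in>J. \<bar>\<kappa> (\<xi> j)\<bar>)" for w \<xi>
    by (simp add: F_def norm_mult prod_norm[symmetric])
  have int_abs: "integrable (Pi\<^sub>M J (\<lambda>_. lborel)) (\<lambda>\<xi>. \<Prod>j\<in>J. \<bar>\<kappa> (\<xi> j)\<bar>)"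
    using \<kappa> by (intro P.product_integrable_prod J) auto
  have intF: "integrable (M \<Otimes>\<^sub>M Pi\<^sub>M J (\<lambda>_. lborel)) (case_prod F)"
  proof (rule PS.Fubini_integrable)
    show "integrable M (\<lambda>w. LINT \<xi>|Pi\<^sub>M J (\<lambda>_. lborel). norm (case (w, \<xi>) of (w, \<xi>) \<Rightarrow> F w \<xi>))"
      by (simp add: normF)
    show "AE w in M. integrable (Pi\<^sub>M J (\<lambda>_. lborel)) (\<lambda>\<xi>. case (w, \<xi>) of (w, \<xi>) \<Rightarrow> F w \<xi>)"
    proof (intro AE_I2)
      fix w
      show "integrable (Pi\<^sub>M J (\<lambda>_. lborel)) (\<lambda>\<xi>. case (w, \<xi>) of (w, \<xi>) \<Rightarrow> F w \<xi>)"
        unfolding F_def prod.case by (intro P.product_integrable_prod J int_factor)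
    qed
  qed measurable
  have prod_k: "complex_of_real (\<Prod>j\<in>J. k (X (s j) w - x)) = (LINT \<xi>|Pi\<^sub>M J (\<lambda>_. lborel). F w \<xi>)" for w
    unfolding F_def by (subst P.product_integral_prod[OF J int_factor]) (simp add: k)
  have "complex_of_real (expectation (\<lambda>w. \<Prod>j\<in>J. k (X (s j) w - x)))
      = (CLINT w|M. (LINT \<xi>|Pi\<^sub>M J (\<lambda>_. lborel). F w \<xi>))"
    unfolding integral_complex_of_real[symmetric] by (simp only: prod_k)
  also have "\<dots> = (LINT \<xi>|Pi\<^sub>M J (\<lambda>_. lborel). (CLINT w|M. F w \<xi>))"
    using PS.Fubini_integral[OF intF] by simp
  also have "\<dots> = (LINT \<xi>|Pi\<^sub>M J (\<lambda>_. lborel). (\<Prod>j\<in>J. complex_of_real (\<kappa> (\<xi> j)) * iexp (- \<xi> j * x))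
      * complex_of_real (exp (- Q \<xi> / 2)))"
  proof (intro Bochner_Integration.integral_cong refl)
    fix \<xi>
    have "F w \<xi> = (\<Prod>j\<in>J. complex_of_real (\<kappa> (\<xi> j)) * iexp (- \<xi> j * x))
        * iexp (\<Sum>j\<in>J. \<xi> j * X (s j) w)" for w
    proof -
      have "iexp (\<Sum>j\<in>J. \<xi> j * X (s j) w) = (\<Prod>j\<in>J. iexp (\<xi> j * X (s j) w))"
        by (simp add: exp_sum[OF J] sum_distrib_left)
      then show ?thesis
        unfolding F_def by (simp add: prod.distrib[symmetric] exp_add[symmetric] mult.assoc)
            (simp add: algebra_simps)
    qed
    then show "(CLINT w|M. F w \<xi>) = (\<Prod>j\<in>J. complex_of_real (\<kappa> (\<xi> j)) * iexp (- \<xi> j * x))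
        * complex_of_real (exp (- Q \<xi> / 2))"
      using real_fbs_char[OF X J inj s, of \<xi>] by (simp add: Q_def)
  qed
  finally have eq: "complex_of_real (expectation (\<lambda>w. \<Prod>j\<in>J. k (X (s j) w - x))) = \<dots>" .
  have "\<bar>expectation (\<lambda>w. \<Prod>j\<in>J. k (X (s j) w - x))\<bar>
      = norm (complex_of_real (expectation (\<lambda>w. \<Prod>j\<in>J. k (X (s j) w - x))))"
    by simp
  then have "ennreal \<bar>expectation (\<lambda>w. \<Prod>j\<in>J. k (X (s j) w - x))\<bar> \<le>
    (\<integral>\<^sup>+ \<xi>. norm ((\<Prod>j\<in>J. complex_of_real (\<kappa> (\<xi> j)) * iexp (- \<xi> j * x))
        * complex_of_real (exp (- Q \<xi> / 2))) \<partial>(Pi\<^sub>M J (\<lambda>_. lborel)))"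
    unfolding eq by (simp only:) (rule norm_integral_le_nn_integral)
  also have "\<dots> = (\<integral>\<^sup>+ \<xi>. ennreal ((\<Prod>j\<in>J. \<bar>\<kappa> (\<xi> j)\<bar>) * exp (- Q \<xi> / 2)) \<partial>(Pi\<^sub>M J (\<lambda>_. lborel)))"
    by (intro nn_integral_cong arg_cong[where f=ennreal]) (simp add: norm_mult prod_norm[symmetric])
  finally show ?thesis by (simp add: Q_def)
qed

section \<open>Pointwise bounds by singular kernels\<close>

text \<open>Distance to the nearest point of A, capped at 1: the cap covers an empty A, meets the
  condition \<open>\<rho> \<le> 1\<close> of local nondeterminism, and makes negative powers grow
  with their exponent.\<close>

definition sep :: "('j \<Rightarrow> real) \<Rightarrow> 'j \<Rightarrow> 'j set \<Rightarrow> real" where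
  "sep x j A = Min (insert 1 ((\<lambda>k. \<bar>x j - x k\<bar>) ` A))"

lemma sep_empty [simp]: "sep x j {} = 1" by (simp add: sep_def)

lemma sep_insert: "finite A \<Longrightarrow> sep x j (insert k A) = min \<bar>x j - x k\<bar> (sep x j A)"
  unfolding sep_def image_insert by (subst insert_commute, subst Min_insert) auto

lemma sep_le_one: "finite A \<Longrightarrow> sep x j A \<le> 1"
  by (simp add: sep_def)

lemma sep_le: "finite A \<Longrightarrow> k \<in> A \<Longrightarrow> sep x j A \<le> \<bar>x j - x k\<bar>"
  by (simp add: sep_def)

lemma sep_pos: "finite A \<Longrightarrow> (\<And>k. k \<in> A \<Longrightarrow> x k \<noteq> x j) \<Longrightarrow> 0 < sep x j A"
  by (fastforce simp: sep_def)

lemma sep_cases: "finite A \<Longrightarrow> sep x j A = 1 \<or> (\<exists>k\<in>A. sep x j A = \<bar>x j - x k\<bar>)"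
  using Min_in[of "insert 1 ((\<lambda>k. \<bar>x j - x k\<bar>) ` A)"] by (auto simp: sep_def simp del: Min_insert)

text \<open>A point is nearest either to its predecessor or to its successor, so every gap between
  consecutive points is counted at most twice.\<close>

lemma prod_sep_past_sq_le:
  assumes "finite J" "inj_on x J"
  shows "(\<Prod>j\<in>J. sep x j {k \<in> J - {j}. x k \<le> x j})\<^sup>2 \<le> (\<Prod>j\<in>J. sep x j (J - {j}))"
  using assms
proof (induction J rule: finite_ranking_induct[where f = x])
  case empty
  then show ?case by simp
next
  case (insert m J)
  show ?case
  proof (cases "m \<in> J")
    case True
    then show ?thesis using insert by (simp add: insert_absorb)
  next
    case False
    have less: "x y < x m" if "y \<in> J" for y
    proof -
      have "x y \<noteq> x m" using insert.prems that False by (metis inj_on_def insertCI)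
      then show ?thesis using insert.hyps(2)[OF that] by simp
    qed
    define g where "g = sep x m J"
    define r where "r j = sep x j (J - {j})" for j
    have r0: "0 < r j" if "j \<in> J" for j
      unfolding r_def using insert.hyps(1) insert.prems that by (intro sep_pos) (auto simp: inj_on_def)
    have g: "0 < g" "g \<le> 1"
      unfolding g_def using insert.hyps(1) less by (auto intro!: sep_pos sep_le_one) force
    have past_m: "{k \<in> insert m J - {m}. x k \<le> x m} = J" using less False by force
    have past_j: "{k \<in> insert m J - {j}. x k \<le> x j} = {k \<in> J - {j}. x k \<le> x j}" if "j \<in> J" for j
      using less[OF that] by auto
    have "(\<Prod>j\<in>insert m J. sep x j {k \<in> insert m J - {j}. x k \<le> x j})
       = sep x m {k \<in> insert m J - {m}. x k \<le> x m} * (\<Prod>j\<in>J. sep x j {k \<in> insert m J - {j}. x k \<le> x j})"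
      using insert.hyps(1) False by (rule prod.insert)
    also have "\<dots> = g * (\<Prod>j\<in>J. sep x j {k \<in> J - {j}. x k \<le> x j})"
      unfolding past_m g_def by (intro arg_cong2[where f="(*)"] prod.cong refl) (simp only: past_j)
    finally have "(\<Prod>j\<in>insert m J. sep x j {k \<in> insert m J - {j}. x k \<le> x j})\<^sup>2
       = g * (g * (\<Prod>j\<in>J. sep x j {k \<in> J - {j}. x k \<le> x j})\<^sup>2)"
      by (simp only: power2_eq_square mult_ac)
    also have "\<dots> \<le> g * (g * prod r J)"
      using insert.IH insert.prems g unfolding r_def by (intro mult_left_mono) auto
    also have "g * prod r J \<le> (\<Prod>j\<in>J. min \<bar>x j - x m\<bar> (r j))"
    proof (cases "J = {}")
      case True
      then show ?thesis using g by simp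
    next
      case ne: False
      \<comment> \<open>Adding the largest point m can shrink only the nearest distance of its
        predecessor p, because p lies no farther than m from any other point. For p itself, both
        factors of \<open>g * r p\<close> are at most 1 and g is at most the distance from p to m,
        so the product lies below the minimum.\<close>
      obtain p where p: "p \<in> J" "\<And>y. y \<in> J \<Longrightarrow> x y \<le> x p"
        using insert.hyps(1) ne Max_in[of "x ` J"] Max_ge[of "x ` J"]
        by (metis (no_types) empty_is_image finite_imageI image_iff imageI)
      have r_le: "r j \<le> \<bar>x j - x m\<bar>" if "j \<in> J" "j \<noteq> p" for j
      proof -
        have "r j \<le> \<bar>x j - x p\<bar>"
          unfolding r_def using insert.hyps(1) p that by (intro sep_le) auto
        then show ?thesis using p(2)[OF that(1)] less[OF p(1)] by linarith
      qed
      have "g \<le> \<bar>x m - x p\<bar>" unfolding g_def using insert.hyps(1) p by (intro sep_le)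
      moreover have "r p \<le> 1" unfolding r_def using insert.hyps(1) by (intro sep_le_one) auto
      ultimately have "g * r p \<le> min \<bar>x p - x m\<bar> (r p)"
        using g r0[OF p(1)] mult_mono[of g "\<bar>x p - x m\<bar>" "r p" 1] mult_mono[of g 1 "r p" "r p"]
        by (simp add: abs_minus_commute)
      then have "(g * r p) * prod r (J - {p}) \<le> min \<bar>x p - x m\<bar> (r p)
          * (\<Prod>j\<in>J - {p}. min \<bar>x j - x m\<bar> (r j))"
        using r0 g p r_le by (intro mult_mono prod_mono prod_nonneg) (auto simp: less_imp_le min_def)
      then show ?thesis
        using insert.hyps(1) p by (simp add: prod.remove mult.assoc)
    qed
    also have "g * (\<Prod>j\<in>J. min \<bar>x j - x m\<bar> (r j)) = (\<Prod>j\<in>insert m J. sep x j (insert m J - {j}))"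
    proof -
      have "insert m J - {j} = insert m (J - {j})" if "j \<in> J" for j using that False by auto
      then show ?thesis
        using insert.hyps(1) False by (simp add: g_def r_def sep_insert)
    qed
    finally show ?thesis using g by simp
  qed
qed

text \<open>The value \<open>\<infinity>\<close> at \<open>0\<close>, together with the non-strict order in \<open>past\<close> below, makes every bound by
  \<open>past_weight\<close> trivial when two points share a coordinate.\<close>

definition singular_kernel :: "real \<Rightarrow> real \<Rightarrow> ennreal" where
  "singular_kernel \<eta> x = (if x = 0 then \<infinity> else ennreal (\<bar>x\<bar> powr (- \<eta>)))"

definition past :: "'n \<Rightarrow> ('j \<Rightarrow> real ^ 'n) \<Rightarrow> 'j set \<Rightarrow> 'j \<Rightarrow> 'j set" where
  "past l0 s J j = {k \<in> J - {j}. s k $ l0 \<le> s j $ l0}"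

text \<open>The past is determined by the single coordinate \<open>l0\<close> for all coordinates l,
  because the Gaussian variables are eliminated in one common order.\<close>

definition past_weight :: "real \<Rightarrow> 'n::finite \<Rightarrow> 'j set \<Rightarrow> ('j \<Rightarrow> real ^ 'n) \<Rightarrow> ennreal" where
  "past_weight \<eta> l0 J s = (\<Prod>j\<in>J. \<Prod>l\<in>UNIV. 1 + (\<Sum>k\<in>past l0 s J j. singular_kernel \<eta> (s j $ l - s k $ l)))"

lemma ennreal_factor_le_prod:
  fixes f :: "'a \<Rightarrow> ennreal"
  assumes "finite A" "a \<in> A" "\<And>x. x \<in> A \<Longrightarrow> 1 \<le> f x"
  shows "f a \<le> prod f A"
proof -
  have "f a * 1 \<le> f a * prod f (A - {a})"
    using assms by (intro mult_left_mono prod_ge_1) auto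
  then show ?thesis using assms by (simp add: prod.remove)
qed

text \<open>Of two points one is always in the past of the other, whichever coordinate they
  share.\<close>

lemma past_weight_eq_infinity:
  assumes "finite J" "j \<in> J" "k \<in> J" "j \<noteq> k" "s j $ l = s k $ l"
  shows "past_weight \<eta> l0 J s = \<infinity>"
proof -
  obtain i i' where i: "i \<in> J" "i' \<in> past l0 s J i" "s i $ l = s i' $ l"
    using assms by (cases "s k $ l0 \<le> s j $ l0") (force simp: past_def)+
  let ?f = "\<lambda>j l. 1 + (\<Sum>k\<in>past l0 s J j. singular_kernel \<eta> (s j $ l - s k $ l))"
  have fin: "finite (past l0 s J i)" using assms by (simp add: past_def)
  have "\<infinity> \<le> singular_kernel \<eta> (s i $ l - s i' $ l)" using i by (simp add: singular_kernel_def)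
  also have "\<dots> \<le> (\<Sum>k\<in>past l0 s J i. singular_kernel \<eta> (s i $ l - s k $ l))"
    using fin i by (intro member_le_sum) auto
  also have "\<dots> \<le> ?f i l" by (simp add: add_increasing)
  also have "\<dots> \<le> prod (?f i) UNIV" by (rule ennreal_factor_le_prod) auto
  also have "\<dots> \<le> past_weight \<eta> l0 J s"
    unfolding past_weight_def using assms i by
        (intro ennreal_factor_le_prod[where f="\<lambda>j. prod (?f j) UNIV"] prod_ge_1) auto
  finally show ?thesis by (simp add: top_unique)
qed

text \<open>The minimum in \<open>sep\<close> is attained either at the cap 1 or at some k, so the
  power is one of the summands on the right.\<close>

lemma powr_sep_le_one_plus_sum:
  assumes "finite A" "0 \<le> \<eta>" "\<And>k. k \<in> A \<Longrightarrow> x k \<noteq> x j"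
  shows "ennreal (sep x j A powr (- \<eta>)) \<le> 1 + (\<Sum>k\<in>A. singular_kernel \<eta> (x j - x k))"
proof (cases "sep x j A = 1")
  case False
  then obtain k where k: "k \<in> A" "sep x j A = \<bar>x j - x k\<bar>" using sep_cases[OF assms(1), of x j] by auto
  then have "ennreal (sep x j A powr (- \<eta>)) = singular_kernel \<eta> (x j - x k)"
    using assms(3)[OF k(1)] by (simp add: singular_kernel_def)
  also have "\<dots> \<le> (\<Sum>k\<in>A. singular_kernel \<eta> (x j - x k))"
    using assms k by (intro member_le_sum) auto
  finally show ?thesis by (simp add: add_increasing)
qed simp

text \<open>The maximum is split into its powers with exponents proportional to \<open>1 / H l\<close>, so that all
    coordinates
  receive the same exponent.\<close>

lemma Max_powr_le_prod:
  fixes g H :: "'n::finite \<Rightarrow> real"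
  assumes g: "\<And>l. 0 < g l" and H: "\<And>l. 0 < H l" and D: "0 \<le> D"
  shows "(MAX l. g l powr (2 * H l)) powr (- D / 2) \<le> (\<Prod>l\<in>UNIV. g l powr (- (D / (\<Sum>l\<in>UNIV. 1 / H l))))"
proof -
  define m where "m = (MAX l. g l powr (2 * H l))"
  define T where "T = (\<Sum>l\<in>UNIV. 1 / H l)"
  have T: "0 < T" unfolding T_def using H by (intro sum_pos) auto
  have ge: "g l powr (2 * H l) \<le> m" for l unfolding m_def by simp
  have m: "0 < m" using ge[of undefined] g[of undefined]
      by (metis less_le_trans powr_gt_zero less_irrefl)
  have "m powr (- D / 2) = m powr (\<Sum>l\<in>UNIV. - (D / T) / 2 * (1 / H l))"
    unfolding sum_distrib_left[symmetric] T_def[symmetric] using T by simp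
  also have "\<dots> = (\<Prod>l\<in>UNIV. m powr (- (D / T) / 2 * (1 / H l)))"
    using m by (simp add: powr_sum)
  also have "\<dots> \<le> (\<Prod>l\<in>UNIV. g l powr (- (D / T)))"
  proof (intro prod_mono conjI)
    fix l
    have "m powr (- (D / T) / 2 * (1 / H l)) \<le> (g l powr (2 * H l)) powr (- (D / T) / 2 * (1 / H l))"
      using ge[of l] g[of l] H[of l] D T by (intro powr_mono2') auto
    also have "\<dots> = g l powr (- (D / T))"
      using H[of l] by (simp add: powr_powr)
    finally show "m powr (- (D / T) / 2 * (1 / H l)) \<le> g l powr (- (D / T))" .
  qed auto
  finally show ?thesis by (simp add: m_def T_def)
qed

text \<open>Each point contributes \<open>lnd_const powr (- 1/2)\<close> twice, once through the
  bounds \<open>v\<close> and once through the bounds \<open>w\<close>, which yields the power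
  -n.\<close>

definition past_weight_const :: "real ^ 'n \<Rightarrow> real \<Rightarrow> real \<Rightarrow> nat \<Rightarrow> nat \<Rightarrow> real" where
  "past_weight_const H \<alpha> \<gamma> D n =
    ((4 * (4 * (real n + 1)) powr (\<gamma> / 2) * sqrt pi) ^ n * lnd_const H \<alpha> powr (- real n)) ^ D"

lemma past_weight_const_pos: "0 < past_weight_const H \<alpha> \<gamma> D n"
  using lnd_const_pos[of H \<alpha>] by (simp add: past_weight_const_def)

text \<open>The bounds \<open>v\<close> control every frequency with the others free and use the
  distance \<open>r\<close> to all other points in coordinate \<open>l0\<close>; the bounds
  \<open>w\<close> concern vectors supported on the past and use the distances \<open>g\<close> to
  the past in the best coordinate. Since \<open>v\<close> enters with power
  \<open>- \<gamma> / 2\<close> only, \<open>prod_sep_past_sq_le\<close> can replace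
  \<open>r\<close> by the square of \<open>g\<close>. The D-th power then gives
  \<open>2 * \<gamma> * D\<close> from \<open>v\<close> and, split over the coordinates, D divided
  by the sum of the \<open>1 / H $ l\<close> from \<open>w\<close>.\<close>

lemma weighted_gaussian_integral_le_past_weight:
  fixes H :: "real ^ 'n" and l0 :: 'n and D n :: nat
  assumes H: "\<And>l. 0 < H $ l" "\<And>l. H $ l < 1" and \<alpha>: "0 < \<alpha>" "\<alpha> \<le> 1" and \<gamma>: "0 < \<gamma>" "\<gamma> \<le> 1"
  defines "\<eta> \<equiv> real D / (\<Sum>l\<in>UNIV. 1 / H $ l) + 2 * \<gamma> * real D"
  assumes J: "finite J" "card J = n" and s: "\<And>j l. j \<in> J \<Longrightarrow> \<alpha> \<le> s j $ l"
  shows "(\<integral>\<^sup>+ \<xi>. ennreal ((\<Prod>j\<in>J. 1 + \<bar>\<xi> j\<bar> powr \<gamma>)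
      * exp (- fbs_form H J s \<xi> / 2)) \<partial>(Pi\<^sub>M J (\<lambda>_. lborel))) ^ D
     \<le> ennreal (past_weight_const H \<alpha> \<gamma> D n) * past_weight \<eta> l0 J s" (is "?I ^ D \<le> _")
proof -
  define \<kappa> where "\<kappa> = lnd_const H \<alpha>"
  have \<kappa>: "0 < \<kappa>" "\<kappa> \<le> 1" by (simp_all add: \<kappa>_def lnd_const_pos lnd_const_le_one)
  note lnd = fbs_cov_local_nondeterminism[OF H \<alpha>, folded \<kappa>_def]
  define T where "T = (\<Sum>l\<in>UNIV. 1 / H $ l)"
  have T: "0 < T" unfolding T_def using H by (intro sum_pos) auto
  define \<delta> where "\<delta> = 2 * \<gamma> * real D"
  define C0 where "C0 = (4 * (4 * (real n + 1)) powr (\<gamma> / 2) * sqrt pi) ^ n"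
  define C where "C = (C0 * \<kappa> powr (- real n)) ^ D"
  have C0: "0 < C0" by (simp add: C0_def)
  have C: "0 < C" unfolding C_def using C0 \<kappa> by simp
  have C_eq: "past_weight_const H \<alpha> \<gamma> D n = C" by (simp add: past_weight_const_def C_def C0_def \<kappa>_def)
  show ?thesis
  proof (cases "\<exists>j\<in>J. \<exists>k\<in>J. \<exists>l. j \<noteq> k \<and> s j $ l = s k $ l")
    case True
    then have "past_weight \<eta> l0 J s = \<infinity>" using past_weight_eq_infinity[OF J(1)] by metis
    then show ?thesis using C by (simp add: C_eq ennreal_mult_top)
  next
    case False
    then have ne: "s k $ l \<noteq> s j $ l" if "j \<in> J" "k \<in> J" "k \<noteq> j" for j k l
      using that by metis
    define P where "P = past l0 s J"
    have P: "finite (P j)" "P j \<subseteq> J - {j}" for j using J by (auto simp: P_def past_def)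
    define g where "g j l = sep (\<lambda>k. s k $ l) j (P j)" for j l
    have g: "0 < g j l" "g j l \<le> 1" if "j \<in> J" for j l
      unfolding g_def using P[of j] ne that by (auto intro!: sep_pos sep_le_one)
    define r where "r j = sep (\<lambda>k. s k $ l0) j (J - {j})" for j
    have r: "0 < r j" "r j \<le> 1" if "j \<in> J" for j
      unfolding r_def using J ne that by (auto intro!: sep_pos sep_le_one)
    define v where "v j = \<kappa> * r j powr (2 * H $ l0)" for j
    define mx where "mx j = (MAX l. g j l powr (2 * H $ l))" for j
    define w where "w j = \<kappa> * mx j" for j
    have Max_pos: "0 < mx j" if "j \<in> J" for j
    proof -
      have "g j l0 powr (2 * H $ l0) \<le> mx j" by (simp add: mx_def)
      moreover have "0 < g j l0 powr (2 * H $ l0)" using g[OF that, of l0] by simp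
      ultimately show ?thesis by linarith
    qed
    let ?m = "\<kappa> powr (- real n) * (((\<Prod>j\<in>J. g j l0)\<^sup>2) powr (- \<gamma>) * (\<Prod>j\<in>J. mx j powr (- 1/2)))"
    have I_le: "?I \<le> ennreal (C0 * (\<Prod>j\<in>J. v j powr (- \<gamma> / 2) * w j powr (- 1 / 2)))"
      unfolding C0_def J(2)[symmetric]
    proof (rule nn_integral_weighted_exp_quadratic_form_le[where key = "\<lambda>j. s j $ l0", OF J(1)])
      show "inj_on (\<lambda>j. s j $ l0) J" using ne by (auto simp: inj_on_def)
      show "fbs_cov H (s i) (s k) = fbs_cov H (s k) (s i)" for i k by (rule fbs_cov_commute)
      show "0 < w j" if "j \<in> J" for j using Max_pos[OF that] \<kappa> by (simp add: w_def)
      show "0 < v j" if "j \<in> J" for j using r[OF that] \<kappa> by (simp add: v_def)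
      show "v j \<le> 1" if "j \<in> J" for j
      proof -
        have "r j powr (2 * H $ l0) \<le> 1 powr (2 * H $ l0)"
          using r[OF that] H[of l0] by (intro powr_mono2) auto
        then show ?thesis unfolding v_def using \<kappa> by (intro mult_le_one) auto
      qed
      show "0 < \<gamma>" "\<gamma> \<le> 1" by fact+
      show "v j * (\<xi> j)\<^sup>2 \<le> fbs_form H J s \<xi>" if "j \<in> J" for \<xi> j
        unfolding v_def using J s that r[OF that]
        by (intro lnd) (auto simp: r_def intro!: sep_le[where x="\<lambda>k. s k $ l0"])
      show "w j * (\<xi> j)\<^sup>2 \<le> fbs_form H J s \<xi>"
        if j: "j \<in> J" and zero: "\<And>k. k \<in> J \<Longrightarrow> s j $ l0 < s k $ l0 \<Longrightarrow> \<xi> k = 0" for \<xi> j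
      proof -
        have "mx j \<in> range (\<lambda>l. g j l powr (2 * H $ l))" unfolding mx_def by (intro Max_in) auto
        then obtain l where "mx j = g j l powr (2 * H $ l)" by (rule imageE)
        then have l: "w j = \<kappa> * g j l powr (2 * H $ l)" by (simp only: w_def)
        \<comment> \<open>The vector vanishes off j and its past, so the form may be taken over
          these points alone, and only separation from the past is required.\<close>
        let ?K = "insert j (P j)"
        have K: "finite ?K" "?K \<subseteq> J" using P[of j] j by auto
        have "w j * (\<xi> j)\<^sup>2 \<le> (\<Sum>i\<in>?K. \<Sum>k\<in>?K. \<xi> i * \<xi> k * fbs_cov H (s i) (s k))"
          unfolding l using s K g[OF j, of l] P[of j]
          by (intro lnd) (auto simp: g_def intro!: sep_le[where x="\<lambda>k. s k $ l"])
        also have "\<dots> = fbs_form H J s \<xi>"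
        proof -
          have z: "\<xi> k = 0" if "k \<in> J - ?K" for k
            using that zero[of k] by (auto simp: P_def past_def)
          have inner: "(\<Sum>k\<in>?K. \<xi> i * \<xi> k * fbs_cov H (s i) (s k))
              = (\<Sum>k\<in>J. \<xi> i * \<xi> k * fbs_cov H (s i) (s k))" for i
            by (rule sum.mono_neutral_left) (use J K z in auto)
          show ?thesis unfolding inner by (rule sum.mono_neutral_left) (use J K z in auto)
        qed
        finally show ?thesis .
      qed
    qed
    have v_le: "v j powr (- \<gamma> / 2) \<le> \<kappa> powr (- 1/2) * r j powr (- \<gamma>)" if "j \<in> J" for j
    proof -
      have "v j powr (- \<gamma> / 2) = \<kappa> powr (- \<gamma> / 2) * r j powr (- (\<gamma> * H $ l0))"
        using \<kappa> by (simp add: v_def powr_mult powr_powr mult.commute)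
      also have "\<dots> \<le> \<kappa> powr (- 1/2) * r j powr (- \<gamma>)"
        using \<kappa> r[OF that] \<gamma> H[of l0] by (intro mult_mono powr_mono') auto
      finally show ?thesis .
    qed
    have w_eq: "w j powr (- 1 / 2) = \<kappa> powr (- 1/2) * mx j powr (- 1/2)" for j
      using \<kappa> Max_pos[of j] unfolding w_def by (intro powr_mult)
    have "(\<Prod>j\<in>J. v j powr (- \<gamma> / 2) * w j powr (- 1 / 2)) \<le>
        (\<Prod>j\<in>J. \<kappa> powr (-1) * (r j powr (- \<gamma>) * mx j powr (- 1/2)))"
    proof (intro prod_mono conjI)
      fix j assume "j \<in> J"
      then have "v j powr (- \<gamma> / 2) * w j powr (- 1 / 2) \<le> (\<kappa> powr (- 1/2) * r j powr (- \<gamma>))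
          * (\<kappa> powr (- 1/2) * mx j powr (- 1/2))"
        unfolding w_eq by (intro mult_right_mono v_le) auto
      also have "\<dots> = (\<kappa> powr (- 1/2) * \<kappa> powr (- 1/2)) * (r j powr (- \<gamma>) * mx j powr (- 1/2))"
        by (simp only: mult_ac)
      also have "\<kappa> powr (- 1/2) * \<kappa> powr (- 1/2) = \<kappa> powr (-1)" unfolding powr_add[symmetric] by simp
      finally show "v j powr (- \<gamma> / 2) * w j powr (- 1 / 2) \<le> \<kappa> powr (-1)
          * (r j powr (- \<gamma>) * mx j powr (- 1/2))" .
    qed auto
    also have "\<dots> = \<kappa> powr (- real n) * ((\<Prod>j\<in>J. r j) powr (- \<gamma>) * (\<Prod>j\<in>J. mx j powr (- 1/2)))"
    proof -
      have "(\<Prod>j\<in>J. \<kappa> powr (-1)) = \<kappa> powr (- real n)"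
        using \<kappa> J by (simp add: powr_minus powr_realpow power_inverse)
      then show ?thesis by (simp only: prod.distrib prod_powr_distrib)
    qed
    also have "\<dots> \<le> ?m"
    proof -
      have "(\<Prod>j\<in>J. g j l0)\<^sup>2 \<le> (\<Prod>j\<in>J. r j)"
        unfolding g_def r_def P_def past_def using J ne
        by (intro prod_sep_past_sq_le) (auto simp: inj_on_def)
      moreover have "0 < (\<Prod>j\<in>J. g j l0)\<^sup>2" using g by (intro zero_less_power prod_pos) auto
      ultimately show ?thesis using \<gamma>
        by (intro mult_left_mono mult_right_mono powr_mono2' prod_nonneg) auto
    qed
    finally have "C0 * (\<Prod>j\<in>J. v j powr (- \<gamma> / 2) * w j powr (- 1 / 2)) \<le> C0 * ?m"
      using C0 by (intro mult_left_mono) auto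
    with I_le have "?I \<le> ennreal (C0 * ?m)"
      by (meson ennreal_leI order_trans)
    then have "?I ^ D \<le> ennreal (C0 * ?m) ^ D"
      by (intro power_mono) auto
    also have "\<dots> = ennreal ((C0 * ?m) ^ D)"
      using C0 by (intro ennreal_power mult_nonneg_nonneg prod_nonneg) auto
    also have "(C0 * ?m) ^ D
       = C * (\<Prod>j\<in>J. g j l0 powr (- \<delta>) * mx j powr (- real D / 2))"
    proof -
      have "(((\<Prod>j\<in>J. g j l0)\<^sup>2) powr (- \<gamma>)) ^ D = (\<Prod>j\<in>J. g j l0 powr (- \<delta>))"
      proof -
        have pos: "0 < (\<Prod>j\<in>J. g j l0)" using g by (intro prod_pos) auto
        have "(((\<Prod>j\<in>J. g j l0)\<^sup>2) powr (- \<gamma>)) ^ D = (\<Prod>j\<in>J. g j l0) powr (- \<delta>)"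
          using pos by (simp add: \<delta>_def powr_realpow[symmetric] powr_powr powr_numeral[symmetric]
              mult_ac del: powr_numeral)
        then show ?thesis using g by (simp add: prod_powr_distrib less_imp_le)
      qed
      moreover have "(\<Prod>j\<in>J. mx j powr (- 1/2)) ^ D = (\<Prod>j\<in>J. mx j powr (- real D / 2))"
        unfolding prod_power_distrib
      proof (intro prod.cong refl)
        fix j assume "j \<in> J"
        then show "(mx j powr (- 1/2)) ^ D = mx j powr (- real D / 2)"
          using Max_pos[of j] by (simp add: powr_realpow[symmetric] powr_powr)
      qed
      ultimately show ?thesis by (simp add: C_def power_mult_distrib prod.distrib)
    qed
    also have "ennreal \<dots> = ennreal C * (\<Prod>j\<in>J. ennreal (g j l0 powr (- \<delta>) * mx j powr (- real D / 2)))"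
      using C by (subst ennreal_mult) (auto intro!: prod_nonneg simp: prod_ennreal)
    also have "\<dots> \<le> ennreal C * past_weight \<eta> l0 J s"
      unfolding past_weight_def
    proof (intro mult_left_mono prod_mono_ennreal)
      fix j assume j: "j \<in> J"
      have "mx j powr (- real D / 2) \<le> (\<Prod>l\<in>UNIV. g j l powr (- (real D / T)))"
        unfolding T_def mx_def using g[OF j] H by (intro Max_powr_le_prod) auto
      \<comment> \<open>The loss from \<open>v\<close> sits in coordinate \<open>l0\<close>. As
        \<open>g\<close> is at most 1, it may be charged to every coordinate, which gives all of
        them the exponent \<eta>.\<close>
      moreover have "g j l0 powr (- \<delta>) \<le> (\<Prod>l\<in>UNIV. g j l powr (- \<delta>))"
      proof -
        have "1 \<le> g j l powr (- \<delta>)" for l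
        proof -
          have "1 powr (- \<delta>) \<le> g j l powr (- \<delta>)"
            using g[OF j, of l] \<gamma> by (intro powr_mono2') (auto simp: \<delta>_def)
          then show ?thesis by simp
        qed
        then have "g j l0 powr (- \<delta>) * 1 \<le> g j l0 powr (- \<delta>) * (\<Prod>l\<in>UNIV - {l0}. g j l powr (- \<delta>))"
          by (intro mult_left_mono prod_ge_1) auto
        then show ?thesis by (simp add: prod.remove[of UNIV l0])
      qed
      ultimately have "g j l0 powr (- \<delta>) * mx j powr (- real D / 2)
         \<le> (\<Prod>l\<in>UNIV. g j l powr (- \<delta>)) * (\<Prod>l\<in>UNIV. g j l powr (- (real D / T)))"
        by (intro mult_mono prod_nonneg) auto
      also have "\<dots> = (\<Prod>l\<in>UNIV. g j l powr (- \<eta>))"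
      proof -
        have "- \<delta> + - (real D / T) = - \<eta>" by (simp add: \<eta>_def T_def \<delta>_def)
        then show ?thesis by (simp only: prod.distrib[symmetric] powr_add[symmetric])
      qed
      finally have "ennreal (g j l0 powr (- \<delta>) * mx j powr (- real D / 2))
          \<le> ennreal (\<Prod>l\<in>UNIV. g j l powr (- \<eta>))"
        by (rule ennreal_leI)
      also have "\<dots> = (\<Prod>l\<in>UNIV. ennreal (g j l powr (- \<eta>)))" by (simp add: prod_ennreal)
      also have "\<dots> \<le> (\<Prod>l\<in>UNIV. 1 + (\<Sum>k\<in>past l0 s J j. singular_kernel \<eta> (s j $ l - s k $ l)))"
      proof (intro prod_mono_ennreal)
        fix l
        show "ennreal (g j l powr (- \<eta>)) \<le> 1 + (\<Sum>k\<in>past l0 s J j. singular_kernel \<eta> (s j $ l - s k $ l))"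
          unfolding g_def P_def[symmetric]
          using P[of j] ne j \<gamma> T by (intro powr_sep_le_one_plus_sum) (auto simp: \<eta>_def T_def)
      qed
      finally show "ennreal (g j l0 powr (- \<delta>) * mx j powr (- real D / 2))
         \<le> (\<Prod>l\<in>UNIV. 1 + (\<Sum>k\<in>past l0 s J j. singular_kernel \<eta> (s j $ l - s k $ l)))" .
    qed simp
    finally show ?thesis unfolding C_eq .
  qed
qed

section \<open>Integrability of the singular weights\<close>

lemma nn_integral_lborel_prod_vec:
  fixes f :: "'n::finite \<Rightarrow> real \<Rightarrow> ennreal"
  assumes "\<And>l. f l \<in> borel_measurable borel"
  shows "(\<integral>\<^sup>+ x. (\<Prod>l\<in>UNIV. f l (x $ l)) \<partial>(lborel :: (real ^ 'n) measure))
      = (\<Prod>l\<in>UNIV. \<integral>\<^sup>+ x. f l x \<partial>lborel)"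
proof -
  have B: "Basis = range (\<lambda>l::'n. axis l (1::real))" by (auto simp: Basis_vec_def)
  have inj: "inj (\<lambda>l::'n. axis l (1::real))" by (auto simp: inj_def axis_eq_axis)
  have "(\<integral>\<^sup>+ x. (\<Prod>b\<in>Basis. f (axis_index b) (x \<bullet> b)) \<partial>(lborel :: (real ^ 'n) measure))
     = (\<Prod>b\<in>(Basis :: (real ^ 'n) set). \<integral>\<^sup>+ x. f (axis_index b) x \<partial>lborel)"
    using assms by (intro nn_integral_lborel_prod) auto
  then show ?thesis
    unfolding B prod.reindex[OF inj] by (simp add: inner_axis)
qed

lemma finite_measure_restrict_cbox: "finite_measure (restrict_space lborel (cbox a b))"
  using emeasure_lborel_cbox_finite[of a b]
  by (intro finite_measureI) (simp add: space_restrict_space emeasure_restrict_space less_top[symmetric])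

lemma borel_measurable_singular_kernel [measurable]: "singular_kernel \<eta> \<in> borel_measurable borel"
  unfolding singular_kernel_def[abs_def] by measurable

definition kernel_mass :: "real \<Rightarrow> ennreal" where
  "kernel_mass \<eta> = (\<integral>\<^sup>+ x. singular_kernel \<eta> x * indicator {-1..1} x \<partial>lborel)"

lemma kernel_mass_finite:
  assumes "\<eta> < 1"
  shows "kernel_mass \<eta> < \<infinity>"
proof -
  have "integrable lborel (\<lambda>x::real. indicator {0..1} x * x powr (- \<eta>))"
    using has_integral_powr_from_0[of "- \<eta>" 1] assms
    by (intro integrable_indicator_has_integral) auto
  also have "(\<lambda>x::real. indicator {0..1} x * x powr (- \<eta>)) = (\<lambda>x. indicator {0..} x
      * (indicator {-1..1} x * \<bar>x\<bar> powr (- \<eta>)))"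
    by (auto simp: fun_eq_iff indicator_def)
  finally have int: "integrable lborel (\<lambda>x::real. indicator {-1..1} x * \<bar>x\<bar> powr (- \<eta>))"
    by (rule integrable_lborel_even) (auto simp: indicator_def)
  have "kernel_mass \<eta> = (\<integral>\<^sup>+ x. ennreal (indicator {-1..1} x * \<bar>x\<bar> powr (- \<eta>)) \<partial>lborel)"
    unfolding kernel_mass_def
    by (intro nn_integral_cong_AE AE_I[of _ _ "{0::real}"])
      (auto simp: singular_kernel_def ennreal_indicator indicator_def split: if_splits)
  also have "\<dots> < \<infinity>"
    using integrableD(2)[OF int] by (simp add: abs_mult top.not_eq_extremum)
  finally show ?thesis .
qed

text \<open>The bound is uniform in the pole c: within distance 1 of c the kernel has mass
  \<open>kernel_mass \<eta>\<close>, and farther away it is at most 1.\<close>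

lemma nn_integral_singular_kernel_le:
  "(\<integral>\<^sup>+ y. singular_kernel \<eta> (y - c) * indicator {a..b} y \<partial>lborel) \<le> kernel_mass \<eta>
      + emeasure lborel {a..b}"
  if "0 \<le> \<eta>"
proof -
  have "singular_kernel \<eta> (y - c) * indicator {a..b} y \<le> singular_kernel \<eta> (y - c)
      * indicator {-1..1} (y - c) + indicator {a..b} y" for y
  proof (cases "y - c \<in> {-1..1}")
    case False
    then have "\<bar>y - c\<bar> powr (- \<eta>) \<le> 1 powr (- \<eta>)"
      using that by (intro powr_mono2') auto
    then show ?thesis using False by (auto simp: singular_kernel_def indicator_def)
  qed (auto simp: indicator_def add_increasing2)
  then have "(\<integral>\<^sup>+ y. singular_kernel \<eta> (y - c) * indicator {a..b} y \<partial>lborel) \<le>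
    (\<integral>\<^sup>+ y. singular_kernel \<eta> (y - c) * indicator {-1..1} (y - c) + indicator {a..b} y \<partial>lborel)"
    by (intro nn_integral_mono)
  also have "\<dots> = (\<integral>\<^sup>+ y. singular_kernel \<eta> (y - c) * indicator {-1..1} (y - c) \<partial>lborel)
      + emeasure lborel {a..b}"
    by (subst nn_integral_add) auto
  also have "(\<integral>\<^sup>+ y. singular_kernel \<eta> (y - c) * indicator {-1..1} (y - c) \<partial>lborel) = kernel_mass \<eta>"
    unfolding kernel_mass_def
    by (subst nn_integral_real_affine[of _ 1 "- c"]) (auto simp: add.commute)
  finally show ?thesis .
qed

lemma past_weight_cong:
  "(\<And>j. j \<in> J \<Longrightarrow> s j = t j) \<Longrightarrow> past_weight \<eta> l0 J s = past_weight \<eta> l0 J t"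
  unfolding past_weight_def past_def by (intro prod.cong sum.cong arg_cong2[where f="(+)"]) auto

lemma one_le_past_weight: "1 \<le> past_weight \<eta> l0 J s"
  unfolding past_weight_def by (intro prod_ge_1) auto

text \<open>The point with the largest coordinate \<open>l0\<close> has all others in its past and
  lies in no other past, so its factor splits off. Which point this is depends on s; summing over
  all candidates m avoids decomposing the domain by orderings.\<close>

lemma past_weight_le_sum:
  assumes J: "finite J" "J \<noteq> {}"
  shows "past_weight \<eta> l0 J s \<le> (\<Sum>m\<in>J. (\<Prod>l\<in>UNIV. 1
      + (\<Sum>k\<in>J - {m}. singular_kernel \<eta> (s m $ l - s k $ l))) * past_weight \<eta> l0 (J - {m}) s)"
    (is "_ \<le> (\<Sum>m\<in>J. ?W m * _ m)")
proof (cases "\<exists>j\<in>J. \<exists>k\<in>J. j \<noteq> k \<and> s j $ l0 = s k $ l0")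
  case True
  then obtain j k where jk: "j \<in> J" "k \<in> J" "j \<noteq> k" "s j $ l0 = s k $ l0" by blast
  have "\<infinity> \<le> singular_kernel \<eta> (s j $ l0 - s k $ l0)" using jk by (simp add: singular_kernel_def)
  also have "\<dots> \<le> (\<Sum>k\<in>J - {j}. singular_kernel \<eta> (s j $ l0 - s k $ l0))"
    using J jk by (intro member_le_sum) auto
  also have "\<dots> \<le> 1 + (\<Sum>k\<in>J - {j}. singular_kernel \<eta> (s j $ l0 - s k $ l0))" by (simp add: add_increasing)
  also have "\<dots> \<le> ?W j" by (rule ennreal_factor_le_prod[where a = l0]) auto
  finally have W: "?W j = \<infinity>" by (simp add: top_unique)
  \<comment> \<open>The infinite factor must not meet a zero; the remaining weight is at least
    1.\<close>
  have "\<infinity> = ?W j * past_weight \<eta> l0 (J - {j}) s"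
    unfolding W using one_le_past_weight[of \<eta> l0 "J - {j}" s] by (auto simp: ennreal_top_mult)
  also have "\<dots> \<le> (\<Sum>m\<in>J. ?W m * past_weight \<eta> l0 (J - {m}) s)"
    by (rule member_le_sum) (use J jk in auto)
  finally show ?thesis by (simp add: top_unique)
next
  case False
  have "Max ((\<lambda>j. s j $ l0) ` J) \<in> (\<lambda>j. s j $ l0) ` J" using J by (intro Max_in) auto
  then obtain m where m: "m \<in> J" "Max ((\<lambda>j. s j $ l0) ` J) = s m $ l0" by blast
  have le: "s k $ l0 \<le> s m $ l0" if "k \<in> J" for k
    unfolding m(2)[symmetric] using J that by (intro Max_ge) auto
  have past_m: "past l0 s J m = J - {m}" using le by (auto simp: past_def)
  have past_j: "past l0 s J j = past l0 s (J - {m}) j" if "j \<in> J - {m}" for j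
    using that le[of j] False m(1) by (force simp: past_def)
  have "past_weight \<eta> l0 J s = ?W m * (\<Prod>j\<in>J - {m}. \<Prod>l\<in>UNIV. 1
      + (\<Sum>k\<in>past l0 s J j. singular_kernel \<eta> (s j $ l - s k $ l)))"
    unfolding past_weight_def by (subst prod.remove[OF J(1) m(1)]) (simp add: past_m)
  also have "\<dots> = ?W m * past_weight \<eta> l0 (J - {m}) s"
    unfolding past_weight_def by (intro arg_cong2[where f="(*)"] prod.cong refl) (simp only: past_j)
  also have "\<dots> \<le> (\<Sum>m\<in>J. ?W m * past_weight \<eta> l0 (J - {m}) s)"
    by (rule member_le_sum) (use J m in auto)
  finally show ?thesis .
qed

lemma measurable_PiM_component_vec_nth:
  fixes A :: "(real ^ 'n) set"
  assumes "j \<in> J"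
  shows "(\<lambda>s. s j $ l) \<in> borel_measurable (Pi\<^sub>M J (\<lambda>_. restrict_space lborel A))"
proof -
  have "(\<lambda>x. x $ l) \<in> borel_measurable (restrict_space lborel A)"
    by (intro measurable_restrict_space1) simp
  then show ?thesis using measurable_component_singleton[OF assms] by (rule measurable_compose[rotated])
qed

lemma borel_measurable_past_weight:
  fixes A :: "(real ^ 'n) set"
  assumes "finite J"
  shows "past_weight \<eta> l0 J \<in> borel_measurable (Pi\<^sub>M J (\<lambda>_. restrict_space lborel A))"
proof -
  note [measurable] = measurable_PiM_component_vec_nth[where A = A]
  \<comment> \<open>The index set of the inner sum depends on s; moving this dependence into an
    \<open>if\<close> makes measurability visible.\<close>
  have eq: "past_weight \<eta> l0 J s = (\<Prod>j\<in>J. \<Prod>l\<in>UNIV. 1 + (\<Sum>k\<in>J - {j}. if s k $ l0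
      \<le> s j $ l0 then singular_kernel \<eta> (s j $ l - s k $ l) else 0))" for s
    unfolding past_weight_def past_def using assms
        by (intro prod.cong refl arg_cong2[where f="(+)"] sum.inter_filter) auto
  show ?thesis unfolding eq[abs_def] by measurable
qed

text \<open>Induction on the number of points: the last point is integrated first. The others enter
  only as poles, so its integral factors over the coordinates and is bounded uniformly in their
  positions.\<close>

lemma nn_integral_past_weight_finite:
  fixes a b :: "real ^ 'n" and J :: "'j set"
  assumes \<eta>: "0 \<le> \<eta>" "\<eta> < 1" and "finite J"
  shows "(\<integral>\<^sup>+ s. past_weight \<eta> l0 J s \<partial>(Pi\<^sub>M J (\<lambda>_. restrict_space lborel (cbox a b)))) < \<infinity>"
  using \<open>finite J\<close>
proof (induction "card J" arbitrary: J)
  case 0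
  then have "J = {}" by simp
  then show ?case by (simp add: PiM_empty nn_integral_count_space_finite past_weight_def)
next
  case (Suc n)
  let ?\<mu> = "restrict_space lborel (cbox a b)"
  interpret finite_measure ?\<mu> by (rule finite_measure_restrict_cbox)
  interpret product_sigma_finite "\<lambda>_::'j. ?\<mu>" ..
  let ?W = "\<lambda>J m s. \<Prod>l\<in>UNIV. 1 + (\<Sum>k\<in>J - {m}. singular_kernel \<eta> (s m $ l - s k $ l))"
  \<comment> \<open>In each coordinate the summand 1 contributes the side length, and each of the n
    kernels at most the bound of \<open>nn_integral_singular_kernel_le\<close>.\<close>
  define K where "K = (\<Prod>l\<in>UNIV. emeasure lborel {a $ l..b $ l} + of_nat n
      * (kernel_mass \<eta> + emeasure lborel {a $ l..b $ l}))"
  have fin: "emeasure lborel {a $ l..b $ l} \<noteq> \<top>" for l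
    using emeasure_lborel_cbox_finite[of "a $ l" "b $ l"]
        by (simp only: cbox_interval less_top[symmetric] infinity_ennreal_def not_False_eq_True)
  have K: "K < \<infinity>"
    unfolding K_def using fin kernel_mass_finite[OF \<eta>(2)]
    by (auto simp del: emeasure_lborel_Icc_eq simp: ennreal_prod_eq_top less_top[symmetric]
        ennreal_mult_eq_top_iff)
  have term_finite: "(\<integral>\<^sup>+ s. ?W J m s * past_weight \<eta> l0 (J - {m}) s \<partial>(Pi\<^sub>M J (\<lambda>_. ?\<mu>))) < \<infinity>" if m:
      "m \<in> J" for m
  proof -
    define J' where "J' = J - {m}"
    have J': "J = insert m J'" "m \<notin> J'" "finite J'" "card J' = n" "J - {m} = J'"
      using m Suc.hyps(2) Suc.prems by (auto simp: J'_def)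
    note [measurable] = measurable_PiM_component_vec_nth[where A = "cbox a b"]
    have pw_upd: "past_weight \<eta> l0 J' (s(m := y)) = past_weight \<eta> l0 J' s" for s y
      using J' by (intro past_weight_cong) auto
    have m1: "(\<lambda>s. past_weight \<eta> l0 J' s) \<in> borel_measurable (Pi\<^sub>M (insert m J') (\<lambda>_. ?\<mu>))"
    proof -
      have "(\<lambda>s. past_weight \<eta> l0 J' (restrict s J')) \<in> borel_measurable (Pi\<^sub>M (insert m J') (\<lambda>_. ?\<mu>))"
        by (rule measurable_compose[OF measurable_restrict_subset borel_measurable_past_weight])
            (use J' in auto)
      also have "(\<lambda>s. past_weight \<eta> l0 J' (restrict s J')) = (\<lambda>s. past_weight \<eta> l0 J' s)"
        by (intro ext past_weight_cong) auto
      finally show ?thesis .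
    qed
    have m2: "?W J m \<in> borel_measurable (Pi\<^sub>M (insert m J') (\<lambda>_. ?\<mu>))"
      unfolding J'(5) by measurable
    have "(\<integral>\<^sup>+ s. ?W J m s * past_weight \<eta> l0 (J - {m}) s \<partial>(Pi\<^sub>M J (\<lambda>_. ?\<mu>)))
       = (\<integral>\<^sup>+ s. (\<integral>\<^sup>+ y. ?W J m (s(m := y)) * past_weight \<eta> l0 J' (s(m := y)) \<partial>?\<mu>) \<partial>(Pi\<^sub>M J' (\<lambda>_. ?\<mu>)))"
      unfolding J'(5) using m1 m2 J' unfolding J'(1)
          by (intro product_nn_integral_insert borel_measurable_times) auto
    also have "\<dots> \<le> (\<integral>\<^sup>+ s. K * past_weight \<eta> l0 J' s \<partial>(Pi\<^sub>M J' (\<lambda>_. ?\<mu>)))"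
    proof (intro nn_integral_mono)
      fix s :: "'j \<Rightarrow> real ^ 'n"
      have W_upd: "?W J m (s(m := y)) = (\<Prod>l\<in>UNIV. 1 + (\<Sum>k\<in>J'. singular_kernel \<eta> (y $ l - s k $ l)))"
          for y
        unfolding J'(5) using J'(2) by (intro prod.cong sum.cong arg_cong2[where f="(+)"]) auto
      have eq: "(\<integral>\<^sup>+ y. ?W J m (s(m := y)) * past_weight \<eta> l0 J' (s(m := y)) \<partial>?\<mu>)
         = (\<integral>\<^sup>+ y. (\<Prod>l\<in>UNIV. 1 + (\<Sum>k\<in>J'. singular_kernel \<eta> (y $ l - s k $ l))) \<partial>?\<mu>)
             * past_weight \<eta> l0 J' s"
        unfolding W_upd pw_upd by (intro nn_integral_multc measurable_restrict_space1) simp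
      have "(\<integral>\<^sup>+ y. (\<Prod>l\<in>UNIV. 1 + (\<Sum>k\<in>J'. singular_kernel \<eta> (y $ l - s k $ l))) \<partial>?\<mu>)
         = (\<integral>\<^sup>+ y. (\<Prod>l\<in>UNIV. (1 + (\<Sum>k\<in>J'. singular_kernel \<eta> (y $ l - s k $ l)))
             * indicator {a $ l..b $ l} (y $ l)) \<partial>lborel)"
      proof (subst nn_integral_restrict_space)
        have "indicator (cbox a b) y = (\<Prod>l\<in>UNIV. indicator {a $ l..b $ l} (y $ l) :: ennreal)" for y
          by (auto simp: indicator_def mem_box_cart)
        then show "(\<integral>\<^sup>+ y. (\<Prod>l\<in>UNIV. 1 + (\<Sum>k\<in>J'. singular_kernel \<eta> (y $ l - s k $ l)))
            * indicator (cbox a b) y \<partial>lborel)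
           = (\<integral>\<^sup>+ y. (\<Prod>l\<in>UNIV. (1 + (\<Sum>k\<in>J'. singular_kernel \<eta> (y $ l - s k $ l)))
               * indicator {a $ l..b $ l} (y $ l)) \<partial>lborel)"
          by (simp add: prod.distrib)
      qed simp
      also have "\<dots> = (\<Prod>l\<in>UNIV. \<integral>\<^sup>+ y. (1 + (\<Sum>k\<in>J'. singular_kernel \<eta> (y - s k $ l)))
          * indicator {a $ l..b $ l} y \<partial>lborel)"
        by (rule nn_integral_lborel_prod_vec) measurable
      also have "\<dots> \<le> K"
        unfolding K_def
      proof (intro prod_mono_ennreal)
        fix l
        have "(\<integral>\<^sup>+ y. (1 + (\<Sum>k\<in>J'. singular_kernel \<eta> (y - s k $ l))) * indicator {a $ l..b $ l} y \<partial>lborel)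
           = (\<integral>\<^sup>+ y. indicator {a $ l..b $ l} y + (\<Sum>k\<in>J'. singular_kernel \<eta> (y - s k $ l)
               * indicator {a $ l..b $ l} y) \<partial>lborel)"
          by (simp add: distrib_right sum_distrib_right)
        also have "\<dots> = emeasure lborel {a $ l..b $ l}
            + (\<Sum>k\<in>J'. \<integral>\<^sup>+ y. singular_kernel \<eta> (y - s k $ l) * indicator {a $ l..b $ l} y \<partial>lborel)"
          by (subst nn_integral_add) (auto simp: nn_integral_sum simp del: emeasure_lborel_Icc_eq)
        also have "\<dots> \<le> emeasure lborel {a $ l..b $ l}
            + (\<Sum>k\<in>J'. kernel_mass \<eta> + emeasure lborel {a $ l..b $ l})"
          by (intro add_left_mono sum_mono nn_integral_singular_kernel_le \<eta>)
        finally show "(\<integral>\<^sup>+ y. (1 + (\<Sum>k\<in>J'. singular_kernel \<eta> (y - s k $ l)))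
            * indicator {a $ l..b $ l} y \<partial>lborel)
           \<le> emeasure lborel {a $ l..b $ l} + of_nat n
               * (kernel_mass \<eta> + emeasure lborel {a $ l..b $ l})"
          using J'(4) by simp
      qed
      finally show "(\<integral>\<^sup>+ y. ?W J m (s(m := y)) * past_weight \<eta> l0 J' (s(m := y)) \<partial>?\<mu>) \<le> K
          * past_weight \<eta> l0 J' s"
        unfolding eq by (rule mult_right_mono) simp
    qed
    also have "\<dots> = K * (\<integral>\<^sup>+ s. past_weight \<eta> l0 J' s \<partial>(Pi\<^sub>M J' (\<lambda>_. ?\<mu>)))"
      by (intro nn_integral_cmult borel_measurable_past_weight J')
    also have "\<dots> < \<infinity>"
      using K Suc.hyps(1)[of J'] J' by (auto simp: ennreal_mult_less_top)
    finally show ?thesis .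
  qed
  have "J \<noteq> {}" using Suc.hyps(2) by auto
  have meas: "(\<lambda>s. ?W J m s * past_weight \<eta> l0 (J - {m}) s) \<in> borel_measurable (Pi\<^sub>M J (\<lambda>_. ?\<mu>))" if
      "m \<in> J" for m
  proof -
    note [measurable] = measurable_PiM_component_vec_nth[where A = "cbox a b"]
    have "(\<lambda>s. past_weight \<eta> l0 (J - {m}) (restrict s (J - {m}))) \<in> borel_measurable (Pi\<^sub>M J (\<lambda>_. ?\<mu>))"
      by (rule measurable_compose[OF measurable_restrict_subset borel_measurable_past_weight])
          (use Suc.prems in auto)
    also have "(\<lambda>s. past_weight \<eta> l0 (J - {m}) (restrict s (J - {m})))
        = (\<lambda>s. past_weight \<eta> l0 (J - {m}) s)"
      by (intro ext past_weight_cong) auto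
    finally have "(\<lambda>s. past_weight \<eta> l0 (J - {m}) s) \<in> borel_measurable (Pi\<^sub>M J (\<lambda>_. ?\<mu>))" .
    moreover have "?W J m \<in> borel_measurable (Pi\<^sub>M J (\<lambda>_. ?\<mu>))"
      using that by measurable
    ultimately show ?thesis by simp
  qed
  have "(\<integral>\<^sup>+ s. past_weight \<eta> l0 J s \<partial>(Pi\<^sub>M J (\<lambda>_. ?\<mu>)))
    \<le> (\<integral>\<^sup>+ s. (\<Sum>m\<in>J. ?W J m s * past_weight \<eta> l0 (J - {m}) s) \<partial>(Pi\<^sub>M J (\<lambda>_. ?\<mu>)))"
    using Suc.prems \<open>J \<noteq> {}\<close> by (intro nn_integral_mono past_weight_le_sum)
  also have "\<dots> = (\<Sum>m\<in>J. \<integral>\<^sup>+ s. ?W J m s * past_weight \<eta> l0 (J - {m}) s \<partial>(Pi\<^sub>M J (\<lambda>_. ?\<mu>)))"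
    by (intro nn_integral_sum meas)
  also have "\<dots> < \<infinity>"
    using term_finite Suc.prems by (simp add: ennreal_sum_less_top less_top[symmetric])
  finally show ?case .
qed

section \<open>Moments of smoothed occupation integrals\<close>

text \<open>Integrability of \<open>\<kappa>\<close> justifies the Fourier integral and Fubini,
  while the moment bounds depend on A alone. For differences of mollifiers A carries the decay in
  the scale, bought by the growth \<open>\<bar>\<xi>\<bar> powr \<gamma>\<close>.\<close>

definition fourier_kernel :: "real \<Rightarrow> real \<Rightarrow> (real \<Rightarrow> real) \<Rightarrow> bool" where
  "fourier_kernel \<gamma> A k \<longleftrightarrow> k \<in> borel_measurable borel \<and> 0 < A \<and>
     (\<exists>\<kappa>. integrable lborel \<kappa> \<and> (\<forall>y. complex_of_real (k y) = (CLBINT \<xi>. complex_of_real (\<kappa> \<xi>)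
         * iexp (\<xi> * y))) \<and>
       (\<forall>\<xi>. \<bar>\<kappa> \<xi>\<bar> \<le> A * (1 + \<bar>\<xi>\<bar> powr \<gamma>)))"

lemma fourier_kernel_bounded:
  assumes "fourier_kernel \<gamma> A k"
  shows "\<exists>c\<ge>1. \<forall>y. \<bar>k y\<bar> \<le> c"
proof -
  from assms obtain \<kappa> where \<kappa>: "integrable lborel \<kappa>" "\<And>y. complex_of_real (k y)
      = (CLBINT \<xi>. complex_of_real (\<kappa> \<xi>) * iexp (\<xi> * y))"
    by (auto simp: fourier_kernel_def)
  have "\<bar>k y\<bar> \<le> (LBINT \<xi>. \<bar>\<kappa> \<xi>\<bar>)" for y
  proof -
    have "\<bar>k y\<bar> = norm (complex_of_real (k y))" by simp
    also have "\<dots> \<le> (LBINT \<xi>. norm (complex_of_real (\<kappa> \<xi>) * iexp (\<xi> * y)))"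
      unfolding \<kappa>(2) by (rule integral_norm_bound)
    finally show ?thesis by (simp add: norm_mult)
  qed
  then show ?thesis by (intro exI[of _ "max 1 (LBINT \<xi>. \<bar>\<kappa> \<xi>\<bar>)"]) (auto intro: max.coboundedI2)
qed

text \<open>Independence factors the expectation over the coordinates of the range, each bounded by
  the same Gaussian integral; hence its d-th power. If two of the points coincide, the
  characteristic function formula does not apply, but then the right side is infinite.\<close>

lemma (in prob_space) fbs_abs_expectation_prod_le:
  fixes H :: "real ^ 'n" and B :: "real ^ 'n \<Rightarrow> 'a \<Rightarrow> real ^ 'd" and J :: "'j set" and l0 :: 'n
  assumes H: "\<And>l. 0 < H $ l" "\<And>l. H $ l < 1" and \<alpha>: "0 < \<alpha>" "\<alpha> \<le> 1" and \<gamma>: "0 < \<gamma>" "\<gamma> \<le> 1"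
    and B: "fractional_brownian_sheet M H B"
    and k: "\<And>i. fourier_kernel \<gamma> (A i) (k i)"
    and J: "finite J" "card J = n" and s: "\<And>j l. j \<in> J \<Longrightarrow> \<alpha> \<le> s j $ l"
  defines "\<eta> \<equiv> real CARD('d) / (\<Sum>l\<in>UNIV. 1 / H $ l) + 2 * \<gamma> * real CARD('d)"
  shows "ennreal \<bar>expectation (\<lambda>w. \<Prod>j\<in>J. \<Prod>i\<in>UNIV. k i (B (s j) w $ i - x $ i))\<bar>
    \<le> ennreal (\<Prod>i\<in>UNIV. A i ^ n) * (ennreal (past_weight_const H \<alpha> \<gamma> CARD('d) n) * past_weight \<eta> l0 J s)"
proof (cases "inj_on s J")
  case False
  then obtain j j' where "j \<in> J" "j' \<in> J" "j \<noteq> j'" "s j = s j'" by (auto simp: inj_on_def)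
  then have "past_weight \<eta> l0 J s = \<infinity>" using past_weight_eq_infinity[OF J(1)] by metis
  moreover define p where "p = (\<Prod>i\<in>UNIV. A i ^ n)"
  moreover have "0 < p" unfolding p_def using k by (intro prod_pos) (auto simp: fourier_kernel_def)
  ultimately show ?thesis unfolding p_def[symmetric] using past_weight_const_pos[of H \<alpha> \<gamma> "CARD('d)" n]
    by (simp add: ennreal_mult_top)
next
  case inj: True
  have so: "s j \<in> orthant" if "j \<in> J" for j
  proof -
    have "0 \<le> s j $ l" for l using s[OF that, of l] \<alpha> by linarith
    then show ?thesis by (simp add: orthant_def)
  qed
  define I where "I = (\<integral>\<^sup>+ \<xi>. ennreal ((\<Prod>j\<in>J. 1 + \<bar>\<xi> j\<bar> powr \<gamma>)
      * exp (- fbs_form H J s \<xi> / 2)) \<partial>(Pi\<^sub>M J (\<lambda>_. lborel)))"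
  define Y where "Y i w = (\<Prod>j\<in>J. k i (B (s j) w $ i - x $ i))" for i w
  have X: "real_fbs M H (\<lambda>t w. B t w $ i)" for i using B by (simp add: fractional_brownian_sheet_def)
  have k_meas [measurable]: "k i \<in> borel_measurable borel" for i using k
      by (simp add: fourier_kernel_def)
  have A: "0 < A i" for i using k[of i] by (simp add: fourier_kernel_def)
  have Y_meas [measurable]: "Y i \<in> borel_measurable M" for i
  proof -
    have [measurable]: "(\<lambda>w. B (s j) w $ i) \<in> borel_measurable M" if "j \<in> J" for j
      using real_fbs_measurable[OF X so[OF that]] .
    show ?thesis unfolding Y_def[abs_def] by measurable
  qed
  have Y_int: "integrable M (Y i)" for i
  proof -
    obtain c where c: "1 \<le> c" "\<And>y. \<bar>k i y\<bar> \<le> c" using fourier_kernel_bounded[OF k[of i]] by metis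
    have "norm (Y i w) \<le> c ^ card J" for w
      unfolding Y_def prod_norm[symmetric] using c by (intro prod_le_power) auto
    then show ?thesis by (intro integrable_const_bound[of _ "c ^ card J"]) auto
  qed
  \<comment> \<open>Each \<open>Y i\<close> is a measurable functional of the whole i-th process, so
    independence of the processes passes to it.\<close>
  have indep: "indep_vars (\<lambda>_. borel) Y UNIV"
  proof -
    have "indep_vars (\<lambda>_. \<Pi>\<^sub>M t\<in>orthant. borel) (\<lambda>i w. \<lambda>t\<in>orthant. B t w $ i) UNIV"
      using B by (simp add: fractional_brownian_sheet_def)
    then have "indep_vars (\<lambda>_. borel) (\<lambda>i w. (\<lambda>p. \<Prod>j\<in>J. k i (p (s j)
        - x $ i)) (\<lambda>t\<in>orthant. B t w $ i)) UNIV"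
    proof (rule indep_vars_compose2)
      fix i
      have [measurable]: "(\<lambda>p. p (s j)) \<in> borel_measurable (\<Pi>\<^sub>M t\<in>orthant. (borel :: real measure))"
          if "j \<in> J" for j
        using so[OF that] by measurable
      show "(\<lambda>p. \<Prod>j\<in>J. k i (p (s j) - x $ i)) \<in> borel_measurable (\<Pi>\<^sub>M t\<in>orthant. (borel :: real measure))"
        by measurable
    qed
    also have "(\<lambda>i w. (\<lambda>p. \<Prod>j\<in>J. k i (p (s j) - x $ i)) (\<lambda>t\<in>orthant. B t w $ i)) = Y"
      unfolding Y_def by (intro ext prod.cong) (auto simp: so)
    finally show ?thesis .
  qed
  have "expectation (\<lambda>w. \<Prod>j\<in>J. \<Prod>i\<in>UNIV. k i (B (s j) w $ i - x $ i)) = expectation (\<lambda>w. \<Prod>i\<in>UNIV. Y i w)"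
    unfolding Y_def by (subst prod.swap) simp
  also have "\<dots> = (\<Prod>i\<in>UNIV. expectation (Y i))"
    using indep Y_int by (intro indep_vars_lebesgue_integral) auto
  finally have "ennreal \<bar>expectation (\<lambda>w. \<Prod>j\<in>J. \<Prod>i\<in>UNIV. k i (B (s j) w $ i - x $ i))\<bar>
      = (\<Prod>i\<in>UNIV. ennreal \<bar>expectation (Y i)\<bar>)"
    by (simp add: abs_prod prod_ennreal)
  also have "\<dots> \<le> (\<Prod>i\<in>UNIV. ennreal (A i ^ n) * I)"
  proof (intro prod_mono_ennreal)
    fix i
    from k[of i] obtain \<kappa> where \<kappa>: "integrable lborel \<kappa>" "\<And>y. complex_of_real (k i y)
        = (CLBINT \<xi>. complex_of_real (\<kappa> \<xi>) * iexp (\<xi> * y))"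
      "\<And>\<xi>. \<bar>\<kappa> \<xi>\<bar> \<le> A i * (1 + \<bar>\<xi>\<bar> powr \<gamma>)"
      by (auto simp: fourier_kernel_def)
    have "ennreal \<bar>expectation (Y i)\<bar> \<le> (\<integral>\<^sup>+ \<xi>. ennreal ((\<Prod>j\<in>J. \<bar>\<kappa> (\<xi> j)\<bar>)
        * exp (- fbs_form H J s \<xi> / 2)) \<partial>(Pi\<^sub>M J (\<lambda>_. lborel)))"
      unfolding Y_def using real_fbs_abs_expectation_prod_le[OF X J(1) inj so \<kappa>(1,2)] by simp
    also have "\<dots> \<le> (\<integral>\<^sup>+ \<xi>. ennreal (A i ^ n) * ennreal ((\<Prod>j\<in>J. 1 + \<bar>\<xi> j\<bar> powr \<gamma>)
        * exp (- fbs_form H J s \<xi> / 2)) \<partial>(Pi\<^sub>M J (\<lambda>_. lborel)))"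
    proof (intro nn_integral_mono)
      fix \<xi> :: "'j \<Rightarrow> real"
      have "(\<Prod>j\<in>J. \<bar>\<kappa> (\<xi> j)\<bar>) \<le> (\<Prod>j\<in>J. A i * (1 + \<bar>\<xi> j\<bar> powr \<gamma>))"
        using \<kappa>(3) by (intro prod_mono) auto
      also have "\<dots> = A i ^ n * (\<Prod>j\<in>J. 1 + \<bar>\<xi> j\<bar> powr \<gamma>)" using J by (simp add: prod.distrib)
      finally have "(\<Prod>j\<in>J. \<bar>\<kappa> (\<xi> j)\<bar>) * exp (- fbs_form H J s \<xi> / 2)
         \<le> A i ^ n * ((\<Prod>j\<in>J. 1 + \<bar>\<xi> j\<bar> powr \<gamma>) * exp (- fbs_form H J s \<xi> / 2))"
        unfolding mult.assoc[symmetric] by (intro mult_right_mono) auto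
      then show "ennreal ((\<Prod>j\<in>J. \<bar>\<kappa> (\<xi> j)\<bar>) * exp (- fbs_form H J s \<xi> / 2))
        \<le> ennreal (A i ^ n) * ennreal ((\<Prod>j\<in>J. 1 + \<bar>\<xi> j\<bar> powr \<gamma>) * exp (- fbs_form H J s \<xi> / 2))"
        using A[of i] by (subst ennreal_mult[symmetric]) (auto intro!: ennreal_leI
            mult_nonneg_nonneg prod_nonneg)
    qed
    also have "\<dots> = ennreal (A i ^ n) * I"
      unfolding I_def by (rule nn_integral_cmult) measurable
    finally show "ennreal \<bar>expectation (Y i)\<bar> \<le> ennreal (A i ^ n) * I" .
  qed
  also have "\<dots> = ennreal (\<Prod>i\<in>UNIV. A i ^ n) * I ^ CARD('d)"
    using A by (simp add: prod.distrib prod_ennreal less_imp_le)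
  also have "\<dots> \<le> ennreal (\<Prod>i\<in>UNIV. A i ^ n) * (ennreal (past_weight_const H \<alpha> \<gamma> CARD('d) n)
      * past_weight \<eta> l0 J s)"
    unfolding I_def \<eta>_def by (intro mult_left_mono weighted_gaussian_integral_le_past_weight H \<alpha> \<gamma> J
        s) auto
  finally show ?thesis .
qed

text \<open>The n-th power of an integral is an n-fold integral, and Fubini reduces it to joint
  moments at n points; even n makes the power nonnegative. The factor g is there for indicators of
  subboxes: it does not depend on w and is bounded by 1, so the bound does not depend on the
  subbox.\<close>

lemma (in prob_space) fbs_integral_moment_le:
  fixes H :: "real ^ 'n" and B :: "real ^ 'n \<Rightarrow> 'a \<Rightarrow> real ^ 'd" and a b :: "real ^ 'n" and l0 :: 'n
      and x :: "real ^ 'd"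
  assumes H: "\<And>l. 0 < H $ l" "\<And>l. H $ l < 1" and \<alpha>: "0 < \<alpha>" "\<alpha> \<le> 1" "\<And>l. \<alpha> \<le> a $ l" and \<gamma>: "0 < \<gamma>"
      "\<gamma> \<le> 1"
    and B: "fractional_brownian_sheet M H B"
    and B_meas: "(\<lambda>(t, w). B t w) \<in> borel_measurable (restrict_space borel orthant \<Otimes>\<^sub>M M)"
    and k: "\<And>i. fourier_kernel \<gamma> (A i) (k i)"
    and n: "even n" and g: "g \<in> borel_measurable borel" "\<And>s. \<bar>g s\<bar> \<le> 1"
  defines "\<mu> \<equiv> restrict_space lborel (cbox a b)"
    and "\<eta> \<equiv> real CARD('d) / (\<Sum>l\<in>UNIV. 1 / H $ l) + 2 * \<gamma> * real CARD('d)"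
  defines "Y \<equiv> \<lambda>w. LINT s|\<mu>. g s * (\<Prod>i\<in>UNIV. k i (B s w $ i - x $ i))"
  shows "Y \<in> borel_measurable M"
    and "(\<integral>\<^sup>+ w. ennreal ((Y w) ^ n) \<partial>M) \<le> ennreal (\<Prod>i\<in>UNIV. A i ^ n) *
      (ennreal (past_weight_const H \<alpha> \<gamma> CARD('d) n)
          * (\<integral>\<^sup>+ s. past_weight \<eta> l0 {..<n} s \<partial>(Pi\<^sub>M {..<n} (\<lambda>_. \<mu>))))"
proof -
  interpret \<mu>: finite_measure \<mu> unfolding \<mu>_def by (rule finite_measure_restrict_cbox)
  interpret P: product_sigma_finite "\<lambda>_::nat. \<mu>" ..
  interpret PF: finite_product_sigma_finite "\<lambda>_::nat. \<mu>" "{..<n}" by standard auto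
  interpret PS: pair_sigma_finite M "Pi\<^sub>M {..<n} (\<lambda>_. \<mu>)" ..
  have sub: "cbox a b \<subseteq> orthant"
  proof
    fix s assume "s \<in> cbox a b"
    then have "a $ l \<le> s $ l" for l by (simp add: mem_box_cart)
    then have "0 \<le> s $ l" for l using \<alpha>(1) \<alpha>(3)[of l] by (meson less_le order_trans)
    then show "s \<in> orthant" by (simp add: orthant_def)
  qed
  have space_\<mu>: "space \<mu> = cbox a b" by (simp add: \<mu>_def space_restrict_space)
  have id: "(\<lambda>s. s) \<in> \<mu> \<rightarrow>\<^sub>M restrict_space borel orthant"
    unfolding \<mu>_def using sub by (intro measurable_restrict_space3) auto
  have k_meas [measurable]: "k i \<in> borel_measurable borel" for i using k
      by (simp add: fourier_kernel_def)
  have g_meas [measurable]: "g \<in> borel_measurable \<mu>"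
    unfolding \<mu>_def by (intro measurable_restrict_space1) (use g in simp)
  define f where "f w s = g s * (\<Prod>i\<in>UNIV. k i (B s w $ i - x $ i))" for w s
  have B' [measurable]: "(\<lambda>(s, w). B s w) \<in> borel_measurable (\<mu> \<Otimes>\<^sub>M M)"
  proof -
    have "(\<lambda>p. (fst p, snd p)) \<in> \<mu> \<Otimes>\<^sub>M M \<rightarrow>\<^sub>M restrict_space borel orthant \<Otimes>\<^sub>M M"
      by (intro measurable_Pair measurable_compose[OF measurable_fst id] measurable_snd)
    from measurable_compose[OF this B_meas] show ?thesis by (simp add: case_prod_beta)
  qed
  have f_meas: "(\<lambda>(s, w). f w s) \<in> borel_measurable (\<mu> \<Otimes>\<^sub>M M)"
  proof -
    have [measurable]: "(\<lambda>p. B (fst p) (snd p) $ i) \<in> borel_measurable (\<mu> \<Otimes>\<^sub>M M)" for i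
      using measurable_compose[OF B', of "\<lambda>v. v $ i" borel] by (simp add: case_prod_beta)
    show ?thesis unfolding f_def case_prod_beta by measurable
  qed
  have f_meas': "(\<lambda>(w, s). f w s) \<in> borel_measurable (M \<Otimes>\<^sub>M \<mu>)"
    using measurable_compose[OF measurable_pair_swap' f_meas] by (simp add: case_prod_beta)
  show Y_meas: "Y \<in> borel_measurable M"
    unfolding Y_def f_def[symmetric] by (rule \<mu>.borel_measurable_lebesgue_integral[OF f_meas'])
  have f_meas_s: "f w \<in> borel_measurable \<mu>" if "w \<in> space M" for w
    using measurable_compose[OF measurable_Pair1'[OF that] f_meas'] by simp
  obtain c where c: "\<And>i. 1 \<le> c i" "\<And>i y. \<bar>k i y\<bar> \<le> c i"
    using fourier_kernel_bounded[OF k] by metis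
  define K where "K = (\<Prod>i\<in>UNIV. c i)"
  have K: "1 \<le> K" unfolding K_def using c by (intro prod_ge_1) auto
  have f_bound: "\<bar>f w s\<bar> \<le> K" for w s
  proof -
    have "\<bar>f w s\<bar> \<le> 1 * (\<Prod>i\<in>UNIV. \<bar>k i (B s w $ i - x $ i)\<bar>)"
      unfolding f_def abs_mult abs_prod using g by (intro mult_right_mono prod_nonneg) auto
    also have "\<dots> \<le> 1 * K" unfolding K_def using c by (intro mult_left_mono prod_mono) auto
    finally show ?thesis by simp
  qed
  have f_int: "integrable \<mu> (f w)" if "w \<in> space M" for w
    using f_bound by (intro \<mu>.integrable_const_bound[of _ K] f_meas_s that) auto
  define F where "F w s = (\<Prod>j<n. f w (s j))" for w s
  have F_meas: "case_prod F \<in> borel_measurable (M \<Otimes>\<^sub>M Pi\<^sub>M {..<n} (\<lambda>_. \<mu>))"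
  proof -
    have "(\<lambda>p. f (fst p) (snd p j)) \<in> borel_measurable (M \<Otimes>\<^sub>M Pi\<^sub>M {..<n} (\<lambda>_. \<mu>))" if "j \<in> {..<n}" for j
    proof -
      have "(\<lambda>p. (fst p, snd p j)) \<in> M \<Otimes>\<^sub>M Pi\<^sub>M {..<n} (\<lambda>_. \<mu>) \<rightarrow>\<^sub>M M \<Otimes>\<^sub>M \<mu>"
        using that by measurable
      from measurable_compose[OF this f_meas'] show ?thesis by (simp add: case_prod_beta)
    qed
    then show ?thesis unfolding F_def case_prod_beta by (intro borel_measurable_prod) auto
  qed
  have F_bound: "norm (F w s) \<le> K ^ n" for w s
  proof -
    have "norm (F w s) = (\<Prod>j<n. \<bar>f w (s j)\<bar>)" by (simp add: F_def abs_prod)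
    also have "\<dots> \<le> K ^ card {..<n}" using f_bound K by (intro prod_le_power) auto
    finally show ?thesis by simp
  qed
  \<comment> \<open>The integrand is bounded on a finite measure space, which justifies every
    exchange of integrals before any singular bound is used.\<close>
  have fin: "finite_measure (M \<Otimes>\<^sub>M Pi\<^sub>M {..<n} (\<lambda>_. \<mu>))"
  proof (rule finite_measureI)
    have "emeasure (Pi\<^sub>M {..<n} (\<lambda>_. \<mu>)) (space (Pi\<^sub>M {..<n} (\<lambda>_. \<mu>))) = (\<Prod>j<n. emeasure \<mu> (space \<mu>))"
      unfolding space_PiM by (rule P.emeasure_PiM) auto
    also have "\<dots> \<noteq> \<infinity>" by (simp add: power_eq_top_ennreal)
    finally show "emeasure (M \<Otimes>\<^sub>M Pi\<^sub>M {..<n} (\<lambda>_. \<mu>)) (space (M \<Otimes>\<^sub>M Pi\<^sub>M {..<n} (\<lambda>_. \<mu>))) \<noteq> \<infinity>"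
      by (simp add: space_pair_measure PF.emeasure_pair_measure_Times emeasure_space_1)
  qed
  have F_int: "integrable (M \<Otimes>\<^sub>M Pi\<^sub>M {..<n} (\<lambda>_. \<mu>)) (case_prod F)"
    using F_bound F_meas by (intro finite_measure.integrable_const_bound[OF fin, of _ "K ^ n"]) auto
  have Y_pow: "Y w ^ n = (LINT s|Pi\<^sub>M {..<n} (\<lambda>_. \<mu>). F w s)" if "w \<in> space M" for w
    unfolding F_def using f_int[OF that] by (subst P.product_integral_prod)
        (auto simp: Y_def f_def[abs_def])
  have Y_nonneg: "0 \<le> Y w ^ n" for w by (rule zero_le_even_power[OF n])
  have "integrable M (\<lambda>w. LINT s|Pi\<^sub>M {..<n} (\<lambda>_. \<mu>). F w s)"
    using PS.integrable_fst'[OF F_int] by simp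
  then have "integrable M (\<lambda>w. Y w ^ n)"
    by (subst Bochner_Integration.integrable_cong[OF refl Y_pow])
  then have "(\<integral>\<^sup>+ w. ennreal ((Y w) ^ n) \<partial>M) = ennreal (expectation (\<lambda>w. Y w ^ n))"
    using Y_nonneg by (intro nn_integral_eq_integral) auto
  also have "expectation (\<lambda>w. Y w ^ n) = (LINT w|M. LINT s|Pi\<^sub>M {..<n} (\<lambda>_. \<mu>). F w s)"
    by (intro Bochner_Integration.integral_cong refl Y_pow)
  also have "\<dots> = (LINT s|Pi\<^sub>M {..<n} (\<lambda>_. \<mu>). LINT w|M. F w s)"
    using PS.Fubini_integral[OF F_int] by simp
  also have "ennreal \<dots> \<le> ennreal (norm (LINT s|Pi\<^sub>M {..<n} (\<lambda>_. \<mu>). LINT w|M. F w s))"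
    by (intro ennreal_leI) simp
  also have "\<dots> \<le> (\<integral>\<^sup>+ s. norm (LINT w|M. F w s) \<partial>(Pi\<^sub>M {..<n} (\<lambda>_. \<mu>)))"
    by (rule norm_integral_le_nn_integral)
  also have "\<dots> \<le> (\<integral>\<^sup>+ s. ennreal (\<Prod>i\<in>UNIV. A i ^ n) * (ennreal (past_weight_const H \<alpha> \<gamma> CARD('d) n)
      * past_weight \<eta> l0 {..<n} s) \<partial>(Pi\<^sub>M {..<n} (\<lambda>_. \<mu>)))"
  proof (intro nn_integral_mono)
    fix s assume "s \<in> space (Pi\<^sub>M {..<n} (\<lambda>_. \<mu>))"
    then have s: "\<alpha> \<le> s j $ l" if "j \<in> {..<n}" for j l
      using that \<alpha>(3)[of l] by (force simp: space_PiM space_\<mu> PiE_iff mem_box_cart intro: order_trans)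
    have "LINT w|M. F w s = (\<Prod>j<n. g (s j)) * expectation (\<lambda>w. \<Prod>j<n. \<Prod>i\<in>UNIV. k i (B (s j) w $ i
        - x $ i))"
      by (simp add: F_def f_def prod.distrib)
    then have "norm (LINT w|M. F w s) = (\<Prod>j<n. \<bar>g (s j)\<bar>)
        * \<bar>expectation (\<lambda>w. \<Prod>j<n. \<Prod>i\<in>UNIV. k i (B (s j) w $ i - x $ i))\<bar>"
      by (simp add: abs_mult abs_prod)
    also have "\<dots> \<le> 1 * \<bar>expectation (\<lambda>w. \<Prod>j<n. \<Prod>i\<in>UNIV. k i (B (s j) w $ i - x $ i))\<bar>"
      using g by (intro mult_right_mono prod_le_1) auto
    finally have "ennreal (norm (LINT w|M. F w s))
        \<le> ennreal \<bar>expectation (\<lambda>w. \<Prod>j<n. \<Prod>i\<in>UNIV. k i (B (s j) w $ i - x $ i))\<bar>"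
      by (intro ennreal_leI) simp
    also have "\<dots> \<le> ennreal (\<Prod>i\<in>UNIV. A i ^ n) * (ennreal (past_weight_const H \<alpha> \<gamma> CARD('d) n)
        * past_weight \<eta> l0 {..<n} s)"
      unfolding \<eta>_def using s by (intro fbs_abs_expectation_prod_le H \<alpha> \<gamma> B k) auto
    finally show "ennreal (norm (LINT w|M. F w s)) \<le> ennreal (\<Prod>i\<in>UNIV. A i ^ n)
        * (ennreal (past_weight_const H \<alpha> \<gamma> CARD('d) n) * past_weight \<eta> l0 {..<n} s)" .
  qed
  also have "\<dots> = ennreal (\<Prod>i\<in>UNIV. A i ^ n) * (ennreal (past_weight_const H \<alpha> \<gamma> CARD('d) n)
      * (\<integral>\<^sup>+ s. past_weight \<eta> l0 {..<n} s \<partial>(Pi\<^sub>M {..<n} (\<lambda>_. \<mu>))))"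
    using borel_measurable_past_weight[of "{..<n}" \<eta> l0 "cbox a b"] unfolding \<mu>_def
    by (simp add: nn_integral_cmult)
  finally show "(\<integral>\<^sup>+ w. ennreal ((Y w) ^ n) \<partial>M) \<le> \<dots>" .
qed

section \<open>Tent mollifiers\<close>

definition moll :: "real \<Rightarrow> real \<Rightarrow> real" where "moll r y = r * tent (r * y)"

lemma tent_nonneg: "0 \<le> tent x" and tent_le_one: "tent x \<le> 1" and tent_minus [simp]:
    "tent (- x) = tent x"
  by (auto simp: tent_def)

lemma tent_lipschitz: "\<bar>tent x - tent y\<bar> \<le> \<bar>x - y\<bar>"
  by (auto simp: tent_def max_def abs_if)

lemma borel_measurable_tent [measurable]: "tent \<in> borel_measurable borel"
  unfolding tent_def[abs_def] by measurable

lemma borel_measurable_moll [measurable]: "moll r \<in> borel_measurable borel"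
  unfolding moll_def[abs_def] by measurable

lemma moll_nonneg: "0 \<le> r \<Longrightarrow> 0 \<le> moll r y"
  by (simp add: moll_def tent_nonneg)

lemma moll_le: "0 \<le> r \<Longrightarrow> moll r y \<le> r"
  using tent_le_one[of "r * y"] mult_left_mono[of "tent (r * y)" 1 r] by (simp add: moll_def)

lemma moll_eq_0: "0 < r \<Longrightarrow> 1 / r \<le> \<bar>y\<bar> \<Longrightarrow> moll r y = 0"
  by (auto simp: moll_def tent_def abs_mult field_simps)

lemma nn_integral_tent: "(\<integral>\<^sup>+ x. ennreal (tent x) \<partial>lborel) = 1"
proof -
  have "((\<lambda>x::real. 1 - x) has_integral ((1 - 1\<^sup>2 / 2) - (0 - 0\<^sup>2 / 2))) {0..1}"
    by (rule fundamental_theorem_of_calculus[where f = "\<lambda>x. x - x\<^sup>2 / 2"])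
      (auto intro!: derivative_eq_intros simp flip: has_real_derivative_iff_has_vector_derivative)
  then have "((\<lambda>x::real. 1 - x) has_integral 1 / 2) {0..1}" by simp
  then have "((\<lambda>x::real. tent x) has_integral 1 / 2) {0..1}"
    by (rule has_integral_eq[rotated]) (auto simp: tent_def)
  then have int: "(\<integral>\<^sup>+ x. ennreal (indicator {0..1} x * tent x) \<partial>lborel) = ennreal (1 / 2)"
    by (intro nn_integral_has_integral_lebesgue) (auto simp: tent_nonneg)
  have eq: "indicator {0..1} x * tent x = indicator {0..} x *\<^sub>R tent x" for x
    by (auto simp: indicator_def tent_def)
  have "has_bochner_integral lborel (\<lambda>x. indicator {0..} x *\<^sub>R tent x) (1 / 2)"
    using int unfolding eq by (intro has_bochner_integral_nn_integral) (auto simp: tent_nonneg)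
  then have "has_bochner_integral lborel tent (2 *\<^sub>R (1 / 2))"
    by (rule has_bochner_integral_even_function) simp
  then have "integrable lborel tent" "integral\<^sup>L lborel tent = 1"
    by (auto simp: has_bochner_integral_iff)
  then show ?thesis by (simp add: nn_integral_eq_integral tent_nonneg)
qed

lemma nn_integral_moll:
  assumes "0 < r"
  shows "(\<integral>\<^sup>+ x. ennreal (moll r (y - x)) \<partial>lborel) = 1"
proof -
  have "1 = (\<integral>\<^sup>+ x. ennreal (tent x) \<partial>lborel)" by (simp add: nn_integral_tent)
  also have "\<dots> = ennreal r * (\<integral>\<^sup>+ x. ennreal (tent (r * y + - r * x)) \<partial>lborel)"
    using assms by (subst nn_integral_real_affine[where c = "- r" and t = "r * y"]) auto
  also have "\<dots> = (\<integral>\<^sup>+ x. ennreal (moll r (y - x)) \<partial>lborel)"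
    using assms by (subst nn_integral_cmult[symmetric]) (auto simp: moll_def ennreal_mult
        tent_nonneg right_diff_distrib)
  finally show ?thesis by simp
qed

lemma integrable_fourier_integrand:
  assumes "integrable lborel \<kappa>"
  shows "integrable lborel (\<lambda>\<xi>. complex_of_real (\<kappa> \<xi>) * iexp (\<xi> * y))"
  by (rule Bochner_Integration.integrable_bound[OF assms])
    (use borel_measurable_integrable[OF assms] in \<open>auto simp: norm_mult\<close>)

text \<open>Adding the integral to its reflection at the origin leaves twice the cosine
  part.\<close>

lemma fourier_integral_even:
  assumes "integrable lborel \<kappa>" "\<And>x. \<kappa> (- x) = (\<kappa> x :: real)"
  shows "(CLBINT \<xi>. complex_of_real (\<kappa> \<xi>) * iexp (\<xi> * y)) = complex_of_real (LBINT \<xi>. \<kappa> \<xi> * cos (\<xi> * y))"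
proof -
  let ?I = "CLBINT \<xi>. complex_of_real (\<kappa> \<xi>) * iexp (\<xi> * y)"
  have [measurable]: "\<kappa> \<in> borel_measurable borel" using borel_measurable_integrable[OF assms(1)] by simp
  note int = integrable_fourier_integrand[OF assms(1)]
  have "?I = \<bar>-1\<bar> *\<^sub>R (CLBINT \<xi>. complex_of_real (\<kappa> (0 + -1 * \<xi>)) * iexp ((0 + -1 * \<xi>) * y))"
    by (rule lborel_integral_real_affine) simp
  also have "\<dots> = (CLBINT \<xi>. complex_of_real (\<kappa> \<xi>) * iexp (\<xi> * (- y)))"
    using assms(2) by simp
  finally have "?I + ?I = (CLBINT \<xi>. complex_of_real (\<kappa> \<xi>) * iexp (\<xi> * y))
      + (CLBINT \<xi>. complex_of_real (\<kappa> \<xi>) * iexp (\<xi> * (- y)))"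
    by simp
  also have "\<dots> = (CLBINT \<xi>. complex_of_real (\<kappa> \<xi>) * iexp (\<xi> * y) + complex_of_real (\<kappa> \<xi>)
      * iexp (\<xi> * (- y)))"
    by (rule Bochner_Integration.integral_add[symmetric]; rule int)
  also have "\<dots> = (CLBINT \<xi>. complex_of_real (2 * (\<kappa> \<xi> * cos (\<xi> * y))))"
  proof (rule Bochner_Integration.integral_cong[OF refl])
    fix \<xi>
    have "iexp (\<xi> * y) + iexp (\<xi> * (- y)) = complex_of_real (2 * cos (\<xi> * y))"
      by (simp add: complex_eq_iff Re_exp Im_exp)
    then show "complex_of_real (\<kappa> \<xi>) * iexp (\<xi> * y) + complex_of_real (\<kappa> \<xi>) * iexp (\<xi> * (- y))
        = complex_of_real (2 * (\<kappa> \<xi> * cos (\<xi> * y)))"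
      unfolding distrib_left[symmetric] by simp
  qed
  also have "\<dots> = complex_of_real (LBINT \<xi>. 2 * (\<kappa> \<xi> * cos (\<xi> * y)))"
    by (rule integral_complex_of_real)
  also have "\<dots> = complex_of_real (LBINT \<xi>. \<kappa> \<xi> * cos (\<xi> * y)) + complex_of_real (LBINT \<xi>. \<kappa> \<xi>
      * cos (\<xi> * y))"
    by simp
  finally show ?thesis by simp
qed

text \<open>\<open>tent_fourier\<close> already writes the tent as an integral of
  \<open>fejer\<close> against cosines, so inversion amounts to a change of scale.\<close>

lemma moll_fourier:
  assumes r: "0 < r"
  shows "integrable lborel (\<lambda>\<xi>. fejer (\<xi> / r) / cos_const (1/2))"
    and "complex_of_real (moll r y) = (CLBINT \<xi>. complex_of_real (fejer (\<xi> / r) / cos_const (1/2))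
        * iexp (\<xi> * y))"
proof -
  have c: "0 < cos_const (1/2)" by (intro cos_const_pos) auto
  have "integrable lborel (\<lambda>\<xi>. fejer (0 + (1/r) * \<xi>))"
    using r by (intro lborel_integrable_real_affine integrable_fejer) auto
  then show int: "integrable lborel (\<lambda>\<xi>. fejer (\<xi> / r) / cos_const (1/2))" by simp
  have "(CLBINT \<xi>. complex_of_real (fejer (\<xi> / r) / cos_const (1/2)) * iexp (\<xi> * y))
     = complex_of_real (LBINT \<xi>. fejer (\<xi> / r) / cos_const (1/2) * cos (\<xi> * y))"
    by (rule fourier_integral_even[OF int]) simp
  also have "(LBINT \<xi>. fejer (\<xi> / r) / cos_const (1/2) * cos (\<xi> * y))
     = \<bar>r\<bar> *\<^sub>R (LBINT \<xi>. fejer ((0 + r * \<xi>) / r) / cos_const (1/2) * cos ((0 + r * \<xi>) * y))"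
    by (rule lborel_integral_real_affine) (use r in simp)
  also have "\<dots> = r * (LBINT \<xi>. (fejer \<xi> * cos ((r * y) * \<xi>)) / cos_const (1/2))"
    using r by (simp add: mult_ac)
  also have "\<dots> = r * ((LBINT \<xi>. fejer \<xi> * cos ((r * y) * \<xi>)) / cos_const (1/2))"
    by (subst integral_divide_zero) simp
  also have "(LBINT \<xi>. fejer \<xi> * cos ((r * y) * \<xi>)) = cos_const (1/2) * tent (r * y)"
    using tent_fourier[of "r * y"] by (simp only: has_bochner_integral_iff)
  also have "r * (cos_const (1/2) * tent (r * y) / cos_const (1/2)) = moll r y"
    using c by (simp add: moll_def)
  finally show "complex_of_real (moll r y) = (CLBINT \<xi>. complex_of_real (fejer (\<xi> / r) / cos_const
      (1/2)) * iexp (\<xi> * y))" ..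
qed

text \<open>Mollifiers at all scales have the same mass, so the two transforms have the same limit
  at the origin. Their difference is of order z^2 there and bounded by 1 elsewhere, hence below any
  power \<gamma> in (0, 1].\<close>

lemma fejer_half_minus_fejer_le:
  assumes "0 < \<gamma>" "\<gamma> \<le> 1"
  shows "\<bar>fejer (z / 2) - fejer z\<bar> \<le> \<bar>z\<bar> powr \<gamma>"
proof (cases "z = 0")
  case False
  have dbl: "cos z = 2 * (cos (z / 2))\<^sup>2 - 1" using cos_double_cos[of "z / 2"] by simp
  have eq: "fejer (z / 2) - fejer z = 2 * (1 - cos (z / 2))\<^sup>2 / z\<^sup>2"
    using False unfolding fejer_eq dbl by (simp add: field_simps power2_eq_square)
  show ?thesis
  proof (cases "\<bar>z\<bar> \<le> 1")
    case True
    have "1 - cos (z / 2) \<le> z\<^sup>2 / 8" using one_minus_cos_le_sq[of "z / 2"] by (simp add: power_divide)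
    then have "(1 - cos (z / 2))\<^sup>2 \<le> (z\<^sup>2 / 8)\<^sup>2" by (intro power_mono) auto
    then have "2 * (1 - cos (z / 2))\<^sup>2 / z\<^sup>2 \<le> 2 * (z\<^sup>2 / 8)\<^sup>2 / z\<^sup>2"
      by (intro divide_right_mono) auto
    also have "\<dots> \<le> z\<^sup>2" using False by (simp add: field_simps power2_eq_square)
    also have "\<dots> = \<bar>z\<bar> powr 2" using False by (simp add: powr_numeral)
    also have "\<dots> \<le> \<bar>z\<bar> powr \<gamma>" using True False assms by (intro powr_mono') auto
    finally show ?thesis unfolding eq by simp
  next
    case large: False
    have "\<bar>fejer (z / 2) - fejer z\<bar> \<le> 1"
      using fejer_nonneg[of "z/2"] fejer_nonneg[of z] fejer_le_half[of "z/2"] fejer_le_half[of z]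
          by linarith
    also have "1 \<le> \<bar>z\<bar> powr \<gamma>" using large assms by (intro ge_one_powr_ge_zero) auto
    finally show ?thesis .
  qed
qed (simp add: fejer_def)

lemma fourier_kernel_moll:
  assumes r: "0 < r" and \<gamma>: "0 < \<gamma>" "\<gamma> \<le> 1"
  shows "fourier_kernel \<gamma> (1 / cos_const (1/2)) (moll r)"
proof -
  have c: "0 < cos_const (1/2)" by (intro cos_const_pos) auto
  have "\<bar>fejer (\<xi> / r) / cos_const (1/2)\<bar> \<le> 1 / cos_const (1/2) * (1 + \<bar>\<xi>\<bar> powr \<gamma>)" for \<xi>
  proof -
    have "\<bar>fejer (\<xi> / r)\<bar> \<le> 1 + \<bar>\<xi>\<bar> powr \<gamma>"
      using fejer_nonneg[of "\<xi> / r"] fejer_le_half[of "\<xi> / r"] powr_ge_zero[of "\<bar>\<xi>\<bar>" \<gamma>] by linarith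
    then show ?thesis using c by (simp add: abs_divide divide_right_mono)
  qed
  with moll_fourier[OF r] c show ?thesis unfolding fourier_kernel_def by auto
qed

text \<open>The preceding bound at \<open>z = \<xi> / r\<close> trades a power \<gamma> of the
  frequency for the factor \<open>r powr (- \<gamma>)\<close>.\<close>

lemma fourier_kernel_moll_diff:
  assumes r: "0 < r" and \<gamma>: "0 < \<gamma>" "\<gamma> \<le> 1"
  shows "fourier_kernel \<gamma> (r powr (- \<gamma>) / cos_const (1/2)) (\<lambda>y. moll (2 * r) y - moll r y)"
  unfolding fourier_kernel_def
proof (intro conjI exI allI)
  have c: "0 < cos_const (1/2)" by (intro cos_const_pos) auto
  let ?\<kappa> = "\<lambda>\<xi>. fejer (\<xi> / (2 * r)) / cos_const (1/2) - fejer (\<xi> / r) / cos_const (1/2)"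
  show "(\<lambda>y. moll (2 * r) y - moll r y) \<in> borel_measurable borel" by measurable
  show "0 < r powr (- \<gamma>) / cos_const (1/2)" using r c by simp
  show "integrable lborel ?\<kappa>" using r by (intro Bochner_Integration.integrable_diff moll_fourier(1)) auto
  fix y
  have int: "integrable lborel (\<lambda>\<xi>. complex_of_real (fejer (\<xi> / r') / cos_const (1/2))
      * iexp (\<xi> * y))" if "0 < r'" for r'
    by (rule integrable_fourier_integrand[OF moll_fourier(1)[OF that]])
  have "complex_of_real (moll (2 * r) y - moll r y) =
     (CLBINT \<xi>. complex_of_real (fejer (\<xi> / (2 * r)) / cos_const (1/2)) * iexp (\<xi> * y))
         - (CLBINT \<xi>. complex_of_real (fejer (\<xi> / r) / cos_const (1/2)) * iexp (\<xi> * y))"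
    using r moll_fourier(2)[of r y] moll_fourier(2)[of "2 * r" y] by simp
  also have "\<dots> = (CLBINT \<xi>. complex_of_real (fejer (\<xi> / (2 * r)) / cos_const (1/2)) * iexp (\<xi> * y)
      - complex_of_real (fejer (\<xi> / r) / cos_const (1/2)) * iexp (\<xi> * y))"
    using r by (intro Bochner_Integration.integral_diff[symmetric] int) auto
  also have "\<dots> = (CLBINT \<xi>. complex_of_real (?\<kappa> \<xi>) * iexp (\<xi> * y))"
    by (simp add: left_diff_distrib)
  finally show "complex_of_real (moll (2 * r) y - moll r y) = (CLBINT \<xi>. complex_of_real (?\<kappa> \<xi>)
      * iexp (\<xi> * y))" .
next
  have c: "0 < cos_const (1/2)" by (intro cos_const_pos) auto
  fix \<xi>
  have "\<bar>fejer (\<xi> / r / 2) - fejer (\<xi> / r)\<bar> \<le> \<bar>\<xi> / r\<bar> powr \<gamma>"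
    by (rule fejer_half_minus_fejer_le[OF \<gamma>])
  also have "\<dots> = r powr (- \<gamma>) * \<bar>\<xi>\<bar> powr \<gamma>"
    using r by (simp add: powr_divide powr_minus field_simps)
  also have "\<dots> \<le> r powr (- \<gamma>) * (1 + \<bar>\<xi>\<bar> powr \<gamma>)" by (intro mult_left_mono) auto
  finally have "\<bar>fejer (\<xi> / (2 * r)) - fejer (\<xi> / r)\<bar> / cos_const (1/2) \<le> r powr (- \<gamma>)
      * (1 + \<bar>\<xi>\<bar> powr \<gamma>) / cos_const (1/2)"
    using c by (intro divide_right_mono) (auto simp: mult.commute)
  then show "\<bar>fejer (\<xi> / (2 * r)) / cos_const (1/2) - fejer (\<xi> / r) / cos_const (1/2)\<bar>
      \<le> r powr (- \<gamma>) / cos_const (1/2) * (1 + \<bar>\<xi>\<bar> powr \<gamma>)"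
    using c by (simp add: diff_divide_distrib[symmetric])
qed

section \<open>Product mollifiers on the range\<close>

definition moll_vec :: "real \<Rightarrow> real ^ 'd \<Rightarrow> real" where
  "moll_vec r y = (\<Prod>i\<in>UNIV. moll r (y $ i))"

lemma borel_measurable_moll_vec [measurable]: "moll_vec r \<in> borel_measurable borel"
  unfolding moll_vec_def[abs_def] by measurable

lemma moll_vec_nonneg: "0 \<le> r \<Longrightarrow> 0 \<le> moll_vec r y"
  by (simp add: moll_vec_def prod_nonneg moll_nonneg)

lemma moll_vec_le: "0 \<le> r \<Longrightarrow> moll_vec r y \<le> r ^ CARD('d)" for y :: "real ^ 'd"
  unfolding moll_vec_def using prod_mono[of UNIV "\<lambda>i. moll r (y $ i)" "\<lambda>_. r"]
      by (simp add: moll_nonneg moll_le)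

lemma nn_integral_moll_vec: "0 < r \<Longrightarrow> (\<integral>\<^sup>+ x. ennreal (moll_vec r (y - x)) \<partial>lborel) = 1"
proof -
  assume r: "0 < r"
  have "(\<integral>\<^sup>+ x. ennreal (moll_vec r (y - x)) \<partial>lborel)
      = (\<integral>\<^sup>+ x. (\<Prod>i\<in>UNIV. ennreal (moll r (y $ i - x $ i))) \<partial>lborel)"
    using r by (intro nn_integral_cong) (simp add: moll_vec_def prod_ennreal moll_nonneg)
  also have "\<dots> = (\<Prod>i\<in>UNIV. \<integral>\<^sup>+ x. ennreal (moll r (y $ i - x)) \<partial>lborel)"
    by (rule nn_integral_lborel_prod_vec) measurable
  finally show ?thesis by (simp add: nn_integral_moll r)
qed

text \<open>Heights contribute the factor r once per coordinate, and the slope of one tent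
  contributes one more.\<close>

lemma moll_vec_lipschitz:
  fixes y z :: "real ^ 'd"
  assumes "0 \<le> r"
  shows "\<bar>moll_vec r y - moll_vec r z\<bar> \<le> r ^ (CARD('d) + 1) * (\<Sum>i\<in>UNIV. \<bar>y $ i - z $ i\<bar>)"
proof -
  have eq: "moll_vec r y = r ^ CARD('d) * (\<Prod>i\<in>UNIV. tent (r * y $ i))" for y :: "real ^ 'd"
    by (simp add: moll_vec_def moll_def prod.distrib)
  have "\<bar>moll_vec r y - moll_vec r z\<bar> = r ^ CARD('d) * norm ((\<Prod>i\<in>UNIV. tent (r * y $ i))
      - (\<Prod>i\<in>UNIV. tent (r * z $ i)))"
    using assms by (simp add: eq abs_mult flip: right_diff_distrib)
  also have "\<dots> \<le> r ^ CARD('d) * (\<Sum>i\<in>UNIV. norm (tent (r * y $ i) - tent (r * z $ i)))"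
    using assms by (intro mult_left_mono norm_prod_diff) (auto simp: tent_nonneg tent_le_one)
  also have "\<dots> \<le> r ^ CARD('d) * (\<Sum>i\<in>UNIV. r * \<bar>y $ i - z $ i\<bar>)"
  proof (intro mult_left_mono sum_mono)
    fix i
    show "norm (tent (r * y $ i) - tent (r * z $ i)) \<le> r * \<bar>y $ i - z $ i\<bar>"
      using tent_lipschitz[of "r * y $ i" "r * z $ i"] assms
          by (simp add: abs_mult flip: right_diff_distrib)
  qed (use assms in auto)
  finally show ?thesis by (simp add: sum_distrib_left mult_ac)
qed

text \<open>Every summand contains a difference of mollifiers, the source of the decay in \<open>r\<close>.\<close>

lemma moll_vec_double:
  fixes y :: "real ^ 'd"
  shows "moll_vec (2 * r) y - moll_vec r y =
    (\<Sum>S\<in>Pow UNIV - {{}}. \<Prod>i\<in>UNIV. (if i \<in> S then moll (2 * r) (y $ i)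
        - moll r (y $ i) else moll r (y $ i)))"
proof -
  let ?f = "\<lambda>S i. if i \<in> S then moll (2 * r) (y $ i) - moll r (y $ i) else moll r (y $ i)"
  have "moll_vec (2 * r) y = (\<Prod>i\<in>UNIV. (moll (2 * r) (y $ i) - moll r (y $ i)) + moll r (y $ i))"
    by (simp add: moll_vec_def)
  also have "\<dots> = (\<Sum>S\<in>Pow UNIV. (\<Prod>i\<in>S. moll (2 * r) (y $ i) - moll r (y $ i))
      * (\<Prod>i\<in>UNIV - S. moll r (y $ i)))"
    by (rule prod_add) simp
  also have "\<dots> = (\<Sum>S\<in>Pow UNIV. \<Prod>i\<in>UNIV. ?f S i)"
  proof (intro sum.cong refl)
    fix S :: "'d set"
    have "(\<Prod>i\<in>UNIV. ?f S i) = (\<Prod>i\<in>S \<union> (UNIV - S). ?f S i)" by simp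
    also have "\<dots> = (\<Prod>i\<in>S. ?f S i) * (\<Prod>i\<in>UNIV - S. ?f S i)" by (rule prod.union_disjoint) auto
    finally show "(\<Prod>i\<in>S. moll (2 * r) (y $ i) - moll r (y $ i)) * (\<Prod>i\<in>UNIV - S. moll r (y $ i))
        = (\<Prod>i\<in>UNIV. ?f S i)" by simp
  qed
  also have "\<dots> = (\<Prod>i\<in>UNIV. ?f {} i) + (\<Sum>S\<in>Pow UNIV - {{}}. \<Prod>i\<in>UNIV. ?f S i)"
    by (rule sum.remove) auto
  finally show ?thesis by (simp add: moll_vec_def)
qed

section \<open>Smoothed occupation densities\<close>

text \<open>The integral runs over the whole box, with an indicator for the subbox, so that all t
  share one measure and the indicator can play the part of g in
  \<open>fbs_integral_moment_le\<close>.\<close>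

definition smoothed_occupation ::
    "(real ^ 'n \<Rightarrow> real ^ 'd) \<Rightarrow> real ^ 'n \<Rightarrow> real ^ 'n \<Rightarrow> real \<Rightarrow> real ^ 'd \<Rightarrow> real ^ 'n \<Rightarrow> real" where
  "smoothed_occupation X a h r x t =
     (LINT s|restrict_space lborel (cbox a (a + h)). indicator (cbox a (a + t)) s
         * moll_vec r (X s - x))"

lemma measure_cbox_shift:
  fixes a t :: "real ^ 'n"
  assumes "\<And>l. 0 \<le> t $ l"
  shows "measure lborel (cbox a (a + t)) = (\<Prod>l\<in>UNIV. t $ l)"
proof -
  have "cbox a (a + t) \<noteq> {}" using assms by (auto simp: interval_ne_empty_cart)
  then show ?thesis by (simp add: content_cbox_cart)
qed

lemma subset_box_cart_shift:
  fixes a v h :: "real ^ 'n"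
  assumes "\<And>l. v $ l \<le> h $ l"
  shows "cbox a (a + v) \<subseteq> cbox a (a + h)"
proof
  fix s assume s: "s \<in> cbox a (a + v)"
  have "s $ l \<le> a $ l + h $ l" for l
    using s assms[of l] by (auto simp: mem_box_cart intro: order_trans[OF _ add_left_mono])
  then show "s \<in> cbox a (a + h)" using s by (auto simp: mem_box_cart)
qed

text \<open>Boxes with a common lower corner intersect in the box of the componentwise minima m, and
  the symmetric difference has volume |t| + |u| - 2|m|, with |.| the product of the side
  lengths.\<close>

lemma integral_indicator_cbox_diff_le:
  fixes a h t u :: "real ^ 'n"
  assumes h: "\<And>l. 0 < h $ l" and t: "t \<in> cbox 0 h" and u: "u \<in> cbox 0 h"
  shows "(LINT s|restrict_space lborel (cbox a (a + h)). \<bar>indicator (cbox a (a + t)) s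
      - indicator (cbox a (a + u)) s\<bar> :: real)
    \<le> 2 * (\<Prod>l\<in>UNIV. h $ l) * (\<Sum>l\<in>UNIV. \<bar>t $ l - u $ l\<bar> / h $ l)"
proof -
  let ?\<mu> = "restrict_space lborel (cbox a (a + h))"
  interpret finite_measure ?\<mu> by (rule finite_measure_restrict_cbox)
  define m :: "real ^ 'n" where "m = (\<chi> l. min (t $ l) (u $ l))"
  have bounds: "0 \<le> t $ l" "t $ l \<le> h $ l" "0 \<le> u $ l" "u $ l \<le> h $ l" for l
    using t u by (auto simp: mem_box_cart)
  have m: "0 \<le> m $ l" "m $ l \<le> t $ l" "m $ l \<le> u $ l" "m $ l \<le> h $ l" for l
    using bounds[of l] by (auto simp: m_def)
  have inter: "cbox a (a + t) \<inter> cbox a (a + u) = cbox a (a + m)"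
    unfolding mem_box_cart set_eq_iff Int_iff m_def by (auto simp: min_add_distrib_right)
  have pw: "\<bar>indicator (cbox a (a + t)) s - indicator (cbox a (a + u)) s\<bar> =
     indicator (cbox a (a + t)) s + indicator (cbox a (a + u)) s - 2
         * (indicator (cbox a (a + m)) s :: real)" for s
    unfolding inter[symmetric] by (auto simp: indicator_def)
  have int: "integrable ?\<mu> (indicator (cbox a (a + v)) :: _ \<Rightarrow> real)" for v
    by (intro integrable_const_bound[of _ 1]) (auto simp: indicator_def intro!:
        measurable_restrict_space1)
  have LI: "(LINT s|?\<mu>. indicator (cbox a (a + v)) s) = (\<Prod>l\<in>UNIV. v $ l)" if "\<And>l. 0 \<le> v $ l"
      "\<And>l. v $ l \<le> h $ l" for v
  proof -
    have sub: "cbox a (a + v) \<subseteq> cbox a (a + h)" by (rule subset_box_cart_shift[OF that(2)])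
    have "(LINT s|?\<mu>. indicator (cbox a (a + v)) s)
        = (LINT s|lborel. indicator (cbox a (a + v)) s :: real)"
    proof -
      have "indicator (cbox a (a + h)) s *\<^sub>R (indicator (cbox a (a + v)) s :: real)
          = indicator (cbox a (a + v)) s" for s
        using sub by (auto simp: indicator_def)
      note eq = this
      have "(LINT s|?\<mu>. indicator (cbox a (a + v)) s)
          = (LINT s|lborel. indicator (cbox a (a + h)) s *\<^sub>R (indicator (cbox a (a + v)) s :: real))"
        by (rule integral_restrict_space) simp
      then show ?thesis by (simp only: eq)
    qed
    also have "\<dots> = (\<Prod>l\<in>UNIV. v $ l)" using measure_cbox_shift[of v a] that by simp
    finally show ?thesis .
  qed
  have diff: "(\<Prod>l\<in>UNIV. v $ l) - (\<Prod>l\<in>UNIV. m $ l) \<le> (\<Prod>l\<in>UNIV. h $ l)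
      * (\<Sum>l\<in>UNIV. \<bar>t $ l - u $ l\<bar> / h $ l)"
    if v: "v = t \<or> v = u" for v
  proof -
    have v0: "0 \<le> v $ l" "v $ l \<le> h $ l" "\<bar>v $ l - m $ l\<bar> \<le> \<bar>t $ l - u $ l\<bar>" for l
      using v bounds[of l] by (auto simp: m_def)
    \<comment> \<open>Division by h brings all factors into [0, 1], where the difference of two
      products is at most the sum of the differences of the factors.\<close>
    have "(\<Prod>l\<in>UNIV. v $ l) - (\<Prod>l\<in>UNIV. m $ l) = (\<Prod>l\<in>UNIV. h $ l) * ((\<Prod>l\<in>UNIV. v $ l / h $ l)
        - (\<Prod>l\<in>UNIV. m $ l / h $ l))"
      using h by (simp add: prod_dividef right_diff_distrib less_imp_neq[THEN not_sym])
    also have "\<dots> \<le> (\<Prod>l\<in>UNIV. h $ l) * norm ((\<Prod>l\<in>UNIV. v $ l / h $ l) - (\<Prod>l\<in>UNIV. m $ l / h $ l))"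
      using h by (intro mult_left_mono prod_nonneg) (auto simp: less_imp_le)
    also have "\<dots> \<le> (\<Prod>l\<in>UNIV. h $ l) * (\<Sum>l\<in>UNIV. norm (v $ l / h $ l - m $ l / h $ l))"
      using h v0 m by (intro mult_left_mono norm_prod_diff prod_nonneg) (auto simp: less_imp_le)
    also have "\<dots> \<le> (\<Prod>l\<in>UNIV. h $ l) * (\<Sum>l\<in>UNIV. \<bar>t $ l - u $ l\<bar> / h $ l)"
    proof (intro mult_left_mono sum_mono prod_nonneg)
      fix l
      have "norm (v $ l / h $ l - m $ l / h $ l) = \<bar>v $ l - m $ l\<bar> / h $ l"
        using h[of l] by (simp flip: diff_divide_distrib)
      also have "\<dots> \<le> \<bar>t $ l - u $ l\<bar> / h $ l" using h[of l] v0(3)[of l] by (intro divide_right_mono) auto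
      finally show "norm (v $ l / h $ l - m $ l / h $ l) \<le> \<bar>t $ l - u $ l\<bar> / h $ l" .
    qed (use h in \<open>auto simp: less_imp_le\<close>)
    finally show ?thesis .
  qed
  have "(LINT s|?\<mu>. \<bar>indicator (cbox a (a + t)) s - indicator (cbox a (a + u)) s\<bar> :: real)
     = (\<Prod>l\<in>UNIV. t $ l) + (\<Prod>l\<in>UNIV. u $ l) - 2 * (\<Prod>l\<in>UNIV. m $ l)"
    unfolding pw
    by (simp only: Bochner_Integration.integral_add Bochner_Integration.integral_diff
        Bochner_Integration.integrable_add
        Bochner_Integration.integrable_diff integrable_mult_right integral_mult_right_zero int LI
            bounds m)
  then show ?thesis using diff[of t, OF disjI1[OF refl]] diff[of u, OF disjI2[OF refl]] by linarith
qed

lemma borel_measurable_restrict_subset: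
  assumes "X \<in> borel_measurable (restrict_space borel A)" "B \<subseteq> A"
  shows "X \<in> borel_measurable (restrict_space borel B)"
    and "X \<in> borel_measurable (restrict_space lborel B)"
proof -
  show X: "X \<in> borel_measurable (restrict_space borel B)"
    using measurable_restrict_mono[OF assms] .
  then show "X \<in> borel_measurable (restrict_space lborel B)"
    by (simp cong: measurable_cong_sets sets_restrict_space_cong)
qed

lemma measurable_moll_vec_comp:
  fixes X :: "real ^ 'n \<Rightarrow> real ^ 'd"
  assumes "X \<in> borel_measurable (restrict_space borel A)"
  shows "(\<lambda>s. moll_vec r (X s - x)) \<in> borel_measurable (restrict_space lborel A)"
proof -
  have [measurable]: "X \<in> borel_measurable (restrict_space lborel A)"
    by (rule borel_measurable_restrict_subset(2)[OF assms order_refl])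
  show ?thesis by measurable
qed

lemma smoothed_occupation_lipschitz:
  fixes X :: "real ^ 'n \<Rightarrow> real ^ 'd" and a h t u :: "real ^ 'n"
  assumes X: "X \<in> borel_measurable (restrict_space borel (cbox a (a + h)))"
    and h: "\<And>l. 0 < h $ l" and t: "t \<in> cbox 0 h" and u: "u \<in> cbox 0 h" and r: "1 \<le> r"
  shows "\<bar>smoothed_occupation X a h r x t - smoothed_occupation X a h r y u\<bar>
    \<le> r ^ (CARD('d) + 1) * (\<Prod>l\<in>UNIV. h $ l) * ((\<Sum>i\<in>UNIV. \<bar>x $ i - y $ i\<bar>) + 2
        * (\<Sum>l\<in>UNIV. \<bar>t $ l - u $ l\<bar> / h $ l))"
proof -
  let ?\<mu> = "restrict_space lborel (cbox a (a + h))"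
  interpret finite_measure ?\<mu> by (rule finite_measure_restrict_cbox)
  define V where "V = (\<Prod>l\<in>UNIV. h $ l)"
  have mu: "measure ?\<mu> (space ?\<mu>) = V"
    using measure_cbox_shift[of h a] h by (simp add: V_def space_restrict_space
        measure_restrict_space less_imp_le)
  note [measurable] = measurable_moll_vec_comp[OF X]
  have [measurable]: "(indicator (cbox a v) :: _ \<Rightarrow> real) \<in> borel_measurable ?\<mu>" for v
    by (intro measurable_restrict_space1) auto
  let ?S = "\<Sum>i\<in>UNIV. \<bar>x $ i - y $ i\<bar>"
  let ?d = "\<lambda>s. \<bar>indicator (cbox a (a + t)) s - indicator (cbox a (a + u)) s\<bar> :: real"
  have r0: "0 \<le> r" using r by simp
  have bnd: "\<bar>moll_vec r (X s - x)\<bar> \<le> r ^ CARD('d)" for s x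
    using moll_vec_le[OF r0, of "X s - x"] moll_vec_nonneg[OF r0, of "X s - x"] by simp
  have int1: "integrable ?\<mu> (\<lambda>s. indicator (cbox a (a + v)) s * moll_vec r (X s - z))" for v z
  proof (rule integrable_const_bound)
    show "AE s in ?\<mu>. norm (indicator (cbox a (a + v)) s * moll_vec r (X s - z)) \<le> r ^ CARD('d)"
      using bnd by (intro AE_I2) (auto simp: indicator_def r0)
  qed measurable
  have int2: "integrable ?\<mu> ?d"
  proof (rule integrable_const_bound)
    show "AE s in ?\<mu>. norm (?d s) \<le> 1" by (intro AE_I2) (auto simp: indicator_def)
  qed measurable
  have "\<bar>smoothed_occupation X a h r x t - smoothed_occupation X a h r y u\<bar>
     = norm (LINT s|?\<mu>. indicator (cbox a (a + t)) s * moll_vec r (X s - x)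
         - indicator (cbox a (a + u)) s * moll_vec r (X s - y))"
    unfolding smoothed_occupation_def using int1 by simp
  also have "\<dots> \<le> (LINT s|?\<mu>. norm (indicator (cbox a (a + t)) s * moll_vec r (X s - x)
      - indicator (cbox a (a + u)) s * moll_vec r (X s - y)))"
    by (rule integral_norm_bound)
  also have "\<dots> \<le> (LINT s|?\<mu>. r ^ (CARD('d) + 1) * ?S + r ^ (CARD('d) + 1) * ?d s)"
  proof (rule integral_mono)
    fix s
    have 1: "\<bar>moll_vec r (X s - x) - moll_vec r (X s - y)\<bar> \<le> r ^ (CARD('d) + 1) * ?S"
      using moll_vec_lipschitz[OF r0, of "X s - x" "X s - y"] by (simp add: abs_minus_commute)
    \<comment> \<open>One power of r is given away, using \<open>1 \<le> r\<close>, so that x and t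
      share the same constant.\<close>
    have 2: "\<bar>moll_vec r (X s - y)\<bar> \<le> r ^ (CARD('d) + 1)"
      using bnd[of s y] power_increasing[of "CARD('d)" "CARD('d) + 1" r] r by linarith
    have "norm (indicator (cbox a (a + t)) s * moll_vec r (X s - x) - indicator (cbox a (a + u)) s
        * moll_vec r (X s - y))
       = \<bar>indicator (cbox a (a + t)) s * (moll_vec r (X s - x) - moll_vec r (X s - y))
           + (indicator (cbox a (a + t)) s - indicator (cbox a (a + u)) s) * moll_vec r (X s - y)\<bar>"
      by (simp add: algebra_simps)
    also have "\<dots> \<le> \<bar>moll_vec r (X s - x) - moll_vec r (X s - y)\<bar> + ?d s * \<bar>moll_vec r (X s - y)\<bar>"
      by (rule order_trans[OF abs_triangle_ineq]) (auto simp: abs_mult indicator_def)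
    also have "\<dots> \<le> r ^ (CARD('d) + 1) * ?S + ?d s * r ^ (CARD('d) + 1)"
      using 1 2 by (intro add_mono mult_left_mono) auto
    finally show "norm (indicator (cbox a (a + t)) s * moll_vec r (X s - x)
        - indicator (cbox a (a + u)) s * moll_vec r (X s - y))
      \<le> r ^ (CARD('d) + 1) * ?S + r ^ (CARD('d) + 1) * ?d s" by (simp only: mult.commute)
  qed (use int1 int2 in auto)
  also have "\<dots> = r ^ (CARD('d) + 1) * ?S * V + r ^ (CARD('d) + 1) * (LINT s|?\<mu>. ?d s)"
    using int2 mu by simp
  also have "\<dots> \<le> r ^ (CARD('d) + 1) * ?S * V + r ^ (CARD('d) + 1)
      * (2 * V * (\<Sum>l\<in>UNIV. \<bar>t $ l - u $ l\<bar> / h $ l))"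
    unfolding V_def using r0 by (intro add_left_mono mult_left_mono integral_indicator_cbox_diff_le
        h t u) auto
  finally show ?thesis by (simp add: V_def algebra_simps)
qed

lemma continuous_on_smoothed_occupation:
  fixes X :: "real ^ 'n \<Rightarrow> real ^ 'd" and a h :: "real ^ 'n"
  assumes X: "X \<in> borel_measurable (restrict_space borel (cbox a (a + h)))"
    and h: "\<And>l. 0 < h $ l" and r: "1 \<le> r"
  shows "continuous_on (UNIV \<times> cbox 0 h) (\<lambda>(x, t). smoothed_occupation X a h r x t)"
  unfolding continuous_on_def
proof
  fix p :: "(real ^ 'd) \<times> (real ^ 'n)" assume p: "p \<in> UNIV \<times> cbox 0 h"
  let ?F = "at p within UNIV \<times> cbox 0 h"
  let ?f = "\<lambda>(x, t). smoothed_occupation X a h r x t"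
  let ?g = "\<lambda>q. r ^ (CARD('d) + 1) * (\<Prod>l\<in>UNIV. h $ l) * ((\<Sum>i\<in>UNIV. \<bar>fst q $ i - fst p $ i\<bar>) + 2
      * (\<Sum>l\<in>UNIV. \<bar>snd q $ l - snd p $ l\<bar> / h $ l))"
  have "((\<lambda>q. ?f q - ?f p) \<longlongrightarrow> 0) ?F"
  proof (rule Lim_null_comparison)
    show "\<forall>\<^sub>F q in ?F. norm (?f q - ?f p) \<le> ?g q"
      using p smoothed_occupation_lipschitz[OF X h _ _ r]
      by (auto simp: eventually_at_topological case_prod_beta intro!: exI[of _ UNIV])
    have "(?g \<longlongrightarrow> ?g p) ?F"
      by (intro tendsto_intros) (use h in \<open>auto simp: less_imp_neq[THEN not_sym]\<close>)
    then show "(?g \<longlongrightarrow> 0) ?F" by simp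
  qed
  then show "(?f \<longlongrightarrow> ?f p) ?F" by (simp add: LIM_zero_iff)
qed

lemma ennreal_smoothed_occupation:
  fixes X :: "real ^ 'n \<Rightarrow> real ^ 'd" and a h t :: "real ^ 'n"
  assumes X: "X \<in> borel_measurable (restrict_space borel (cbox a (a + h)))" and t: "t \<in> cbox 0 h"
      and r: "0 \<le> r"
  shows "ennreal (smoothed_occupation X a h r x t)
      = (\<integral>\<^sup>+ s. ennreal (moll_vec r (X s - x)) \<partial>restrict_space lborel (cbox a (a + t)))"
proof -
  let ?\<mu> = "restrict_space lborel (cbox a (a + h))"
  interpret finite_measure ?\<mu> by (rule finite_measure_restrict_cbox)
  have sub: "cbox a (a + t) \<subseteq> cbox a (a + h)" using t
      by (intro subset_box_cart_shift) (auto simp: mem_box_cart)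
  note [measurable] = measurable_moll_vec_comp[OF X]
  have [measurable]: "(indicator (cbox a v) :: _ \<Rightarrow> real) \<in> borel_measurable ?\<mu>" for v
    by (intro measurable_restrict_space1) auto
  have "integrable ?\<mu> (\<lambda>s. indicator (cbox a (a + t)) s * moll_vec r (X s - x))"
  proof (rule integrable_const_bound)
    show "AE s in ?\<mu>. norm (indicator (cbox a (a + t)) s * moll_vec r (X s - x)) \<le> r ^ CARD('d)"
    proof (intro AE_I2)
      fix s
      show "norm (indicator (cbox a (a + t)) s * moll_vec r (X s - x)) \<le> r ^ CARD('d)"
        using moll_vec_le[OF r, of "X s - x"] moll_vec_nonneg[OF r, of "X s - x"] r
            by (auto simp: indicator_def)
    qed
  qed measurable
  then have "ennreal (smoothed_occupation X a h r x t)
      = (\<integral>\<^sup>+ s. ennreal (indicator (cbox a (a + t)) s * moll_vec r (X s - x)) \<partial>?\<mu>)"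
    unfolding smoothed_occupation_def by (subst nn_integral_eq_integral)
        (auto intro!: AE_I2 mult_nonneg_nonneg moll_vec_nonneg r)
  also have "\<dots> = (\<integral>\<^sup>+ s. ennreal (moll_vec r (X s - x)) * indicator (cbox a (a + t)) s \<partial>lborel)"
    using sub by (subst nn_integral_restrict_space) (auto intro!: nn_integral_cong simp: indicator_def)
  also have "\<dots> = (\<integral>\<^sup>+ s. ennreal (moll_vec r (X s - x)) \<partial>restrict_space lborel (cbox a (a + t)))"
    by (subst nn_integral_restrict_space) auto
  finally show ?thesis .
qed

section \<open>Identifying the limit with the density of the occupation measure\<close>

lemma infdist_lipschitz: "\<bar>infdist x A - infdist y A\<bar> \<le> dist x y"
  using infdist_triangle[of x A y] infdist_triangle[of y A x] by (simp add: dist_commute)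

text \<open>The mollifier has mass 1 and vanishes off the cube of half-side \<open>1 / r\<close>, on
  which f varies by at most \<open>m * d / r\<close>. The two inequalities stand for a bound on a
  difference in \<open>ennreal\<close>.\<close>

lemma moll_vec_lipschitz_integral:
  fixes f :: "real ^ 'd \<Rightarrow> real"
  assumes [measurable]: "f \<in> borel_measurable borel" and f0: "\<And>x. 0 \<le> f x" and lip:
      "\<And>x y. \<bar>f x - f y\<bar> \<le> m * dist x y" and m: "0 \<le> m" and r: "0 < r"
  defines "\<delta> \<equiv> m * real CARD('d) / r"
  shows "(\<integral>\<^sup>+ x. ennreal (f x * moll_vec r (y - x)) \<partial>lborel) \<le> ennreal (f y + \<delta>)"
    and "ennreal (f y) \<le> (\<integral>\<^sup>+ x. ennreal (f x * moll_vec r (y - x)) \<partial>lborel) + ennreal \<delta>"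
proof -
  have \<delta>: "0 \<le> \<delta>" using m r by (simp add: \<delta>_def)
  have r0: "0 \<le> r" using r by simp
  note nn = moll_vec_nonneg[OF r0]
  have close: "\<bar>f x - f y\<bar> * moll_vec r (y - x) \<le> \<delta> * moll_vec r (y - x)" for x
  proof (cases "\<forall>i. \<bar>(y - x) $ i\<bar> \<le> 1 / r")
    case True
    have "dist x y \<le> (\<Sum>i\<in>UNIV. \<bar>(y - x) $ i\<bar>)"
      unfolding dist_norm norm_minus_commute[of x y] by (rule norm_le_l1_cart)
    also have "\<dots> \<le> (\<Sum>i\<in>(UNIV::'d set). 1 / r)" using True by (intro sum_mono) auto
    finally have "dist x y \<le> real CARD('d) / r" by simp
    then have "\<bar>f x - f y\<bar> \<le> m * (real CARD('d) / r)" using lip[of x y] m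
        by (meson mult_left_mono order_trans)
    then show ?thesis using nn by (intro mult_right_mono) (auto simp: \<delta>_def)
  next
    case False
    then obtain i where "1 / r \<le> \<bar>(y - x) $ i\<bar>" by (meson linear)
    then have "moll r ((y - x) $ i) = 0" by (rule moll_eq_0[OF r])
    then have "moll_vec r (y - x) = 0" unfolding moll_vec_def by (intro prod_zero) auto
    then show ?thesis by simp
  qed
  have nnm: "(\<integral>\<^sup>+ x. ennreal c * ennreal (moll_vec r (y - x)) \<partial>lborel) = ennreal c" for c
    using nn_integral_moll_vec[OF r, of y] by (simp add: nn_integral_cmult)
  have "(\<integral>\<^sup>+ x. ennreal (f x * moll_vec r (y - x)) \<partial>lborel) \<le> (\<integral>\<^sup>+ x. ennreal (f y + \<delta>)
      * ennreal (moll_vec r (y - x)) \<partial>lborel)"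
  proof (intro nn_integral_mono)
    fix x
    have "(f x - f y) * moll_vec r (y - x) \<le> \<bar>f x - f y\<bar> * moll_vec r (y - x)" using nn
        by (intro mult_right_mono) auto
    then have "f x * moll_vec r (y - x) \<le> (f y + \<delta>) * moll_vec r (y - x)"
      using close[of x] by (simp add: algebra_simps)
    then show "ennreal (f x * moll_vec r (y - x)) \<le> ennreal (f y + \<delta>) * ennreal (moll_vec r (y - x))"
      using f0[of y] \<delta> nn by (subst ennreal_mult[symmetric]) (auto intro: ennreal_leI)
  qed
  then show "(\<integral>\<^sup>+ x. ennreal (f x * moll_vec r (y - x)) \<partial>lborel) \<le> ennreal (f y + \<delta>)" unfolding nnm .
  have "ennreal (f y) = (\<integral>\<^sup>+ x. ennreal (f y) * ennreal (moll_vec r (y - x)) \<partial>lborel)"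
      by (rule nnm[symmetric])
  also have "\<dots> \<le> (\<integral>\<^sup>+ x. ennreal (f x * moll_vec r (y - x)) + ennreal \<delta>
      * ennreal (moll_vec r (y - x)) \<partial>lborel)"
  proof (intro nn_integral_mono)
    fix x
    have "(f y - f x) * moll_vec r (y - x) \<le> \<bar>f x - f y\<bar> * moll_vec r (y - x)" using nn
        by (intro mult_right_mono) auto
    then have "f y * moll_vec r (y - x) \<le> f x * moll_vec r (y - x) + \<delta> * moll_vec r (y - x)"
      using close[of x] by (simp add: algebra_simps)
    then have "ennreal (f y * moll_vec r (y - x)) \<le> ennreal (f x * moll_vec r (y - x) + \<delta>
        * moll_vec r (y - x))"
      by (rule ennreal_leI)
    also have "\<dots> = ennreal (f x * moll_vec r (y - x)) + ennreal (\<delta> * moll_vec r (y - x))"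
      using f0 \<delta> nn by (intro ennreal_plus mult_nonneg_nonneg)
    also have "ennreal (\<delta> * moll_vec r (y - x)) = ennreal \<delta> * ennreal (moll_vec r (y - x))"
      by (rule ennreal_mult[OF \<delta> nn])
    finally show "ennreal (f y) * ennreal (moll_vec r (y - x)) \<le> ennreal (f x * moll_vec r (y - x))
        + ennreal \<delta> * ennreal (moll_vec r (y - x))"
      by (simp only: ennreal_mult[OF f0 nn, symmetric])
  qed
  also have "\<dots> = (\<integral>\<^sup>+ x. ennreal (f x * moll_vec r (y - x)) \<partial>lborel)
      + (\<integral>\<^sup>+ x. ennreal \<delta> * ennreal (moll_vec r (y - x)) \<partial>lborel)"
    by (rule nn_integral_add) measurable
  finally show "ennreal (f y) \<le> (\<integral>\<^sup>+ x. ennreal (f x * moll_vec r (y - x)) \<partial>lborel) + ennreal \<delta>"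
      unfolding nnm .
qed

text \<open>By Fubini, testing the smoothed density against f is testing the occupation measure
  against the mollified f, which is within \<delta> of f.\<close>

lemma smoothed_occupation_test_integral:
  fixes X :: "real ^ 'n \<Rightarrow> real ^ 'd" and a h t :: "real ^ 'n" and f :: "real ^ 'd \<Rightarrow> real"
  assumes X: "X \<in> borel_measurable (restrict_space borel (cbox a (a + h)))" and t: "t \<in> cbox 0 h"
    and f_meas [measurable]: "f \<in> borel_measurable borel" and f0: "\<And>x. 0 \<le> f x" and lip:
        "\<And>x y. \<bar>f x - f y\<bar> \<le> m * dist x y" and m: "0 \<le> m" and r: "0 < r"
  defines "\<delta> \<equiv> m * real CARD('d) / r" and "V \<equiv> emeasure lborel (cbox a (a + t))"
  shows "(\<integral>\<^sup>+ x. ennreal (f x) * ennreal (smoothed_occupation X a h r x t) \<partial>lborel)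
      \<le> (\<integral>\<^sup>+ y. ennreal (f y) \<partial>occupation_measure X (cbox a (a + t))) + ennreal \<delta> * V" (is "?L \<le> ?R + _")
    and "(\<integral>\<^sup>+ y. ennreal (f y) \<partial>occupation_measure X (cbox a (a + t)))
      \<le> (\<integral>\<^sup>+ x. ennreal (f x) * ennreal (smoothed_occupation X a h r x t) \<partial>lborel) + ennreal \<delta> * V"
proof -
  let ?\<nu> = "restrict_space lborel (cbox a (a + t))"
  interpret N: finite_measure ?\<nu> by (rule finite_measure_restrict_cbox)
  interpret PS: pair_sigma_finite "lborel :: (real ^ 'd) measure" ?\<nu> ..
  have \<delta>: "0 \<le> \<delta>" using m r by (simp add: \<delta>_def)
  have sub: "cbox a (a + t) \<subseteq> cbox a (a + h)" using t
      by (intro subset_box_cart_shift) (auto simp: mem_box_cart)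
  have [measurable]: "X \<in> borel_measurable (restrict_space lborel (cbox a (a + t)))"
    by (rule borel_measurable_restrict_subset(2)[OF X sub])
  have V: "emeasure ?\<nu> (cbox a (a + t)) = V" by (simp add: V_def emeasure_restrict_space)
  have R: "?R = (\<integral>\<^sup>+ s. ennreal (f (X s)) \<partial>?\<nu>)"
    unfolding occupation_measure_def by (subst nn_integral_distr) auto
  have "?L = (\<integral>\<^sup>+ x. \<integral>\<^sup>+ s. ennreal (f x * moll_vec r (X s - x)) \<partial>?\<nu> \<partial>lborel)"
  proof (intro nn_integral_cong)
    fix x
    have "ennreal (f x) * ennreal (smoothed_occupation X a h r x t)
        = (\<integral>\<^sup>+ s. ennreal (f x) * ennreal (moll_vec r (X s - x)) \<partial>?\<nu>)"
      unfolding ennreal_smoothed_occupation[OF X t less_imp_le[OF r]]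
          by (rule nn_integral_cmult[symmetric]) measurable
    then show "ennreal (f x) * ennreal (smoothed_occupation X a h r x t)
        = (\<integral>\<^sup>+ s. ennreal (f x * moll_vec r (X s - x)) \<partial>?\<nu>)"
      using f0 r by (simp add: ennreal_mult moll_vec_nonneg)
  qed
  also have "\<dots> = (\<integral>\<^sup>+ s. \<integral>\<^sup>+ x. ennreal (f x * moll_vec r (X s - x)) \<partial>lborel \<partial>?\<nu>)"
    by (rule PS.Fubini'[symmetric]) measurable
  finally have L: "?L = \<dots>" .
  have "?L \<le> (\<integral>\<^sup>+ s. ennreal (f (X s)) + ennreal \<delta> \<partial>?\<nu>)"
    unfolding L using moll_vec_lipschitz_integral(1)[OF f_meas f0 lip m r] f0 \<delta>
    by (intro nn_integral_mono) (simp add: \<delta>_def)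
  also have "\<dots> = ?R + ennreal \<delta> * V" unfolding R
      by (subst nn_integral_add) (auto simp: V space_restrict_space)
  finally show "?L \<le> ?R + ennreal \<delta> * V" .
  have "?R \<le> (\<integral>\<^sup>+ s. (\<integral>\<^sup>+ x. ennreal (f x * moll_vec r (X s - x)) \<partial>lborel) + ennreal \<delta> \<partial>?\<nu>)"
    unfolding R using moll_vec_lipschitz_integral(2)[OF f_meas f0 lip m r]
    by (intro nn_integral_mono) (simp add: \<delta>_def)
  also have "\<dots> = ?L + ennreal \<delta> * V"
    unfolding L by (subst nn_integral_add) (auto simp: V space_restrict_space intro!:
        lborel.borel_measurable_nn_integral)
  finally show "?R \<le> ?L + ennreal \<delta> * V" .
qed

text \<open>Lipschitz functions vanishing off a bounded open set have the same integral under both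
  measures, because convergence is uniform on that set and the smoothing error tends to 0. Such
  functions increase to the indicator of the set, and bounded open sets form an intersection-stable
  generator.\<close>

lemma occupation_measure_eq_density:
  fixes X :: "real ^ 'n \<Rightarrow> real ^ 'd" and a h t :: "real ^ 'n" and l :: "real ^ 'd \<Rightarrow> real"
  assumes X: "X \<in> borel_measurable (restrict_space borel (cbox a (a + h)))" and t: "t \<in> cbox 0 h"
    and l_meas [measurable]: "l \<in> borel_measurable borel" and l0: "\<And>x. 0 \<le> l x"
    and unif: "\<And>U e. bounded U \<Longrightarrow> 0 < e \<Longrightarrow>
      \<forall>\<^sub>F k in sequentially. \<forall>x\<in>U. \<bar>smoothed_occupation X a h (2 ^ k) x t - l x\<bar> \<le> e"
  shows "density lborel (\<lambda>x. ennreal (l x)) = occupation_measure X (cbox a (a + t))"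
proof -
  let ?N = "occupation_measure X (cbox a (a + t))"
  let ?D = "density lborel (\<lambda>x. ennreal (l x))"
  let ?L = "\<lambda>r x. smoothed_occupation X a h r x t"
  have sub: "cbox a (a + t) \<subseteq> cbox a (a + h)" using t
      by (intro subset_box_cart_shift) (auto simp: mem_box_cart)
  have [measurable]: "X \<in> borel_measurable (restrict_space lborel (cbox a (a + t)))"
    by (rule borel_measurable_restrict_subset(2)[OF X sub])
  interpret R: finite_measure "restrict_space lborel (cbox a (a + t))"
      by (rule finite_measure_restrict_cbox)
  interpret N: finite_measure ?N unfolding occupation_measure_def
      by (rule R.finite_measure_distr) measurable
  have sets_N [measurable_cong, simp]: "sets ?N = sets borel" by (simp add: occupation_measure_def)
  have test: "(\<integral>\<^sup>+ x. ennreal (f x) * ennreal (l x) \<partial>lborel) = (\<integral>\<^sup>+ y. ennreal (f y) \<partial>?N)"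
    if f_meas [measurable]: "f \<in> borel_measurable borel" and f: "\<And>x. 0 \<le> f x"
        "\<And>x. f x \<le> indicator U x" and lip: "\<And>x y. \<bar>f x - f y\<bar> \<le> m * dist x y" and m: "0 \<le> m"
      and U: "open U" "bounded U" for f :: "real ^ 'd \<Rightarrow> real" and U m
  proof -
    \<comment> \<open>Smoothing costs at most e times the volume of the box, and replacing the
      smoothed density by l on U costs at most e times the volume of U.\<close>
    define W where "W = measure lborel (cbox a (a + t)) + measure lborel U"
    have fin_U: "emeasure lborel U < \<infinity>" using U(2) by (rule emeasure_bounded_finite)
    have [measurable]: "U \<in> sets borel" using U by simp
    have key: "(\<integral>\<^sup>+ x. ennreal (f x) * ennreal (l x) \<partial>lborel) \<le> (\<integral>\<^sup>+ y. ennreal (f y) \<partial>?N)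
        + ennreal (e * W)"
        "(\<integral>\<^sup>+ y. ennreal (f y) \<partial>?N) \<le> (\<integral>\<^sup>+ x. ennreal (f x) * ennreal (l x) \<partial>lborel)
            + ennreal (e * W)" if e: "0 < e" for e
    proof -
      have "((\<lambda>k. m * real CARD('d) / 2 ^ k) \<longlongrightarrow> 0) sequentially"
        by (intro LIMSEQ_divide_realpow_zero) auto
      then have "\<forall>\<^sub>F k in sequentially. m * real CARD('d) / 2 ^ k < e" using e by (rule order_tendstoD)
      from eventually_happens[OF eventually_conj[OF this unif[OF U(2) e]]]
      obtain k where k: "m * real CARD('d) / 2 ^ k < e" "\<And>x. x \<in> U \<Longrightarrow> \<bar>?L (2 ^ k) x - l x\<bar> \<le> e" by auto
      let ?r = "2 ^ k :: real"
      have L_meas: "(\<lambda>x. ennreal (?L ?r x)) \<in> borel_measurable borel"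
        unfolding ennreal_smoothed_occupation[OF X t, of ?r, simplified]
        by (rule R.borel_measurable_nn_integral) measurable
      have eW: "ennreal e * emeasure lborel (cbox a (a + t)) + ennreal e * emeasure lborel U
          = ennreal (e * W)"
        using e fin_U emeasure_lborel_cbox_finite[of a "a + t"]
        by (simp add: W_def emeasure_eq_ennreal_measure less_top[symmetric] distrib_left flip:
            ennreal_mult ennreal_plus)
      have dV: "ennreal (m * real CARD('d) / ?r) * emeasure lborel (cbox a (a + t)) \<le> ennreal e
          * emeasure lborel (cbox a (a + t))"
        using k(1) by (intro mult_right_mono ennreal_leI) auto
      have shift: "(\<integral>\<^sup>+ x. ennreal (f x) * ennreal (p x) \<partial>lborel)
          \<le> (\<integral>\<^sup>+ x. ennreal (f x) * ennreal (p' x) \<partial>lborel) + ennreal e * emeasure lborel U"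
        if le: "\<And>x. x \<in> U \<Longrightarrow> ennreal (p x) \<le> ennreal (p' x) + ennreal e" and [measurable]:
            "(\<lambda>x. ennreal (p' x)) \<in> borel_measurable borel" for p p'
      proof -
        have "(\<integral>\<^sup>+ x. ennreal (f x) * ennreal (p x) \<partial>lborel) \<le> (\<integral>\<^sup>+ x. ennreal (f x) * ennreal (p' x)
            + ennreal e * indicator U x \<partial>lborel)"
        proof (intro nn_integral_mono)
          fix x
          show "ennreal (f x) * ennreal (p x) \<le> ennreal (f x) * ennreal (p' x) + ennreal e
              * indicator U x"
          proof (cases "x \<in> U")
            case True
            have "ennreal (f x) * ennreal (p x) \<le> ennreal (f x) * ennreal (p' x) + ennreal (f x)
                * ennreal e"
              using le[OF True] by (simp add: distrib_left[symmetric] mult_left_mono)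
            also have "\<dots> \<le> ennreal (f x) * ennreal (p' x) + 1 * ennreal e"
              using f(2)[of x] True by (intro add_left_mono mult_right_mono) (auto simp: ennreal_le_1)
            finally show ?thesis using True by simp
          next
            case False
            then have "f x = 0" using f[of x] by (simp add: indicator_def)
            then show ?thesis by simp
          qed
        qed
        also have "\<dots> = (\<integral>\<^sup>+ x. ennreal (f x) * ennreal (p' x) \<partial>lborel) + ennreal e * emeasure lborel U"
          by (subst nn_integral_add) (auto simp: nn_integral_cmult_indicator)
        finally show ?thesis .
      qed
      have le1: "ennreal (l x) \<le> ennreal (?L ?r x) + ennreal e" if "x \<in> U" for x
        using k(2)[OF that] e by (cases "0 \<le> ?L ?r x") (auto simp: ennreal_neg intro!: ennreal_leI
            simp flip: ennreal_plus)
      have le2: "ennreal (?L ?r x) \<le> ennreal (l x) + ennreal e" if "x \<in> U" for x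
        using k(2)[OF that] e l0[of x] by (auto intro!: ennreal_leI simp flip: ennreal_plus)
      have A: "(\<integral>\<^sup>+ x. ennreal (f x) * ennreal (l x) \<partial>lborel)
          \<le> (\<integral>\<^sup>+ x. ennreal (f x) * ennreal (?L ?r x) \<partial>lborel) + ennreal e * emeasure lborel U"
        by (rule shift[OF le1 L_meas])
      have B: "(\<integral>\<^sup>+ x. ennreal (f x) * ennreal (?L ?r x) \<partial>lborel)
          \<le> (\<integral>\<^sup>+ x. ennreal (f x) * ennreal (l x) \<partial>lborel) + ennreal e * emeasure lborel U"
        by (rule shift[OF le2]) measurable
      note T = smoothed_occupation_test_integral[OF X t f_meas f(1) lip m, of ?r]
      show "(\<integral>\<^sup>+ x. ennreal (f x) * ennreal (l x) \<partial>lborel) \<le> (\<integral>\<^sup>+ y. ennreal (f y) \<partial>?N) + ennreal (e * W)"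
        unfolding eW[symmetric] add.assoc[symmetric]
        using order_trans[OF A add_right_mono[OF order_trans[OF T(1) add_left_mono[OF dV]]]] by simp
      show "(\<integral>\<^sup>+ y. ennreal (f y) \<partial>?N) \<le> (\<integral>\<^sup>+ x. ennreal (f x) * ennreal (l x) \<partial>lborel) + ennreal (e * W)"
        unfolding eW[symmetric]
        using order_trans[OF T(2) add_mono[OF B dV]] by (simp add: add_ac)
    qed
    have W: "0 \<le> W" by (simp add: W_def)
    have eps: "p \<le> q" if "\<And>e. 0 < e \<Longrightarrow> p \<le> q + ennreal (e * W)" for p q :: ennreal
    proof (rule ennreal_le_epsilon)
      fix e :: real assume e: "0 < e"
      have "e / (W + 1) * W \<le> e" using e W by (simp add: field_simps)
      then have "q + ennreal (e / (W + 1) * W) \<le> q + ennreal e" by (intro add_left_mono ennreal_leI)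
      then show "p \<le> q + ennreal e" using that[of "e / (W + 1)"] e W by (auto intro: order_trans)
    qed
    show ?thesis
    proof (rule antisym)
      show "(\<integral>\<^sup>+ x. ennreal (f x) * ennreal (l x) \<partial>lborel) \<le> (\<integral>\<^sup>+ y. ennreal (f y) \<partial>?N)"
        by (rule eps, rule key(1))
      show "(\<integral>\<^sup>+ y. ennreal (f y) \<partial>?N) \<le> (\<integral>\<^sup>+ x. ennreal (f x) * ennreal (l x) \<partial>lborel)"
        by (rule eps, rule key(2))
    qed
  qed
  have eq_open: "emeasure ?D U = emeasure ?N U" if U: "open U" "bounded U" for U
  proof (cases "U = {}")
    case False
    have [measurable]: "U \<in> sets borel" using U by simp
    \<comment> \<open>\<open>infdist\<close> to the empty set is 0 by default, so the complement of
      U has to be nonempty for the approximating functions to be the intended ones.\<close>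
    have "U \<noteq> UNIV" using U(2) not_bounded_UNIV by auto
    then have ne: "- U \<noteq> {}" by auto
    define f where "f m x = min 1 (real m * infdist x (- U))" for m x
    have f_meas [measurable]: "f m \<in> borel_measurable borel" for m
      unfolding f_def by (intro borel_measurable_continuous_onI continuous_intros)
    have f0: "0 \<le> f m x" for m x by (simp add: f_def infdist_nonneg)
    have f_le: "f m x \<le> indicator U x" for m x
      by (auto simp: f_def indicator_def)
    have lip: "\<bar>f m x - f m y\<bar> \<le> real m * dist x y" for m x y
    proof -
      have "\<bar>f m x - f m y\<bar> \<le> \<bar>real m * infdist x (- U) - real m * infdist y (- U)\<bar>"
        unfolding f_def by (auto simp: min_def)
      also have "\<dots> = real m * \<bar>infdist x (- U) - infdist y (- U)\<bar>"
          by (simp add: abs_mult flip: right_diff_distrib)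
      also have "\<dots> \<le> real m * dist x y" by (intro mult_left_mono infdist_lipschitz) auto
      finally show ?thesis .
    qed
    have mono: "incseq (\<lambda>m. f m x)" for x
      by (auto simp: incseq_def f_def infdist_nonneg min_le_iff_disj intro!: mult_right_mono)
    have lim: "(\<lambda>m. f m x) \<longlonglongrightarrow> indicator U x" for x
    proof (cases "x \<in> U")
      case True
      have "infdist x (- U) \<noteq> 0"
        using in_closed_iff_infdist_zero[of "- U" x] U ne True by auto
      then have pos: "0 < infdist x (- U)" using infdist_nonneg[of x "- U"] by linarith
      obtain m0 :: nat where m0: "1 / infdist x (- U) < real m0" using reals_Archimedean2 by blast
      have "\<forall>\<^sub>F m in sequentially. f m x = 1"
        using eventually_ge_at_top[of m0]
      proof eventually_elim
        case (elim m)
        have "1 < real m0 * infdist x (- U)" using m0 pos by (simp add: divide_less_eq)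
        also have "\<dots> \<le> real m * infdist x (- U)" using elim pos by (intro mult_right_mono) auto
        finally show ?case by (simp add: f_def)
      qed
      then show ?thesis using True by (simp add: tendsto_eventually)
    next
      case False
      then show ?thesis by (simp add: f_def)
    qed
    have lim1: "(\<lambda>m. \<integral>\<^sup>+ x. ennreal (f m x) \<partial>?N) \<longlonglongrightarrow> (\<integral>\<^sup>+ x. ennreal (indicator U x) \<partial>?N)"
      using mono lim by (intro nn_integral_LIMSEQ) (auto simp: incseq_def le_fun_def intro!:
          ennreal_leI tendsto_ennrealI)
    have lim2: "(\<lambda>m. \<integral>\<^sup>+ x. ennreal (f m x) \<partial>?D) \<longlonglongrightarrow> (\<integral>\<^sup>+ x. ennreal (indicator U x) \<partial>?D)"
      using mono lim by (intro nn_integral_LIMSEQ) (auto simp: incseq_def le_fun_def intro!: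
          ennreal_leI tendsto_ennrealI)
    have "(\<integral>\<^sup>+ x. ennreal (f m x) \<partial>?D) = (\<integral>\<^sup>+ x. ennreal (f m x) \<partial>?N)" for m
      using test[OF f_meas f0 f_le lip _ U, of m] by (simp add: nn_integral_density mult.commute)
    then have "(\<integral>\<^sup>+ x. ennreal (indicator U x) \<partial>?D) = (\<integral>\<^sup>+ x. ennreal (indicator U x) \<partial>?N)"
      using lim1 lim2 by (simp add: LIMSEQ_unique)
    then show ?thesis by (simp add: ennreal_indicator)
  qed simp
  let ?E = "{U :: (real ^ 'd) set. open U \<and> bounded U}"
  have sets_E: "sigma_sets UNIV ?E = sets borel"
  proof
    have "sets borel = sigma_sets UNIV (range (\<lambda>(a, b). box a b :: (real ^ 'd) set))"
      unfolding borel_eq_box by simp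
    also have "\<dots> \<subseteq> sigma_sets UNIV ?E"
      by (intro sigma_sets_mono') auto
    finally show "sets borel \<subseteq> sigma_sets UNIV ?E" .
    show "sigma_sets UNIV ?E \<subseteq> sets borel"
      by (rule sets.sigma_sets_subset[of ?E borel, unfolded space_borel]) (auto intro: borel_open)
  qed
  show ?thesis
  proof (rule measure_eqI_generator_eq[where E = ?E and \<Omega> = UNIV and A = "\<lambda>n. ball 0 (real n)"])
    show "Int_stable ?E" by (auto simp: Int_stable_def)
    show "(\<Union>n. ball 0 (real n)) = (UNIV :: (real ^ 'd) set)"
      using reals_Archimedean2 by (auto simp: dist_norm)
    show "emeasure ?D (ball 0 (real n)) \<noteq> \<infinity>" for n
      by (simp add: eq_open)
    show "emeasure ?D U = emeasure ?N U" if "U \<in> ?E" for U using eq_open that by auto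
  qed (auto simp: sets_E)
qed

text \<open>Weierstrass M-test for the telescoping series on each cube of radius R. Continuity is a
  local matter and every x is interior to some cube, so uniformity on cubes is enough.\<close>

lemma jointly_continuous_local_timeI:
  fixes X :: "real ^ 'n \<Rightarrow> real ^ 'd" and a h :: "real ^ 'n"
  assumes X: "X \<in> borel_measurable (restrict_space borel (cbox a (a + h)))" and h: "\<And>l. 0 < h $ l"
    and bound: "\<And>R :: nat. \<exists>M. summable M \<and> (\<forall>k x t. (\<forall>i. \<bar>x $ i\<bar> \<le> real R) \<longrightarrow> t \<in> cbox 0 h \<longrightarrow>
      \<bar>smoothed_occupation X a h (2 ^ Suc k) x t - smoothed_occupation X a h (2 ^ k) x t\<bar> \<le> M k)"
  shows "jointly_continuous_local_time X (cbox a (a + h))"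
proof -
  define Lk where "Lk k p = smoothed_occupation X a h (2 ^ k) (fst p) (snd p)" for k p
  define S where "S R = {x :: real ^ 'd. \<forall>i. \<bar>x $ i\<bar> \<le> real R} \<times> cbox 0 h" for R :: nat
  \<comment> \<open>The pointwise limit gives one function for all R; on each \<open>S R\<close> it
    is the sum of the telescoping series.\<close>
  define L where "L p = lim (\<lambda>k. Lk k p)" for p
  have unif: "uniform_limit (S R) Lk L sequentially" for R
  proof -
    obtain M where M: "summable M" "\<And>k x t. (\<forall>i. \<bar>x $ i\<bar> \<le> real R) \<Longrightarrow> t \<in> cbox 0 h \<Longrightarrow>
        \<bar>smoothed_occupation X a h (2 ^ Suc k) x t - smoothed_occupation X a h (2 ^ k) x t\<bar> \<le> M k"
      using bound[of R] by blast
    have "uniform_limit (S R) (\<lambda>n p. \<Sum>i<n. Lk (Suc i) p - Lk i p) (\<lambda>p. \<Sum>i. Lk (Suc i) p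
        - Lk i p) sequentially"
      using M(2) by (intro Weierstrass_m_test[OF _ M(1)]) (auto simp: S_def Lk_def)
    then have "uniform_limit (S R) (\<lambda>n p. Lk 0 p + (\<Sum>i<n. Lk (Suc i) p - Lk i p)) (\<lambda>p. Lk 0 p
        + (\<Sum>i. Lk (Suc i) p - Lk i p)) sequentially"
      by (intro uniform_limit_add uniform_limit_const)
    moreover have "Lk 0 p + (\<Sum>i<n. Lk (Suc i) p - Lk i p) = Lk n p" for n p
      using sum_lessThan_telescope[of "\<lambda>i. Lk i p" n] by simp
    ultimately have *: "uniform_limit (S R) Lk (\<lambda>p. Lk 0 p + (\<Sum>i. Lk (Suc i) p - Lk i p)) sequentially"
      by simp
    have "L p = Lk 0 p + (\<Sum>i. Lk (Suc i) p - Lk i p)" if "p \<in> S R" for p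
      unfolding L_def using tendsto_uniform_limitI[OF * that] by (rule limI)
    then show ?thesis using * by (simp cong: uniform_limit_cong')
  qed
  have r1: "(1::real) \<le> 2 ^ k" for k by simp
  have cont_Lk: "continuous_on (UNIV \<times> cbox 0 h) (Lk k)" for k
    using continuous_on_smoothed_occupation[OF X h r1[of k]]
        by (simp add: Lk_def[abs_def] case_prod_beta)
  have cont_S: "continuous_on (S R) L" for R
  proof (rule uniform_limit_theorem[OF _ unif])
    show "\<forall>\<^sub>F k in sequentially. continuous_on (S R) (Lk k)"
      by (intro always_eventually allI continuous_on_subset[OF cont_Lk]) (auto simp: S_def)
  qed simp
  have comp: "\<bar>x $ i\<bar> \<le> norm x" for x :: "real ^ 'd" and i by (rule component_le_norm_cart)
  have cont: "continuous_on (UNIV \<times> cbox 0 h) L"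
    unfolding continuous_on_def
  proof
    fix p :: "(real ^ 'd) \<times> (real ^ 'n)" assume p: "p \<in> UNIV \<times> cbox 0 h"
    obtain R :: nat where R: "norm (fst p) < real R" using reals_Archimedean2 by blast
    have in_S: "q \<in> S R" if "norm (fst q) < real R" "q \<in> UNIV \<times> cbox 0 h" for q
    proof -
      have "\<bar>fst q $ i\<bar> \<le> real R" for i using comp[of "fst q" i] that(1) by linarith
      then show ?thesis using that(2) by (auto simp: S_def mem_Times_iff)
    qed
    have "at p within UNIV \<times> cbox 0 h = at p within S R"
    proof (rule at_within_nhd)
      show "p \<in> ball 0 (real R) \<times> UNIV" using R by (simp add: mem_Times_iff)
      show "open (ball 0 (real R) \<times> (UNIV :: (real ^ 'n) set) :: ((real ^ 'd) \<times> (real ^ 'n)) set)"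
        by (intro open_Times) auto
      show "UNIV \<times> cbox 0 h \<inter> ball 0 (real R) \<times> UNIV - {p} = S R \<inter> ball 0 (real R) \<times> UNIV - {p}"
        using in_S by (auto simp: S_def)
    qed
    moreover have "(L \<longlongrightarrow> L p) (at p within S R)"
      using cont_S[of R] in_S[OF R p] by (simp add: continuous_on_def)
    ultimately show "(L \<longlongrightarrow> L p) (at p within UNIV \<times> cbox 0 h)" by simp
  qed
  have L_nonneg: "0 \<le> L (x, t)" if t: "t \<in> cbox 0 h" for x t
  proof -
    obtain R :: nat where R: "norm x < real R" using reals_Archimedean2 by blast
    have "\<bar>x $ i\<bar> \<le> real R" for i using comp[of x i] R by linarith
    then have "(x, t) \<in> S R" using t by (simp add: S_def)
    from tendsto_uniform_limitI[OF unif this] show ?thesis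
    proof (rule LIMSEQ_le_const)
      have "0 \<le> Lk k (x, t)" for k
        unfolding Lk_def smoothed_occupation_def
        by (intro Bochner_Integration.integral_nonneg mult_nonneg_nonneg moll_vec_nonneg) auto
      then show "\<exists>N. \<forall>k\<ge>N. 0 \<le> Lk k (x, t)" by blast
    qed
  qed
  have local_time: "is_local_time X (cbox a (a + t)) (\<lambda>x. L (x, t))" if t: "t \<in> cbox 0 h" for t
  proof -
    have cont_t: "continuous_on UNIV (\<lambda>x. L (x, t))"
      using t by (intro continuous_on_compose2[OF cont, of UNIV "\<lambda>x. (x, t)"] continuous_intros) auto
    then have meas: "(\<lambda>x. L (x, t)) \<in> borel_measurable borel"
      by (rule borel_measurable_continuous_onI)
    have dens: "density lborel (\<lambda>x. ennreal (L (x, t))) = occupation_measure X (cbox a (a + t))"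
    proof (rule occupation_measure_eq_density[OF X t meas L_nonneg[OF t]])
      fix U :: "(real ^ 'd) set" and e :: real assume U: "bounded U" and e: "0 < e"
      obtain b where b: "\<And>x. x \<in> U \<Longrightarrow> norm x \<le> b" using U by (auto simp: bounded_iff)
      obtain R :: nat where R: "b < real R" using reals_Archimedean2 by blast
      have in_S: "(x, t) \<in> S R" if "x \<in> U" for x
      proof -
        have "\<bar>x $ i\<bar> \<le> real R" for i using comp[of x i] b[OF that] R by linarith
        then show ?thesis using t by (simp add: S_def)
      qed
      from uniform_limitD[OF unif[of R] e]
      show "\<forall>\<^sub>F k in sequentially. \<forall>x\<in>U. \<bar>smoothed_occupation X a h (2 ^ k) x t - L (x, t)\<bar> \<le> e"
      proof eventually_elim
        case (elim k)
        show ?case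
        proof
          fix x assume "x \<in> U"
          then have "dist (Lk k (x, t)) (L (x, t)) < e" using elim in_S by blast
          then show "\<bar>smoothed_occupation X a h (2 ^ k) x t - L (x, t)\<bar> \<le> e"
              by (simp add: Lk_def dist_real_def)
        qed
      qed
    qed
    have ac: "absolutely_continuous lborel (occupation_measure X (cbox a (a + t)))"
      unfolding dens[symmetric] using meas by (intro absolutely_continuousI_density) simp
    have sub: "cbox a (a + t) \<subseteq> cbox a (a + h)" using t
        by (intro subset_box_cart_shift) (auto simp: mem_box_cart)
    note X' = borel_measurable_restrict_subset(1)[OF X sub]
    have "AE x in lborel. ennreal (L (x, t)) = RN_deriv lborel (occupation_measure X (cbox a (a + t))) x"
      using meas dens by (intro sigma_finite_measure.RN_deriv_unique[OF sigma_finite_lborel]) auto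
    then show ?thesis
      using ac X' meas L_nonneg[OF t] by (simp add: is_local_time_def has_local_times_def)
  qed
  show ?thesis
    unfolding jointly_continuous_local_time_def
  proof (intro exI conjI ballI allI)
    show "0 < h $ i" for i by (rule h)
    show "is_local_time X (cbox a (a + t)) (\<lambda>x. (\<lambda>x t. L (x, t)) x t)" if "t \<in> cbox 0 h" for t
      using local_time[OF that] by simp
    show "continuous_on (UNIV \<times> cbox 0 h) (\<lambda>(x, t). (\<lambda>x t. L (x, t)) x t)"
      using cont by simp
  qed simp
qed

section \<open>Almost sure convergence\<close>

text \<open>The net consists of \<open>m + 1\<close> equally spaced values per coordinate, endpoints
  included. Degenerate sides are allowed because the cube of radius R is a point for
  \<open>R = 0\<close>.\<close>

lemma finite_net_cbox:
  fixes u v :: "real ^ 'm"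
  assumes m: "0 < (m :: nat)" and uv: "\<And>i. u $ i \<le> v $ i"
  shows "\<exists>G. finite G \<and> G \<subseteq> cbox u v \<and> card G \<le> (m + 1) ^ CARD('m) \<and>
    (\<forall>p\<in>cbox u v. \<exists>q\<in>G. \<forall>i. \<bar>p $ i - q $ i\<bar> \<le> (v $ i - u $ i) / real m)"
proof -
  define f where "f z = (\<chi> i. u $ i + (v $ i - u $ i) * (real (z i) / real m))" for z :: "'m \<Rightarrow> nat"
  define Z where "Z = (UNIV :: 'm set) \<rightarrow>\<^sub>E {0..m}"
  have fin: "finite Z" unfolding Z_def by (intro finite_PiE) auto
  have "card (f ` Z) \<le> card Z" by (rule card_image_le[OF fin])
  also have "card Z = (m + 1) ^ CARD('m)" by (simp add: Z_def card_PiE)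
  finally have card: "card (f ` Z) \<le> (m + 1) ^ CARD('m)" .
  have sub: "f ` Z \<subseteq> cbox u v"
  proof (clarsimp simp: mem_box_cart f_def)
    fix z i assume "z \<in> Z"
    then have "z i \<le> m" by (auto simp: Z_def PiE_iff)
    then have "0 \<le> real (z i) / real m" "real (z i) / real m \<le> 1" using m by auto
    then have "0 \<le> (v $ i - u $ i) * (real (z i) / real m)" and "(v $ i - u $ i)
        * (real (z i) / real m) \<le> (v $ i - u $ i) * 1"
      using uv[of i] by (intro mult_nonneg_nonneg mult_left_mono; simp)+
    then show "0 \<le> (v $ i - u $ i) * real (z i) / real m \<and> u $ i + (v $ i - u $ i)
        * real (z i) / real m \<le> v $ i" by simp
  qed
  have "\<exists>q\<in>f ` Z. \<forall>i. \<bar>p $ i - q $ i\<bar> \<le> (v $ i - u $ i) / real m" if p: "p \<in> cbox u v" for p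
  proof -
    \<comment> \<open>For a degenerate side the quotient is 0 by default, which still represents p
      correctly.\<close>
    define \<theta> where "\<theta> i = (p $ i - u $ i) / (v $ i - u $ i)" for i
    have b: "u $ i \<le> p $ i" "p $ i \<le> v $ i" for i using p by (auto simp: mem_box_cart)
    have \<theta>: "0 \<le> \<theta> i" "\<theta> i \<le> 1" "p $ i = u $ i + (v $ i - u $ i) * \<theta> i" for i
      using b[of i] by (auto simp: \<theta>_def divide_le_eq_1)
    define z where "z i = nat \<lfloor>\<theta> i * real m\<rfloor>" for i
    have z: "real (z i) \<le> \<theta> i * real m" "\<theta> i * real m \<le> real (z i) + 1" for i
      using \<theta>[of i] by (auto simp: z_def)
    have "z i \<le> m" for i
    proof -
      have "\<theta> i * real m \<le> 1 * real m" using \<theta>[of i] by (intro mult_right_mono) auto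
      then have "real (z i) \<le> real m" using z(1)[of i] by linarith
      then show ?thesis by simp
    qed
    then have zZ: "z \<in> Z" by (auto simp: Z_def)
    have "\<bar>p $ i - f z $ i\<bar> \<le> (v $ i - u $ i) / real m" for i
    proof -
      have "\<bar>\<theta> i - real (z i) / real m\<bar> \<le> 1 / real m"
      proof -
        have "\<theta> i - real (z i) / real m = (\<theta> i * real m - real (z i)) / real m" using m
            by (simp add: field_simps)
        moreover have "\<bar>\<theta> i * real m - real (z i)\<bar> \<le> 1" using z[of i] by linarith
        ultimately show ?thesis by (simp add: divide_right_mono)
      qed
      then have "(v $ i - u $ i) * \<bar>\<theta> i - real (z i) / real m\<bar> \<le> (v $ i - u $ i) * (1 / real m)"
        using uv[of i] by (intro mult_left_mono) auto
      moreover have "p $ i - f z $ i = (v $ i - u $ i) * (\<theta> i - real (z i) / real m)"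
        unfolding \<theta>(3)[of i] by (simp add: f_def right_diff_distrib)
      ultimately show ?thesis using uv[of i] by (simp add: abs_mult)
    qed
    then show ?thesis using zZ by blast
  qed
  then show ?thesis using fin card sub by (intro exI[of _ "f ` Z"]) auto
qed

section \<open>Increments between consecutive scales\<close>

definition increment_kernel :: "real \<Rightarrow> 'd set \<Rightarrow> 'd \<Rightarrow> real \<Rightarrow> real" where
  "increment_kernel r S i = (if i \<in> S then (\<lambda>y. moll (2 * r) y - moll r y) else moll r)"

text \<open>The difference of two product mollifiers is not a product over the coordinates, but each
  term of \<open>moll_vec_double\<close> is, as the use of independence demands.\<close>

definition increment_part ::
    "(real ^ 'n \<Rightarrow> real ^ 'd) \<Rightarrow> real ^ 'n \<Rightarrow> real ^ 'n \<Rightarrow> real \<Rightarrow> 'd set \<Rightarrow> real ^ 'd \<Rightarrow> real ^ 'n \<Rightarrow> real"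
        where
  "increment_part X a h r S x t = (LINT s|restrict_space lborel (cbox a (a + h)).
     indicator (cbox a (a + t)) s * (\<Prod>i\<in>UNIV. increment_kernel r S i (X s $ i - x $ i)))"

lemma smoothed_occupation_double:
  fixes X :: "real ^ 'n \<Rightarrow> real ^ 'd" and a h :: "real ^ 'n"
  assumes X: "X \<in> borel_measurable (restrict_space borel (cbox a (a + h)))" and r: "0 < r"
  shows "smoothed_occupation X a h (2 * r) x t - smoothed_occupation X a h r x t
    = (\<Sum>S\<in>Pow UNIV - {{}}. increment_part X a h r S x t)"
proof -
  let ?P = "\<lambda>S s. \<Prod>i\<in>(UNIV :: 'd set). increment_kernel r S i (X s $ i - x $ i)"
  let ?\<mu> = "restrict_space lborel (cbox a (a + h))"
  interpret finite_measure ?\<mu> by (rule finite_measure_restrict_cbox)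
  have X' [measurable]: "X \<in> borel_measurable ?\<mu>"
    by (rule borel_measurable_restrict_subset(2)[OF X order_refl])
  have X_nth: "(\<lambda>s. X s $ i) \<in> borel_measurable ?\<mu>" for i
    by (rule measurable_compose[OF X']) simp
  have [measurable]: "(indicator (cbox a v) :: _ \<Rightarrow> real) \<in> borel_measurable ?\<mu>" for v
    by (intro measurable_restrict_space1) auto
  have k_meas [measurable]: "increment_kernel r S i \<in> borel_measurable borel" for S :: "'d set" and i
    by (auto simp: increment_kernel_def)
  have [measurable]: "(\<lambda>s. increment_kernel r S i (X s $ i - x $ i)) \<in> borel_measurable ?\<mu>" for S i
    by (rule measurable_compose[OF borel_measurable_diff[OF X_nth borel_measurable_const] k_meas])
  have k_bound: "\<bar>increment_kernel r S i y\<bar> \<le> 2 * r" for S :: "'d set" and i y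
    using r moll_nonneg[of r y] moll_nonneg[of "2 * r" y] moll_le[of r y] moll_le[of "2 * r" y]
    by (auto simp: increment_kernel_def abs_le_iff)
  have int: "integrable ?\<mu> (\<lambda>s. indicator (cbox a (a + t)) s * ?P S s)" for S
  proof (rule integrable_const_bound)
    show "AE s in ?\<mu>. norm (indicator (cbox a (a + t)) s * ?P S s) \<le> (2 * r) ^ CARD('d)"
    proof (intro AE_I2)
      fix s
      have "norm (indicator (cbox a (a + t)) s * ?P S s) \<le> 1
          * (\<Prod>i\<in>(UNIV :: 'd set). \<bar>increment_kernel r S i (X s $ i - x $ i)\<bar>)"
        unfolding norm_mult by (intro mult_mono) (auto simp: abs_prod indicator_def intro: prod_nonneg)
      also have "\<dots> \<le> 1 * (\<Prod>i\<in>(UNIV :: 'd set). 2 * r)"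
        using k_bound by (intro mult_left_mono prod_mono) auto
      finally show "norm (indicator (cbox a (a + t)) s * ?P S s) \<le> (2 * r) ^ CARD('d)" by simp
    qed
  qed measurable
  have int1: "integrable ?\<mu> (\<lambda>s. indicator (cbox a (a + t)) s * moll_vec r' (X s - x))" if "0 \<le> r'"
      for r'
  proof (rule integrable_const_bound)
    show "AE s in ?\<mu>. norm (indicator (cbox a (a + t)) s * moll_vec r' (X s - x)) \<le> r' ^ CARD('d)"
    proof (intro AE_I2)
      fix s
      show "norm (indicator (cbox a (a + t)) s * moll_vec r' (X s - x)) \<le> r' ^ CARD('d)"
        using moll_vec_le[OF that, of "X s - x"] moll_vec_nonneg[OF that, of "X s - x"] that
            by (auto simp: indicator_def)
    qed
  qed measurable
  have "smoothed_occupation X a h (2 * r) x t - smoothed_occupation X a h r x t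
     = (LINT s|?\<mu>. indicator (cbox a (a + t)) s * moll_vec (2 * r) (X s - x)
         - indicator (cbox a (a + t)) s * moll_vec r (X s - x))"
    unfolding smoothed_occupation_def using r by (intro Bochner_Integration.integral_diff[symmetric]
        int1) auto
  also have "\<dots> = (LINT s|?\<mu>. (\<Sum>S\<in>Pow UNIV - {{}}. indicator (cbox a (a + t)) s * ?P S s))"
  proof (intro Bochner_Integration.integral_cong refl)
    fix s
    have "indicator (cbox a (a + t)) s * moll_vec (2 * r) (X s - x) - indicator (cbox a (a + t)) s
        * moll_vec r (X s - x)
      = indicator (cbox a (a + t)) s * (moll_vec (2 * r) (X s - x) - moll_vec r (X s - x))"
          by (rule right_diff_distrib[symmetric])
    also have "moll_vec (2 * r) (X s - x) - moll_vec r (X s - x)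
        = (\<Sum>S\<in>Pow UNIV - {{}}. \<Prod>i\<in>UNIV. increment_kernel r S i (X s $ i - x $ i))"
      unfolding moll_vec_double by (intro sum.cong prod.cong refl) (auto simp: increment_kernel_def)
    finally show "indicator (cbox a (a + t)) s * moll_vec (2 * r) (X s - x)
        - indicator (cbox a (a + t)) s * moll_vec r (X s - x)
      = (\<Sum>S\<in>Pow UNIV - {{}}. indicator (cbox a (a + t)) s * ?P S s)"
      by (simp only: sum_distrib_left)
  qed
  also have "\<dots> = (\<Sum>S\<in>Pow UNIV - {{}}. increment_part X a h r S x t)"
    unfolding increment_part_def by (intro Bochner_Integration.integral_sum int)
  finally show ?thesis .
qed

lemma (in prob_space) fbs_increment_part_moment:
  fixes H :: "real ^ 'n" and B :: "real ^ 'n \<Rightarrow> 'a \<Rightarrow> real ^ 'd" and a h t :: "real ^ 'n" and l0 :: 'n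
      and x :: "real ^ 'd"
  assumes H: "\<And>l. 0 < H $ l" "\<And>l. H $ l < 1" and \<alpha>: "0 < \<alpha>" "\<alpha> \<le> 1" "\<And>l. \<alpha> \<le> a $ l" and \<gamma>: "0 < \<gamma>"
      "\<gamma> \<le> 1"
    and B: "fractional_brownian_sheet M H B"
    and B_meas: "(\<lambda>(t, w). B t w) \<in> borel_measurable (restrict_space borel orthant \<Otimes>\<^sub>M M)"
    and n: "even n" and r: "1 \<le> r" and S: "S \<noteq> {}"
    and \<eta>: "real CARD('d) / (\<Sum>l\<in>UNIV. 1 / H $ l) + 2 * \<gamma> * real CARD('d) = \<eta>"
  shows "(\<lambda>w. increment_part (\<lambda>s. B s w) a h r S x t) \<in> borel_measurable M"
    and "(\<integral>\<^sup>+ w. ennreal (increment_part (\<lambda>s. B s w) a h r S x t ^ n) \<partial>M) \<le>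
      ennreal ((1 / cos_const (1/2)) ^ (CARD('d) * n) * (r powr (- \<gamma>)) ^ n) *
      (ennreal (past_weight_const H \<alpha> \<gamma> CARD('d) n)
          * (\<integral>\<^sup>+ s. past_weight \<eta> l0 {..<n} s \<partial>(Pi\<^sub>M {..<n} (\<lambda>_. restrict_space lborel (cbox a (a
          + h))))))"
    (is "_ \<le> _ * ?K")
proof -
  define c where "c = 1 / cos_const (1/2)"
  have c: "0 < c" unfolding c_def using cos_const_pos[of "1/2"] by simp
  define \<rho> where "\<rho> = r powr (- \<gamma>)"
  have \<rho>: "0 \<le> \<rho>" "\<rho> \<le> 1"
    unfolding \<rho>_def using powr_mono[of "- \<gamma>" 0 r] r \<gamma> by auto
  define A where "A i = (if i \<in> S then \<rho> * c else c)" for i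
  have k: "fourier_kernel \<gamma> (A i) (increment_kernel r S i)" for i
    using fourier_kernel_moll[of r \<gamma>] fourier_kernel_moll_diff[of r \<gamma>] r \<gamma>
    by (auto simp: A_def increment_kernel_def c_def \<rho>_def)
  note moment = fbs_integral_moment_le[where b = "a + h" and g = "indicator (cbox a (a + t))" and x = x,
      OF H \<alpha> \<gamma> B B_meas k n, unfolded \<eta>]
  show "(\<lambda>w. increment_part (\<lambda>s. B s w) a h r S x t) \<in> borel_measurable M"
    unfolding increment_part_def by (rule moment(1)) auto
  have "(\<integral>\<^sup>+ w. ennreal (increment_part (\<lambda>s. B s w) a h r S x t ^ n) \<partial>M) \<le> ennreal (\<Prod>i\<in>UNIV. A i ^ n) *
      ?K"
    unfolding increment_part_def by (rule moment(2)) auto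
  also have "\<dots> \<le> ennreal (c ^ (CARD('d) * n) * \<rho> ^ n) *
      ?K"
  proof (intro mult_right_mono ennreal_leI)
    \<comment> \<open>One coordinate in S supplies the decay; the factors of the others are at most
      1 and are given away.\<close>
    obtain i0 where i0: "i0 \<in> S" using S by blast
    have "(\<Prod>i\<in>UNIV. A i ^ n) = (\<Prod>i\<in>UNIV. c ^ n * (if i \<in> S then \<rho> ^ n else 1))"
      by (intro prod.cong) (auto simp: A_def power_mult_distrib)
    also have "\<dots> = c ^ (CARD('d) * n) * (\<Prod>i\<in>UNIV. if i \<in> S then \<rho> ^ n else 1)"
      by (simp add: prod.distrib power_mult[symmetric] mult.commute)
    also have "(\<Prod>i\<in>UNIV. if i \<in> S then \<rho> ^ n else 1) = \<rho> ^ n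
        * (\<Prod>i\<in>UNIV - {i0}. if i \<in> S then \<rho> ^ n else 1)"
      using i0 by (subst prod.remove[of _ i0]) auto
    also have "c ^ (CARD('d) * n) * \<dots> \<le> c ^ (CARD('d) * n) * (\<rho> ^ n * 1)"
      using c \<rho> by (intro mult_left_mono prod_le_1) (auto simp: power_le_one)
    finally show "(\<Prod>i\<in>UNIV. A i ^ n) \<le> c ^ (CARD('d) * n) * \<rho> ^ n" by simp
  qed auto
  finally show "(\<integral>\<^sup>+ w. ennreal (increment_part (\<lambda>s. B s w) a h r S x t ^ n) \<partial>M) \<le>
      ennreal ((1 / cos_const (1/2)) ^ (CARD('d) * n) * (r powr (- \<gamma>)) ^ n) *
      ?K"
    by (simp only: c_def \<rho>_def)
qed

text \<open>In place of Borel-Cantelli, the n-th powers of the increments, amplified by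
  \<open>\<beta> ^ k\<close>, are summed over all scales, grid points and parts. The sum has finite
  expectation, so it is almost surely finite and bounds each of its terms. Off the grid the
  Lipschitz estimate takes over.\<close>

lemma (in prob_space) AE_smoothed_occupation_increments_le:
  fixes H :: "real ^ 'n" and B :: "real ^ 'n \<Rightarrow> 'a \<Rightarrow> real ^ 'd" and a h :: "real ^ 'n" and R :: nat
  assumes H: "\<And>l. 0 < H $ l" "\<And>l. H $ l < 1" and \<alpha>: "0 < \<alpha>" "\<alpha> \<le> 1" "\<And>l. \<alpha> \<le> a $ l" and h:
      "\<And>l. 0 < h $ l"
    and B: "fractional_brownian_sheet M H B"
    and B_meas: "(\<lambda>(t, w). B t w) \<in> borel_measurable (restrict_space borel orthant \<Otimes>\<^sub>M M)"
    and X_meas: "\<And>w. w \<in> space M \<Longrightarrow> (\<lambda>s. B s w) \<in> borel_measurable (restrict_space borel (cbox a (a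
        + h)))"
    and dim: "real CARD('d) < (\<Sum>l\<in>UNIV. 1 / H $ l)"
  shows "AE w in M. \<exists>U. summable U \<and> (\<forall>k x t. (\<forall>i. \<bar>x $ i\<bar> \<le> real R) \<longrightarrow> t \<in> cbox 0 h \<longrightarrow>
      \<bar>smoothed_occupation (\<lambda>s. B s w) a h (2 ^ Suc k) x t
          - smoothed_occupation (\<lambda>s. B s w) a h (2 ^ k) x t\<bar> \<le> U k)"
proof -
  \<comment> \<open>Any coordinate can serve for ordering the points.\<close>
  define l0 :: 'n where "l0 = undefined"
  define d where "d = CARD('d)"
  define N where "N = CARD('n)"
  define \<nu> where "\<nu> = d + N"
  \<comment> \<open>At scale \<open>2 ^ k\<close> the grid has mesh of order
    \<open>2 ^ (- k * (d + 2))\<close>, which beats the Lipschitz constant of order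
    \<open>2 ^ (k * (d + 1))\<close> by a summable factor.\<close>
  define q where "q = d + 2"
  define T where "T = (\<Sum>l\<in>UNIV. 1 / H $ l)"
  \<comment> \<open>Chosen so that \<open>2 * \<gamma> * d\<close> is at most half of the gap
    \<open>1 - d / T\<close>, which leaves \<eta> below 1.\<close>
  define \<gamma> where "\<gamma> = min 1 ((1 - real d / T) / (4 * real d))"
  define \<eta> where "\<eta> = real d / T + 2 * \<gamma> * real d"
  have d: "0 < d" by (simp add: d_def)
  have T: "real d < T" using dim by (simp add: d_def T_def)
  have ratio: "real d / T < 1" "0 \<le> real d / T" using T d by auto
  have \<gamma>: "0 < \<gamma>" "\<gamma> \<le> 1" using ratio d by (auto simp: \<gamma>_def)
  have \<eta>: "0 \<le> \<eta>" "\<eta> < 1"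
  proof -
    show "0 \<le> \<eta>" using ratio \<gamma> by (simp add: \<eta>_def)
    have "2 * \<gamma> * real d \<le> 2 * ((1 - real d / T) / (4 * real d)) * real d"
      unfolding \<gamma>_def by (intro mult_right_mono mult_left_mono) auto
    also have "\<dots> = (1 - real d / T) / 2" using d by (simp add: field_simps)
    finally have "2 * \<gamma> * real d \<le> (1 - real d / T) / 2" .
    moreover have "x + y < 1" if "y \<le> (1 - x) / 2" "x < 1" for x y :: real using that by simp
    ultimately show "\<eta> < 1" unfolding \<eta>_def using ratio(1) by blast
  qed
  \<comment> \<open>The n-th moments decay like \<open>2 powr (- k * \<gamma> * n)\<close>. Half of
    this exponent pays for the order of \<open>2 ^ (k * q * \<nu>)\<close> grid points and for one
    more factor \<open>2 ^ k\<close> to make the sum converge; the other half is used up by the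
    amplification with \<beta>.\<close>
  define n where "n = 2 * nat \<lceil>real (q * \<nu> + 1) / \<gamma>\<rceil>"
  have n_even: "even n" by (simp add: n_def)
  have n_large: "real (q * \<nu> + 1) \<le> \<gamma> * real n / 2"
  proof -
    have "real (q * \<nu> + 1) / \<gamma> \<le> real n / 2" unfolding n_def by linarith
    then show ?thesis using \<gamma> by (simp add: field_simps)
  qed
  have n_pos: "0 < n"
  proof (rule ccontr)
    assume "\<not> 0 < n"
    then have "real (q * \<nu> + 1) \<le> 0" using n_large by simp
    then show False by (simp only: of_nat_le_0_iff)
  qed
  define c where "c = 1 / cos_const (1/2)"
  have c: "0 < c" unfolding c_def using cos_const_pos[of "1/2"] by simp
  define \<mu> where "\<mu> = restrict_space lborel (cbox a (a + h))"
  define K where "K = ennreal (past_weight_const H \<alpha> \<gamma> CARD('d) n)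
      * (\<integral>\<^sup>+ s. past_weight \<eta> l0 {..<n} s \<partial>(Pi\<^sub>M {..<n} (\<lambda>_. \<mu>)))"
  have K: "K < \<infinity>"
  proof -
    have "(\<integral>\<^sup>+ s. past_weight \<eta> l0 {..<n} s \<partial>(Pi\<^sub>M {..<n} (\<lambda>_. \<mu>))) < \<infinity>"
      unfolding \<mu>_def by (rule nn_integral_past_weight_finite[OF \<eta>]) simp
    then show ?thesis by (simp add: K_def ennreal_mult_less_top)
  qed
  define \<beta> where "\<beta> = 2 powr (\<gamma> / 2)"
  have \<beta>: "1 < \<beta>" unfolding \<beta>_def using \<gamma> by (intro gr_one_powr) auto

  define \<theta> :: "nat \<Rightarrow> nat" where "\<theta> k = 2 ^ (k * q)" for k
  define net1 where "net1 k G \<longleftrightarrow> finite G \<and> card G \<le> (\<theta> k + 1) ^ d \<and>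
    (\<forall>p\<in>cbox (\<chi> i. - real R) (\<chi> i. real R). \<exists>q\<in>G. \<forall>i. \<bar>p $ i - q $ i\<bar> \<le> 2 * real R / real (\<theta> k))"
    for k and G :: "(real ^ 'd) set"
  define net2 where "net2 k G \<longleftrightarrow> finite G \<and> G \<subseteq> cbox 0 h \<and> card G \<le> (\<theta> k + 1) ^ N \<and>
    (\<forall>p\<in>cbox 0 h. \<exists>q\<in>G. \<forall>i. \<bar>p $ i - q $ i\<bar> \<le> h $ i / real (\<theta> k))" for k and G :: "(real ^ 'n) set"
  have \<theta>_pos: "0 < \<theta> k" for k by (simp add: \<theta>_def)
  have "\<exists>G. net1 k G" for k
    using finite_net_cbox[OF \<theta>_pos[of k], of "\<chi> i. - real R" "\<chi> i. real R :: real ^ 'd"]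
        by (auto simp: net1_def d_def)
  then obtain G1 where net1: "\<And>k. net1 k (G1 k)" by metis
  have "\<exists>G. net2 k G" for k
    using finite_net_cbox[OF \<theta>_pos[of k], of 0 h] h by (auto simp: net2_def N_def less_imp_le)
  then obtain G2 where net2: "\<And>k. net2 k (G2 k)" by metis
  have G1: "finite (G1 k)" "card (G1 k) \<le> (\<theta> k + 1) ^ d"
    "p \<in> cbox (\<chi> i. - real R) (\<chi> i. real R) \<Longrightarrow> \<exists>q\<in>G1 k. \<forall>i. \<bar>p $ i - q $ i\<bar> \<le> 2
        * real R / real (\<theta> k)" for k p
    using net1[of k] by (simp_all add: net1_def)
  have G2: "finite (G2 k)" "G2 k \<subseteq> cbox 0 h" "card (G2 k) \<le> (\<theta> k + 1) ^ N"
    "p \<in> cbox 0 h \<Longrightarrow> \<exists>q\<in>G2 k. \<forall>i. \<bar>p $ i - q $ i\<bar> \<le> h $ i / real (\<theta> k)" for k p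
    using net2[of k] by (simp_all add: net2_def)
  define G where "G k = G1 k \<times> G2 k" for k
  have G_fin: "finite (G k)" for k using G1 G2 by (simp add: G_def)
  have G_card: "real (card (G k)) \<le> 2 ^ \<nu> * 2 ^ (k * (q * \<nu>))" for k
  proof -
    have "card (G k) \<le> (\<theta> k + 1) ^ d * (\<theta> k + 1) ^ N"
      unfolding G_def card_cartesian_product by (intro mult_le_mono G1 G2)
    also have "\<dots> = (\<theta> k + 1) ^ \<nu>" by (simp add: \<nu>_def power_add)
    also have "\<dots> \<le> (2 * \<theta> k) ^ \<nu>" by (intro power_mono) (auto simp: \<theta>_def)
    also have "\<dots> = 2 ^ \<nu> * 2 ^ (k * (q * \<nu>))" by (simp add: \<theta>_def power_mult_distrib
        power_mult[symmetric] mult.assoc)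
    finally have "real (card (G k)) \<le> real (2 ^ \<nu> * 2 ^ (k * (q * \<nu>)))" by (rule of_nat_mono)
    then show ?thesis by simp
  qed

  define IP where "IP k S p w = increment_part (\<lambda>s. B s w) a h (2 ^ k) S (fst p) (snd p)" for k S p w
  let ?Y = "\<lambda>k S p w. IP k S p w * \<beta> ^ k"
  note moment = fbs_increment_part_moment[OF H \<alpha> \<gamma> B B_meas n_even _ _ \<eta>_def[unfolded d_def T_def,
      symmetric]]
  have r1: "(1::real) \<le> 2 ^ k" for k by simp
  have IP_meas: "IP k S p \<in> borel_measurable M" if "S \<noteq> {}" for k S p
    using moment(1)[OF r1[of k] that] by (simp add: IP_def[abs_def])
  have IP_moment: "(\<integral>\<^sup>+ w. ennreal (?Y k S p w ^ n) \<partial>M)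
      \<le> ennreal (c ^ (d * n) * (1 / 2) ^ (k * (q * \<nu> + 1))) * K"
    if S: "S \<noteq> {}" for k S p
  proof -
    have "(\<integral>\<^sup>+ w. ennreal (?Y k S p w ^ n) \<partial>M) = (\<integral>\<^sup>+ w. ennreal ((\<beta> ^ k) ^ n)
        * ennreal (IP k S p w ^ n) \<partial>M)"
    proof (intro nn_integral_cong)
      fix w
      have "?Y k S p w ^ n = (\<beta> ^ k) ^ n * IP k S p w ^ n"
        by (simp only: power_mult_distrib mult.commute)
      also have "ennreal \<dots> = ennreal ((\<beta> ^ k) ^ n) * ennreal (IP k S p w ^ n)"
        by (intro ennreal_mult zero_le_even_power n_even)
      finally show "ennreal (?Y k S p w ^ n) = ennreal ((\<beta> ^ k) ^ n) * ennreal (IP k S p w ^ n)" .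
    qed
    also have "\<dots> = ennreal ((\<beta> ^ k) ^ n) * (\<integral>\<^sup>+ w. ennreal (IP k S p w ^ n) \<partial>M)"
      using IP_meas[OF S] by (intro nn_integral_cmult) simp
    also have "\<dots> \<le> ennreal ((\<beta> ^ k) ^ n) * (ennreal (c ^ (d * n) * ((2 ^ k) powr (- \<gamma>)) ^ n) * K)"
      unfolding IP_def c_def K_def d_def \<mu>_def by (intro mult_left_mono moment(2) r1 S) simp
    also have "\<dots> = ennreal ((\<beta> ^ k) ^ n * (c ^ (d * n) * ((2 ^ k) powr (- \<gamma>)) ^ n)) * K"
      using \<beta> c by (simp add: ennreal_mult mult.assoc)
    also have "(\<beta> ^ k) ^ n * (c ^ (d * n) * ((2 ^ k) powr (- \<gamma>)) ^ n) \<le> c ^ (d * n)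
        * (1 / 2) ^ (k * (q * \<nu> + 1))"
    proof -
      have "\<beta> ^ k * (2 ^ k) powr (- \<gamma>) = 2 powr (- (real k * \<gamma> / 2))"
        by (simp add: \<beta>_def powr_realpow[symmetric] powr_powr powr_add[symmetric] mult.commute)
      then have "(\<beta> ^ k) ^ n * ((2 ^ k) powr (- \<gamma>)) ^ n = (2 powr (- (real k * \<gamma> / 2))) ^ n"
        by (simp add: power_mult_distrib[symmetric])
      also have "\<dots> = 2 powr (- (real k * (\<gamma> * real n / 2)))"
        by (simp add: powr_realpow[symmetric] powr_powr mult.assoc)
      also have "\<dots> \<le> 2 powr (- (real k * real (q * \<nu> + 1)))"
        using n_large by (intro powr_mono le_imp_neg_le mult_left_mono) auto
      also have "\<dots> = (1 / 2) ^ (k * (q * \<nu> + 1))"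
        unfolding of_nat_mult[symmetric] powr_minus
        by (subst powr_realpow) (simp_all add: power_one_over inverse_eq_divide)
      finally have "c ^ (d * n) * ((\<beta> ^ k) ^ n * ((2 ^ k) powr (- \<gamma>)) ^ n) \<le> c ^ (d * n)
          * (1 / 2) ^ (k * (q * \<nu> + 1))"
        using c by (intro mult_left_mono) auto
      then show ?thesis by (simp only: mult_ac)
    qed
    finally show ?thesis by (simp add: mult_right_mono ennreal_leI)
  qed

  define \<S> where "\<S> = Pow (UNIV :: 'd set) - {{}}"
  have \<S>: "finite \<S>" "card \<S> \<le> 2 ^ d" "\<And>S. S \<in> \<S> \<Longrightarrow> S \<noteq> {}"
  proof -
    have "card \<S> \<le> card (Pow (UNIV :: 'd set))" unfolding \<S>_def by (intro card_mono) auto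
    then show "card \<S> \<le> 2 ^ d" by (simp add: card_Pow d_def)
  qed (auto simp: \<S>_def)
  \<comment> \<open>Even n makes all terms nonnegative, so that Z dominates every single
    increment.\<close>
  define Z where "Z w = (\<Sum>k. \<Sum>p\<in>G k. \<Sum>S\<in>\<S>. ennreal (?Y k S p w ^ n))" for w
  have Zk_meas: "(\<lambda>w. \<Sum>p\<in>G k. \<Sum>S\<in>\<S>. ennreal (?Y k S p w ^ n)) \<in> borel_measurable M" for k
    using IP_meas \<S>(3) by (intro borel_measurable_sum) auto
  have Z_meas: "Z \<in> borel_measurable M" unfolding Z_def[abs_def] using Zk_meas by measurable
  define C where "C = 2 ^ \<nu> * 2 ^ d * c ^ (d * n)"
  have C: "0 \<le> C" using c by (simp add: C_def)
  have "(\<integral>\<^sup>+ w. Z w \<partial>M) = (\<Sum>k. \<integral>\<^sup>+ w. (\<Sum>p\<in>G k. \<Sum>S\<in>\<S>. ennreal (?Y k S p w ^ n)) \<partial>M)"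
    unfolding Z_def by (rule nn_integral_suminf[OF Zk_meas])
  also have "\<dots> \<le> (\<Sum>k. ennreal (C * (1 / 2) ^ k) * K)"
  proof (intro suminf_le summableI)
    fix k
    have "(\<integral>\<^sup>+ w. (\<Sum>p\<in>G k. \<Sum>S\<in>\<S>. ennreal (?Y k S p w ^ n)) \<partial>M)
        = (\<Sum>p\<in>G k. \<Sum>S\<in>\<S>. \<integral>\<^sup>+ w. ennreal (?Y k S p w ^ n) \<partial>M)"
      using IP_meas \<S>(3) by (subst nn_integral_sum) (auto intro!: sum.cong nn_integral_sum)
    also have "\<dots> \<le> (\<Sum>p\<in>G k. \<Sum>S\<in>\<S>. ennreal (c ^ (d * n) * (1 / 2) ^ (k * (q * \<nu> + 1))) * K)"
      using \<S>(3) by (intro sum_mono IP_moment)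
    also have "\<dots> = of_nat (card (G k)) * (of_nat (card \<S>)
        * (ennreal (c ^ (d * n) * (1 / 2) ^ (k * (q * \<nu> + 1))) * K))"
      by simp
    also have "\<dots> = ennreal (real (card (G k)) * (real (card \<S>)
        * (c ^ (d * n) * (1 / 2) ^ (k * (q * \<nu> + 1))))) * K"
      using c by (simp add: ennreal_mult ennreal_of_nat_eq_real_of_nat mult.assoc)
    also have "\<dots> \<le> ennreal (C * (1 / 2) ^ k) * K"
    proof (intro mult_right_mono ennreal_leI)
      have "real (card (G k)) * (real (card \<S>) * (c ^ (d * n) * (1 / 2) ^ (k * (q * \<nu> + 1))))
        \<le> (2 ^ \<nu> * 2 ^ (k * (q * \<nu>))) * (2 ^ d * (c ^ (d * n) * (1 / 2) ^ (k * (q * \<nu> + 1))))"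
      proof (intro mult_mono G_card mult_right_mono)
        have "real (card \<S>) \<le> real (2 ^ d)" using \<S>(2) by (rule of_nat_mono)
        then show "real (card \<S>) \<le> 2 ^ d" by simp
      qed (use c in auto)
      also have "\<dots> = C * ((2 ^ (k * (q * \<nu>)) * (1 / 2) ^ (k * (q * \<nu>))) * (1 / 2) ^ k)"
        by (simp only: C_def add_mult_distrib2 mult_1_right mult_1_left power_add mult_ac)
      also have "(2::real) ^ (k * (q * \<nu>)) * (1 / 2) ^ (k * (q * \<nu>)) = 1"
        by (simp add: power_mult_distrib[symmetric])
      finally show "real (card (G k)) * (real (card \<S>)
          * (c ^ (d * n) * (1 / 2) ^ (k * (q * \<nu> + 1)))) \<le> C * (1 / 2) ^ k" by simp
    qed simp
    finally show "(\<integral>\<^sup>+ w. (\<Sum>p\<in>G k. \<Sum>S\<in>\<S>. ennreal (?Y k S p w ^ n)) \<partial>M) \<le> ennreal (C * (1 / 2) ^ k) * K" .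
  qed
  also have "\<dots> = (\<Sum>k. ennreal (C * (1 / 2) ^ k)) * K" by (rule ennreal_suminf_multc)
  also have "(\<Sum>k. ennreal (C * (1 / 2) ^ k)) = ennreal (\<Sum>k. C * (1 / 2) ^ k)"
    using C by (intro suminf_ennreal2 summable_mult summable_geometric) auto
  also have "\<dots> * K < \<infinity>" using K by (simp add: ennreal_mult_less_top)
  finally have "AE w in M. Z w \<noteq> \<infinity>" using Z_meas by (intro nn_integral_PInf_AE) auto
  then show ?thesis
    using AE_space
  proof eventually_elim
    case (elim w)
    define X where "X s = B s w" for s
    have X: "X \<in> borel_measurable (restrict_space borel (cbox a (a + h)))"
      using X_meas[OF elim(2)] by (simp add: X_def[abs_def])
    let ?L = "smoothed_occupation X a h"
    obtain z where z: "0 \<le> z" "Z w = ennreal z" using elim(1) by (cases "Z w") auto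
    have IP_le: "\<bar>IP k S p w\<bar> \<le> max 1 z * (1 / \<beta>) ^ k" if p: "p \<in> G k" and S: "S \<in> \<S>" for k p S
    proof -
      have "ennreal (?Y k S p w ^ n) \<le> (\<Sum>S\<in>\<S>. ennreal (?Y k S p w ^ n))"
        by (rule member_le_sum[OF S]) (use \<S> in auto)
      also have "\<dots> \<le> (\<Sum>p\<in>G k. \<Sum>S\<in>\<S>. ennreal (?Y k S p w ^ n))"
        by (rule member_le_sum[OF p]) (use G_fin in auto)
      also have "\<dots> = (\<Sum>i\<in>{k}. \<Sum>p\<in>G i. \<Sum>S\<in>\<S>. ennreal (?Y i S p w ^ n))" by simp
      also have "\<dots> \<le> Z w" unfolding Z_def by (intro sum_le_suminf summableI) auto
      finally have "?Y k S p w ^ n \<le> z" using z by (simp add: ennreal_le_iff)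
      then have pow: "(\<bar>IP k S p w\<bar> * \<beta> ^ k) ^ n \<le> z"
        using n_even \<beta> by (simp add: power_mult_distrib power_even_abs)
      \<comment> \<open>This avoids an n-th root: a number above 1 is at most its n-th
        power.\<close>
      have "\<bar>IP k S p w\<bar> * \<beta> ^ k \<le> max 1 z"
      proof (cases "\<bar>IP k S p w\<bar> * \<beta> ^ k \<le> 1")
        case False
        then have "\<bar>IP k S p w\<bar> * \<beta> ^ k \<le> (\<bar>IP k S p w\<bar> * \<beta> ^ k) ^ n"
          using n_pos by (intro self_le_power) auto
        with pow show ?thesis by simp
      qed simp
      then have "\<bar>IP k S p w\<bar> \<le> max 1 z / \<beta> ^ k" using \<beta> by (simp add: pos_le_divide_eq)
      then show ?thesis by (simp add: power_one_over)
    qed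
    define V where "V = (\<Prod>l\<in>UNIV. h $ l)"
    define E where "E = 2 * real R * real d + 2 * real N"
    \<comment> \<open>The first term is the cost of moving to a grid point, with factor
      \<open>2 ^ (d + 1)\<close> at scale \<open>2 ^ Suc k\<close> and 1 at scale
      \<open>2 ^ k\<close>; the second bounds the at most \<open>2 ^ d\<close> parts at that grid
      point.\<close>
    define U where "U k = V * E * (2 ^ (d + 1) + 1) * (1 / 2) ^ k + 2 ^ d * (max 1 z) * (1 / \<beta>) ^ k"
        for k
    have V: "0 \<le> V" unfolding V_def using h by (intro prod_nonneg) (auto simp: less_imp_le)
    have "summable U"
      unfolding U_def using \<beta> by (intro summable_add summable_mult summable_geometric) auto
    moreover have "\<bar>?L (2 ^ Suc k) x t - ?L (2 ^ k) x t\<bar> \<le> U k"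
      if x: "\<And>i. \<bar>x $ i\<bar> \<le> real R" and t: "t \<in> cbox 0 h" for k x t
    proof -
      have "x \<in> cbox (\<chi> i. - real R) (\<chi> i. real R)" using x
          by (auto simp: mem_box_cart abs_le_iff minus_le_iff)
      from G1(3)[OF this] obtain y where y: "y \<in> G1 k" "\<And>i. \<bar>x $ i - y $ i\<bar> \<le> 2
          * real R / real (\<theta> k)" by metis
      from G2(4)[OF t] obtain u where u: "u \<in> G2 k" "\<And>l. \<bar>t $ l - u $ l\<bar> \<le> h $ l / real (\<theta> k)" by metis
      have u_box: "u \<in> cbox 0 h" using u(1) G2(2) by blast
      let ?D = "(\<Sum>i\<in>UNIV. \<bar>x $ i - y $ i\<bar>) + 2 * (\<Sum>l\<in>UNIV. \<bar>t $ l - u $ l\<bar> / h $ l)"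
      have D: "?D \<le> E / real (\<theta> k)"
      proof -
        have "(\<Sum>i\<in>UNIV. \<bar>x $ i - y $ i\<bar>) \<le> (\<Sum>i\<in>(UNIV :: 'd set). 2 * real R / real (\<theta> k))"
          by (intro sum_mono y)
        moreover have "(\<Sum>l\<in>UNIV. \<bar>t $ l - u $ l\<bar> / h $ l) \<le> (\<Sum>l\<in>(UNIV :: 'n set). 1 / real (\<theta> k))"
        proof (intro sum_mono)
          fix l
          have "\<bar>t $ l - u $ l\<bar> / h $ l \<le> (h $ l / real (\<theta> k)) / h $ l"
            using h[of l] by (intro divide_right_mono u) auto
          then show "\<bar>t $ l - u $ l\<bar> / h $ l \<le> 1 / real (\<theta> k)" using h[of l] by simp
        qed
        ultimately have "?D \<le> real d * (2 * real R / real (\<theta> k)) + 2 * (real N * (1 / real (\<theta> k)))"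
          by (simp add: d_def N_def)
        also have "\<dots> = E / real (\<theta> k)" by (simp add: E_def add_divide_distrib)
        finally show ?thesis .
      qed
      have \<theta>_eq: "(2 ^ k) ^ (d + 1) / real (\<theta> k) = (1 / 2) ^ k"
      proof -
        have "k * q = k * (d + 1) + k" by (simp add: q_def algebra_simps)
        then have "real (\<theta> k) = (2 ^ k) ^ (d + 1) * 2 ^ k"
            by (simp only: \<theta>_def power_add power_mult of_nat_power of_nat_mult of_nat_numeral)
        then show ?thesis by (simp add: power_one_over)
      qed
      have lip: "\<bar>?L r x t - ?L r y u\<bar> \<le> b * (V * E * (1 / 2) ^ k)"
        if r: "1 \<le> r" "r ^ (d + 1) = b * (2 ^ k) ^ (d + 1)" and b: "0 \<le> b" for r b
      proof -
        have "\<bar>?L r x t - ?L r y u\<bar> \<le> r ^ (d + 1) * V * ?D"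
          unfolding d_def V_def by (rule smoothed_occupation_lipschitz[OF X h t u_box r(1)])
        also have "\<dots> \<le> r ^ (d + 1) * V * (E / real (\<theta> k))"
          by (intro mult_left_mono D mult_nonneg_nonneg zero_le_power V) (use r in simp)
        also have "\<dots> = b * (V * E * ((2 ^ k) ^ (d + 1) / real (\<theta> k)))" unfolding r(2) by simp
        finally show ?thesis unfolding \<theta>_eq .
      qed
      have lip1: "\<bar>?L (2 ^ k) x t - ?L (2 ^ k) y u\<bar> \<le> 1 * (V * E * (1 / 2) ^ k)"
        by (rule lip) auto
      have lip2: "\<bar>?L (2 ^ Suc k) x t - ?L (2 ^ Suc k) y u\<bar> \<le> 2 ^ (d + 1) * (V * E * (1 / 2) ^ k)"
        using one_le_power[of "2::real" "Suc k"] by (intro lip) (auto simp: power_mult_distrib)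
      have pu: "(y, u) \<in> G k" using y(1) u(1) by (simp add: G_def)
      have "?L (2 ^ Suc k) y u - ?L (2 ^ k) y u = (\<Sum>S\<in>\<S>. IP k S (y, u) w)"
        using smoothed_occupation_double[OF X, of "2 ^ k" y u] by (simp add: \<S>_def IP_def X_def[abs_def])
      also have "\<bar>\<dots>\<bar> \<le> (\<Sum>S\<in>\<S>. max 1 z * (1 / \<beta>) ^ k)"
        by (rule order_trans[OF sum_abs sum_mono]) (rule IP_le[OF pu])
      also have "\<dots> = real (card \<S>) * (max 1 z * (1 / \<beta>) ^ k)" by simp
      also have "\<dots> \<le> real (2 ^ d) * (max 1 z * (1 / \<beta>) ^ k)"
        using \<S>(2) \<beta> by (intro mult_right_mono of_nat_mono mult_nonneg_nonneg) auto
      finally have incr: "\<bar>?L (2 ^ Suc k) y u - ?L (2 ^ k) y u\<bar> \<le> 2 ^ d * (max 1 z) * (1 / \<beta>) ^ k"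
        by (simp add: mult.assoc)
      have "U k = 2 ^ (d + 1) * (V * E * (1 / 2) ^ k) + 1 * (V * E * (1 / 2) ^ k) + 2 ^ d
          * (max 1 z) * (1 / \<beta>) ^ k"
        by (simp add: U_def algebra_simps)
      then show ?thesis using lip1 lip2 incr by linarith
    qed
    ultimately show ?case unfolding X_def by blast
  qed
qed

theorem theorem3p1:
  fixes M :: "'w measure"
    and H :: "real ^ 'n"
    and B :: "real ^ 'n \<Rightarrow> 'w \<Rightarrow> real ^ 'd"
  assumes "prob_space M"
    and "\<And>l. 0 < H $ l" and "\<And>l. H $ l < 1"
    and "fractional_brownian_sheet M H B"
    and "(\<lambda>(t, w). B t w) \<in> borel_measurable (restrict_space borel orthant \<Otimes>\<^sub>M M)"
    and "real CARD('d) < (\<Sum>l\<in>UNIV. 1 / H $ l)"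
  shows "\<forall>I\<in>pos_intervals. AE w in M. jointly_continuous_local_time (\<lambda>t. B t w) I"
proof
  interpret prob_space M by fact
  fix I :: "(real ^ 'n) set" assume "I \<in> pos_intervals"
  then obtain a b where I: "I = cbox a b" and ab: "\<And>i. a $ i < b $ i" and pos:
      "cbox a b \<subseteq> {x. \<forall>i. 0 < x $ i}"
    by (auto simp: pos_intervals_def)
  define h where "h = b - a"
  have h: "0 < h $ l" for l using ab[of l] by (simp add: h_def)
  have I': "I = cbox a (a + h)" by (simp add: I h_def)
  have "a \<in> cbox a b" using ab by (auto simp: mem_box_cart less_imp_le)
  then have a: "0 < a $ l" for l using pos by auto
  \<comment> \<open>A positive lower bound for all coordinates on the interval, capped at 1 as local
    nondeterminism requires.\<close>
  define \<alpha> where "\<alpha> = min 1 (Min (range (\<lambda>l. a $ l)))"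
  have \<alpha>: "0 < \<alpha>" "\<alpha> \<le> 1" "\<And>l. \<alpha> \<le> a $ l"
    using a by (auto simp: \<alpha>_def intro: min.coboundedI2)
  have sub: "cbox a (a + h) \<subseteq> orthant"
    using pos unfolding I[symmetric] I' by (auto simp: orthant_def less_imp_le)
  have X: "(\<lambda>s. B s w) \<in> borel_measurable (restrict_space borel (cbox a (a + h)))" if "w \<in> space M" for w
  proof -
    have "(\<lambda>s. B s w) \<in> borel_measurable (restrict_space borel orthant)"
      using measurable_compose[OF measurable_Pair2'[OF that] assms(5)] by simp
    then show ?thesis by (rule borel_measurable_restrict_subset(1)[OF _ sub])
  qed
  \<comment> \<open>Cubes of integer radius suffice, so only countably many exceptional null sets
    are united.\<close>
  have "AE w in M. \<forall>R :: nat. \<exists>U. summable U \<and> (\<forall>k x t. (\<forall>i. \<bar>x $ i\<bar> \<le> real R) \<longrightarrow> t \<in> cbox 0 h \<longrightarrow>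
      \<bar>smoothed_occupation (\<lambda>s. B s w) a h (2 ^ Suc k) x t
          - smoothed_occupation (\<lambda>s. B s w) a h (2 ^ k) x t\<bar> \<le> U k)"
    unfolding AE_all_countable
    by (intro allI AE_smoothed_occupation_increments_le[OF assms(2,3) \<alpha> h assms(4,5) X assms(6)])
  then show "AE w in M. jointly_continuous_local_time (\<lambda>t. B t w) I"
    using AE_space
  proof eventually_elim
    case (elim w)
    show ?case unfolding I' by (rule jointly_continuous_local_timeI[OF X[OF elim(2)] h])
        (use elim(1) in blast)
  qed
qed

end
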